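(* Let $L$ be a locally finite countable simplicial complex, let $X$ be a compact metrizable space and let $n \geq 1$. Then the following conditions are equivalent: (i) $\dim_{L}X \leq n$. (ii) The set of maps $f \colon X \to I^{n}$ with $\dim_{L} f =0$ forms a dense $G_{\delta}$-subset of the space $C(X,I^{n})$. (iii) There exists a map $f \colon X \to I^{n}$ such that $\dim_{L} f = 0$.
   Context: Maps are continuous and $I=[0,1]$. $C(X,I^n)$ is the space of all continuous maps $X\to I^n$ with the compact-open topology. For a normal space $X$, $L \in \mathrm{AE}(X)$ means that every map $f\colon A \to L$ defined on a closed subspace $A$ of $X$ admits an extension $\tilde f\colon X\to L$. $\Sigma^{n}L$ denotes the $n$-th iterated suspension of $L$, with $\Sigma^{0}L = L$. The dimension $\dim_{L}X$ is the smallest integer $n\ge 0$ such that $\Sigma^{n}L \in \mathrm{AE}(X)$; the relation $\dim_L X\le n$ means $\Sigma^nL\in \mathrm{AE}(X)$. For a map $f\colon X\to Y$, $\dim_{L}f=\sup\{\dim_{L}f^{-1}(y)\colon y\in Y\}$. *)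

theory Defs
  imports "HOL-Analysis.Analysis"
begin

text \<open>The quotient (final) topology on \<open>f ` topspace X\<close>.\<close>

definition final_topology :: "'a topology \<Rightarrow> ('a \<Rightarrow> 'b) \<Rightarrow> 'b topology" where
  "final_topology X f =
     topology (\<lambda>U. U \<subseteq> f ` topspace X \<and> openin X {x \<in> topspace X. f x \<in> U})"

lemma openin_final_topology:
  "openin (final_topology X f) U \<longleftrightarrow>
     U \<subseteq> f ` topspace X \<and> openin X {x \<in> topspace X. f x \<in> U}"
proof -
  have "istopology (\<lambda>U. U \<subseteq> f ` topspace X \<and> openin X {x \<in> topspace X. f x \<in> U})"
    unfolding istopology_def
  proof (rule conjI; intro allI impI)
    fix S T
    assume S: "S \<subseteq> f ` topspace X \<and> openin X {x \<in> topspace X. f x \<in> S}"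
      and T: "T \<subseteq> f ` topspace X \<and> openin X {x \<in> topspace X. f x \<in> T}"
    have "{x \<in> topspace X. f x \<in> S \<inter> T} = {x \<in> topspace X. f x \<in> S} \<inter> {x \<in> topspace X. f x \<in> T}"
      by auto
    then show "S \<inter> T \<subseteq> f ` topspace X \<and> openin X {x \<in> topspace X. f x \<in> S \<inter> T}"
      using S T by auto
  next
    fix \<K>
    assume K: "\<forall>U\<in>\<K>. U \<subseteq> f ` topspace X \<and> openin X {x \<in> topspace X. f x \<in> U}"
    have "{x \<in> topspace X. f x \<in> \<Union>\<K>} = \<Union> ((\<lambda>U. {x \<in> topspace X. f x \<in> U}) ` \<K>)"
      by auto
    moreover have "openin X (\<Union> ((\<lambda>U. {x \<in> topspace X. f x \<in> U}) ` \<K>))"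
      using K by (intro openin_Union) auto
    ultimately show "\<Union>\<K> \<subseteq> f ` topspace X \<and> openin X {x \<in> topspace X. f x \<in> \<Union>\<K>}"
      using K by auto
  qed
  then show ?thesis
    unfolding final_topology_def by (simp add: topology_inverse')
qed

lemma topspace_final_topology [simp]: "topspace (final_topology X f) = f ` topspace X"
proof -
  have "{x \<in> topspace X. f x \<in> f ` topspace X} = topspace X"
    by auto
  then have "openin (final_topology X f) (f ` topspace X)"
    by (simp add: openin_final_topology)
  then show ?thesis
    by (metis openin_final_topology openin_subset openin_topspace subset_antisym)
qed

lemma quotient_map_final_topology: "quotient_map X (final_topology X f) f"
  by (auto simp: quotient_map_def openin_final_topology)


section \<open>Simplicial complexes and their geometric realizations\<close>

definition abstract_simplicial_complex :: "'v set set \<Rightarrow> bool" where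
  "abstract_simplicial_complex K \<longleftrightarrow>
     (\<forall>s\<in>K. finite s \<and> s \<noteq> {}) \<and> (\<forall>s\<in>K. \<forall>t. t \<subseteq> s \<and> t \<noteq> {} \<longrightarrow> t \<in> K)"

definition locally_finite_complex :: "'v set set \<Rightarrow> bool" where
  "locally_finite_complex K \<longleftrightarrow> (\<forall>v\<in>\<Union>K. finite {s \<in> K. v \<in> s})"

text \<open>A point of the realization is given by its barycentric coordinates.\<close>

definition realization_carrier :: "'v set set \<Rightarrow> ('v \<Rightarrow> real) set" where
  "realization_carrier K =
     {b. (\<forall>v. 0 \<le> b v) \<and> {v. b v \<noteq> 0} \<in> K \<and> (\<Sum>v | b v \<noteq> 0. b v) = 1}"

definition closed_cell :: "'v set set \<Rightarrow> 'v set \<Rightarrow> ('v \<Rightarrow> real) set" where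
  "closed_cell K s = {b \<in> realization_carrier K. {v. b v \<noteq> 0} \<subseteq> s}"

text \<open>The weak topology determined by the closed simplices. Since simplices are finite,
  the product topology on \<open>'v \<Rightarrow> real\<close> induces the Euclidean topology on each of them.\<close>

definition realization :: "'v set set \<Rightarrow> ('v \<Rightarrow> real) topology" where
  "realization K =
     topology (\<lambda>U. U \<subseteq> realization_carrier K \<and>
       (\<forall>s\<in>K. openin (top_of_set (closed_cell K s)) (U \<inter> closed_cell K s)))"

lemma openin_realization:
  "openin (realization K) U \<longleftrightarrow>
     U \<subseteq> realization_carrier K \<and>
     (\<forall>s\<in>K. openin (top_of_set (closed_cell K s)) (U \<inter> closed_cell K s))"
proof -
  have "istopology (\<lambda>U. U \<subseteq> realization_carrier K \<and>
       (\<forall>s\<in>K. openin (top_of_set (closed_cell K s)) (U \<inter> closed_cell K s)))"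
    unfolding istopology_def
  proof (rule conjI; intro allI impI)
    fix S T
    assume S: "S \<subseteq> realization_carrier K \<and>
        (\<forall>s\<in>K. openin (top_of_set (closed_cell K s)) (S \<inter> closed_cell K s))"
      and T: "T \<subseteq> realization_carrier K \<and>
        (\<forall>s\<in>K. openin (top_of_set (closed_cell K s)) (T \<inter> closed_cell K s))"
    have "S \<inter> T \<inter> closed_cell K s = (S \<inter> closed_cell K s) \<inter> (T \<inter> closed_cell K s)" for s
      by auto
    then show "S \<inter> T \<subseteq> realization_carrier K \<and>
        (\<forall>s\<in>K. openin (top_of_set (closed_cell K s)) (S \<inter> T \<inter> closed_cell K s))"
      using S T by (metis openin_Int le_infI1)
  next
    fix \<K>
    assume K: "\<forall>U\<in>\<K>. U \<subseteq> realization_carrier K \<and>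
        (\<forall>s\<in>K. openin (top_of_set (closed_cell K s)) (U \<inter> closed_cell K s))"
    have "\<Union>\<K> \<inter> closed_cell K s = \<Union> ((\<lambda>U. U \<inter> closed_cell K s) ` \<K>)" for s
      by auto
    moreover have "openin (top_of_set (closed_cell K s)) (\<Union> ((\<lambda>U. U \<inter> closed_cell K s) ` \<K>))"
      if "s \<in> K" for s
      by (rule openin_Union) (use K that in blast)
    ultimately show "\<Union>\<K> \<subseteq> realization_carrier K \<and>
        (\<forall>s\<in>K. openin (top_of_set (closed_cell K s)) (\<Union>\<K> \<inter> closed_cell K s))"
      using K by auto
  qed
  then show ?thesis
    unfolding realization_def by (simp add: topology_inverse')
qed

lemma topspace_realization [simp]: "topspace (realization K) = realization_carrier K"
proof -
  have "realization_carrier K \<inter> closed_cell K s = closed_cell K s" for s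
    by (auto simp: closed_cell_def)
  then have "openin (realization K) (realization_carrier K)"
    by (simp add: openin_realization)
  then show ?thesis
    by (metis openin_realization openin_subset openin_topspace subset_antisym)
qed


section \<open>Iterated suspensions\<close>

text \<open>The suspension of \<open>T\<close> is the quotient of \<open>T \<times> [0,1]\<close> that collapses each of the two ends
  to a point. In order that all iterated suspensions of a space live on one type, their points
  are taken from the following datatype: \<open>Base\<close> embeds the original space, and \<open>Mid p t\<close>
  (\<open>0 < t < 1\<close>), \<open>South\<close>, \<open>North\<close> are canonical representatives of the classes in
  a suspension. The suspension of the empty space is empty.\<close>

datatype 'p susp_point = Base 'p | Mid "'p susp_point" real | South | North

definition susp_proj :: "'p susp_point \<times> real \<Rightarrow> 'p susp_point" where
  "susp_proj = (\<lambda>(p, t). if t = 0 then South else if t = 1 then North else Mid p t)"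

definition suspension :: "'p susp_point topology \<Rightarrow> 'p susp_point topology" where
  "suspension T = final_topology (prod_topology T (top_of_set {0..1})) susp_proj"

primrec iter_suspension :: "nat \<Rightarrow> 'p topology \<Rightarrow> 'p susp_point topology" where
  "iter_suspension 0 T = final_topology T Base"
| "iter_suspension (Suc n) T = suspension (iter_suspension n T)"

lemma iter_suspension_0_homeomorphic: "homeomorphic_map T (iter_suspension 0 T) Base"
  using quotient_map_final_topology[of T Base]
  by (simp add: homeomorphic_map_def inj_on_def)

lemma suspension_identifications:
  assumes "t \<in> {0..1}" "t' \<in> {0..1}"
  shows "susp_proj (p, t) = susp_proj (p', t') \<longleftrightarrow>
    p = p' \<and> t = t' \<or> t = 0 \<and> t' = 0 \<or> t = 1 \<and> t' = 1"
  using assms by (auto simp: susp_proj_def)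


section \<open>Absolute extensors and extension dimension\<close>

definition absolute_extensor :: "'p topology \<Rightarrow> 'a topology \<Rightarrow> bool" where
  "absolute_extensor L X \<longleftrightarrow>
     (\<forall>A f. closedin X A \<and> continuous_map (subtopology X A) L f \<longrightarrow>
        (\<exists>g. continuous_map X L g \<and> (\<forall>x\<in>A. g x = f x)))"

text \<open>The relation \<open>dim\<^sub>L X \<le> n\<close>.\<close>

definition ext_dim_le :: "'p topology \<Rightarrow> 'a topology \<Rightarrow> nat \<Rightarrow> bool" where
  "ext_dim_le L X n \<longleftrightarrow> absolute_extensor (iter_suspension n L) X"

text \<open>\<open>dim\<^sub>L X\<close> as an extended natural number, equal to \<open>\<infinity>\<close> if no \<open>n\<close> qualifies.\<close>

definition ext_dim :: "'p topology \<Rightarrow> 'a topology \<Rightarrow> enat" where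
  "ext_dim L X = (INF n \<in> {n. ext_dim_le L X n}. enat n)"

lemma ext_dim_le_imp: "ext_dim_le L X n \<Longrightarrow> ext_dim L X \<le> enat n"
  by (auto simp: ext_dim_def intro: INF_lower)

definition ext_dim_map ::
  "'p topology \<Rightarrow> 'a topology \<Rightarrow> 'b topology \<Rightarrow> ('a \<Rightarrow> 'b) \<Rightarrow> enat" where
  "ext_dim_map L X Y f =
     (SUP y \<in> topspace Y. ext_dim L (subtopology X {x \<in> topspace X. f x = y}))"


section \<open>Cubes and function spaces\<close>

definition cube :: "nat \<Rightarrow> (nat \<Rightarrow> real) topology" where
  "cube n = product_topology (\<lambda>_. top_of_set {0..1}) {..<n}"

text \<open>Maps are made extensional so that each map \<open>X \<rightarrow> Y\<close> is represented once.\<close>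

definition maps :: "'a topology \<Rightarrow> 'b topology \<Rightarrow> ('a \<Rightarrow> 'b) set" where
  "maps X Y = {f \<in> extensional (topspace X). continuous_map X Y f}"

definition compact_open :: "'a topology \<Rightarrow> 'b topology \<Rightarrow> ('a \<Rightarrow> 'b) topology" where
  "compact_open X Y =
     topology_generated_by {{f \<in> maps X Y. f ` C \<subseteq> U} | C U. compactin X C \<and> openin Y U}"

lemma topspace_compact_open [simp]: "topspace (compact_open X Y) = maps X Y"
proof -
  have "maps X Y = {f \<in> maps X Y. f ` {} \<subseteq> {}}"
    by simp
  then have "maps X Y \<in> {{f \<in> maps X Y. f ` C \<subseteq> U} | C U. compactin X C \<and> openin Y U}"
    using compactin_empty openin_empty by blast
  then show ?thesis
    unfolding compact_open_def topology_generated_by_topspace by blast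
qed

end

theory Submission
  imports Defs
begin

text \<open>
  Maps from compact spaces into (suspensions of) the complex are families of barycentric coordinates.

  If all fibres of \<open>f: X \<rightarrow> I\<close> have a complex \<open>M\<close> as absolute extensor, then a map from a closed
  set to the suspension of \<open>M\<close> extends to \<open>X\<close>: the part of the map that lies near the equator
  extends to the preimages of thin slabs of \<open>I\<close>, and on a staircase-shaped separator, which runs
  at different suspension heights over adjacent slabs, the extensions over neighbouring slabs can be
  matched, because the horizontal steps lie in fibres of \<open>f\<close>. On both sides of the separator the
  values lie in a cone. Applying this to one coordinate at a time gives (iii) \<open>\<Rightarrow>\<close> (i).

  Conversely, the coordinates of a generic map are constructed one at a time. Let the suspension of
  \<open>M\<close> be an absolute extensor of all fibres of \<open>p: X \<rightarrow> I\<^sup>k\<close>, and let a map from a closed set to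
  \<open>M\<close> be given. On each fibre of \<open>p\<close> the given map extends off a closed set that splits into
  small pieces with respect to a function \<open>f\<close>; changing \<open>f\<close> near each piece to a constant that
  exceeds the nearby values makes the pieces open and closed in the level sets of \<open>f\<close>, so that they
  no longer matter. To glue these local changes one first makes \<open>f\<close> generic over a fine grid of
  hyperplanes of \<open>I\<^sup>k\<close>, by induction on \<open>k\<close>. Since countably many extension problems decide
  whether \<open>M\<close> is an absolute extensor of a closed subset of \<open>X\<close>, and solvability on all fibres is
  an open condition, a Baire category argument finishes the proof.
\<close>

section \<open>Continuous functions on a compact metrizable space\<close>

text \<open>Solutions over adjacent cells of the grid must agree over the common wall, but a
  function that is right on one side of it need not be right on the other. Everything is therefore
  done relative to a closed union of fibres, the zero set of a function \<open>dl\<close>, over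
  which the function is generic already and stays frozen. Over a wall one coordinate is constant, so
  genericity there is the same task with one coordinate fewer. Errors are measured from one fixed
  function \<open>f0\<close>, so that they do not add up over many walls. The weak topology does no
  harm: a compact set meets only finitely many vertices, and finite families of real functions
  suffice. Their values are not normalized, because the cone over a complex is then a subset of an
  orthant, with the zero vector as apex, and the orthant retracts onto it by an explicit formula.
  Extension to a neighbourhood and extension over a cone both come from this retraction. The empty
  complex is separate: its suspensions are empty, whereas adding two poles to it would give two
  points.\<close>

locale compact_metrizable =
  fixes X :: "'a topology"
  assumes compactX: "compact_space X" and metrizableX: "metrizable_space X"
begin

lemma normalX: "normal_space X"
  by (rule metrizable_imp_normal_space[OF metrizableX])

text \<open>Functions are total and only their continuity is relative to \<open>A\<close>;
  restricting changes \<open>A\<close> and leaves the function alone.\<close>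

definition cf :: "'a set \<Rightarrow> ('a \<Rightarrow> real) \<Rightarrow> bool" where
  "cf A f \<longleftrightarrow> continuous_map (subtopology X A) euclideanreal f"

lemma cf_mono: "cf A f \<Longrightarrow> B \<subseteq> A \<Longrightarrow> cf B f"
  unfolding cf_def by (rule continuous_map_from_subtopology_mono)

lemma cf_const [simp]: "cf A (\<lambda>x. c)"
  by (simp add: cf_def)

lemma cf_add: "cf A f \<Longrightarrow> cf A g \<Longrightarrow> cf A (\<lambda>x. f x + g x)"
  unfolding cf_def by (rule continuous_map_add)

lemma cf_diff: "cf A f \<Longrightarrow> cf A g \<Longrightarrow> cf A (\<lambda>x. f x - g x)"
  unfolding cf_def by (rule continuous_map_diff)

lemma cf_minus: "cf A f \<Longrightarrow> cf A (\<lambda>x. - f x)"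
  unfolding cf_def by (rule continuous_map_minus)

lemma cf_mult: "cf A f \<Longrightarrow> cf A g \<Longrightarrow> cf A (\<lambda>x. f x * g x)"
  unfolding cf_def by (rule continuous_map_real_mult)

lemma cf_abs: "cf A f \<Longrightarrow> cf A (\<lambda>x. \<bar>f x\<bar>)"
  unfolding cf_def by (rule continuous_map_real_abs)

lemma cf_max: "cf A f \<Longrightarrow> cf A g \<Longrightarrow> cf A (\<lambda>x. max (f x) (g x))"
  unfolding cf_def by (rule continuous_map_real_max)

lemma cf_min: "cf A f \<Longrightarrow> cf A g \<Longrightarrow> cf A (\<lambda>x. min (f x) (g x))"
  unfolding cf_def by (rule continuous_map_real_min)

lemma cf_sum: "finite I \<Longrightarrow> (\<And>i. i \<in> I \<Longrightarrow> cf A (\<lambda>x. f x i)) \<Longrightarrow> cf A (\<lambda>x. \<Sum>i\<in>I. f x i)"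
  unfolding cf_def by (rule continuous_map_sum)

lemma cf_compose:
  assumes "cf A f" "continuous_on S h" "\<And>x. x \<in> A \<Longrightarrow> x \<in> topspace X \<Longrightarrow> f x \<in> S"
  shows "cf A (\<lambda>x. h (f x))"
proof -
  have "continuous_map (subtopology X A) (top_of_set S) f"
    using assms by (auto simp: cf_def continuous_map_in_subtopology)
  moreover have "continuous_map (top_of_set S) euclideanreal h"
    using assms(2) by simp
  ultimately show ?thesis
    unfolding cf_def using continuous_map_compose[of _ _ f _ h] by (simp add: o_def)
qed

lemma cf_divide: "cf A f \<Longrightarrow> cf A g \<Longrightarrow> (\<And>x. x \<in> A \<Longrightarrow> g x \<noteq> 0) \<Longrightarrow> cf A (\<lambda>x. f x / g x)"
  unfolding cf_def by (rule continuous_map_real_divide) auto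

lemma cf_cong: "cf A f \<Longrightarrow> (\<And>x. x \<in> A \<Longrightarrow> f x = g x) \<Longrightarrow> cf A g"
  unfolding cf_def by (erule continuous_map_eq) auto

lemma cf_Max:
  assumes "finite I" "I \<noteq> {}" "\<And>i. i \<in> I \<Longrightarrow> cf A (\<lambda>x. f x i)"
  shows "cf A (\<lambda>x. Max (f x ` I))"
  using assms
proof (induction I rule: finite_ne_induct)
  case (insert i F)
  then have "cf A (\<lambda>x. max (f x i) (Max (f x ` F)))"
    by (intro cf_max) auto
  with insert show ?case by simp
qed simp

lemma cf_Min:
  assumes "finite I" "I \<noteq> {}" "\<And>i. i \<in> I \<Longrightarrow> cf A (\<lambda>x. f x i)"
  shows "cf A (\<lambda>x. Min (f x ` I))"
  using assms
proof (induction I rule: finite_ne_induct)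
  case (insert i F)
  then have "cf A (\<lambda>x. min (f x i) (Min (f x ` F)))"
    by (intro cf_min) auto
  with insert show ?case by simp
qed simp

lemma cf_glue:
  assumes "closedin X A" "closedin X B" "cf A f" "cf B f"
  shows "cf (A \<union> B) f"
proof -
  have "continuous_map (subtopology X (A \<union> B)) euclideanreal f"
  proof (rule pasting_lemma_closed[where I = "{A, B}" and T = "\<lambda>i. i" and f = "\<lambda>i. f"])
    fix i assume i: "i \<in> {A, B}"
    then show "closedin (subtopology X (A \<union> B)) i"
      using assms by (auto intro: closedin_subset_topspace)
    have "subtopology (subtopology X (A \<union> B)) i = subtopology X i"
      using i by (auto simp: subtopology_subtopology Int_absorb1)
    then show "continuous_map (subtopology (subtopology X (A \<union> B)) i) euclideanreal f"
      using i assms(3,4) by (auto simp: cf_def)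
  qed auto
  then show ?thesis by (simp add: cf_def)
qed

lemma cf_glue_finite:
  assumes "finite I" "\<And>i. i \<in> I \<Longrightarrow> closedin X (A i)" "\<And>i. i \<in> I \<Longrightarrow> cf (A i) f"
  shows "cf (\<Union>i\<in>I. A i) f"
  using assms
proof (induction I rule: finite_induct)
  case empty
  have "subtopology X {} = discrete_topology {}"
    by (simp add: subtopology_eq_discrete_topology_empty)
  then show ?case by (simp add: cf_def)
next
  case (insert i F)
  then have "cf (A i \<union> (\<Union>i\<in>F. A i)) f"
    by (intro cf_glue closedin_Union) auto
  then show ?case by simp
qed

lemma closedin_le:
  assumes "closedin X A" "cf A f" "cf A g"
  shows "closedin X {x \<in> A. f x \<le> g x}"
proof -
  have "cf A (\<lambda>x. f x - g x)" using assms by (intro cf_diff)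
  then have "closedin (subtopology X A) {x \<in> topspace (subtopology X A). f x - g x \<in> {..0}}"
    unfolding cf_def by (rule closedin_continuous_map_preimage) (simp flip: closed_closedin)
  moreover have "{x \<in> topspace (subtopology X A). f x - g x \<in> {..0}} = {x \<in> A. f x \<le> g x}"
    using closedin_subset[OF assms(1)] by auto
  ultimately show ?thesis
    using assms(1) closedin_trans_full by metis
qed

lemma closedin_eq:
  assumes "closedin X A" "cf A f" "cf A g"
  shows "closedin X {x \<in> A. f x = g x}"
proof -
  have "{x \<in> A. f x = g x} = {x \<in> A. f x \<le> g x} \<inter> {x \<in> A. g x \<le> f x}" by auto
  then show ?thesis using closedin_le assms by auto
qed

lemma openin_less:
  assumes "cf (topspace X) f" "cf (topspace X) g"
  shows "openin X {x \<in> topspace X. f x < g x}"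
proof -
  have "{x \<in> topspace X. f x < g x} = topspace X - {x \<in> topspace X. g x \<le> f x}" by auto
  then show ?thesis using closedin_le[OF closedin_topspace assms(2,1)] by auto
qed

section \<open>Tietze extension and Urysohn functions\<close>

lemma tietze:
  assumes "closedin X A" "cf A f" "\<And>x. x \<in> A \<Longrightarrow> f x \<in> T" "is_interval T" "T \<noteq> {}"
  obtains g where "\<And>B. cf B g" "\<And>x. x \<in> topspace X \<Longrightarrow> g x \<in> T" "\<And>x. x \<in> A \<Longrightarrow> g x = f x"
proof -
  obtain g where "continuous_map X euclideanreal g" "g ` topspace X \<subseteq> T" "\<And>x. x \<in> A \<Longrightarrow> g x = f x"
    using Tietze_extension_realinterval[OF normalX assms(1,4,5)] assms(2,3) unfolding cf_def
    by (metis image_subsetI)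
  then show thesis
    using that[of g] by (auto simp: cf_def continuous_map_from_subtopology)
qed

lemma urysohn:
  assumes "closedin X A" "closedin X B" "A \<inter> B = {}"
  obtains u where "\<And>C. cf C u" "\<And>x. x \<in> topspace X \<Longrightarrow> 0 \<le> u x \<and> u x \<le> 1"
    "\<And>x. x \<in> A \<Longrightarrow> u x = 0" "\<And>x. x \<in> B \<Longrightarrow> u x = 1"
proof -
  have "cf A (\<lambda>x. if x \<in> A then 0 else 1)"
    by (rule cf_cong[OF cf_const[of _ 0]]) simp
  moreover have "cf B (\<lambda>x. if x \<in> A then 0 else 1)"
    by (rule cf_cong[OF cf_const[of _ 1]]) (use assms(3) in auto)
  ultimately have cont: "cf (A \<union> B) (\<lambda>x. if x \<in> A then 0 else 1)"
    using assms by (intro cf_glue)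
  have clo: "closedin X (A \<union> B)" using assms by blast
  obtain g where
    "\<And>C. cf C g" "\<And>x. x \<in> topspace X \<Longrightarrow> g x \<in> {0..1}"
    "\<And>x. x \<in> A \<union> B \<Longrightarrow> g x = (if x \<in> A then 0 else 1)"
    by (rule tietze[OF clo cont, of "{0..1}"]) (auto simp: is_interval_cc)
  then show thesis
    using assms(3) by (intro that[of g]) auto
qed

section \<open>Uniform bounds from compactness\<close>

lemma compact_closed: "closedin X A \<Longrightarrow> compactin X A"
  using closedin_compact_space compactX by blast

lemma attains_inf:
  assumes "closedin X A" "cf A g" "A \<noteq> {}"
  obtains z where "z \<in> A" "\<And>x. x \<in> A \<Longrightarrow> g z \<le> g x"
proof -
  have "compactin (subtopology X A) A"
    using compact_closed[OF assms(1)] by (simp add: compactin_subtopology)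
  then have "compactin euclideanreal (g ` A)"
    using assms(2) image_compactin unfolding cf_def by blast
  then have "compact (g ` A)" by simp
  then obtain s where "s \<in> g ` A" "\<forall>t\<in>g ` A. s \<le> t"
    using compact_attains_inf[of "g ` A"] assms(3) by auto
  then show thesis using that by auto
qed

lemma pos_min:
  assumes "closedin X A" "cf A g" "\<And>x. x \<in> A \<Longrightarrow> 0 < g x"
  obtains m where "0 < m" "\<And>x. x \<in> A \<Longrightarrow> m \<le> g x"
proof (cases "A = {}")
  case True
  with that[of 1] show thesis by auto
next
  case False
  with attains_inf[OF assms(1,2)] assms(3) that show thesis by metis
qed

lemma cf_bounded:
  assumes "closedin X A" "cf A g"
  obtains M where "0 < M" "\<And>x. x \<in> A \<Longrightarrow> \<bar>g x\<bar> \<le> M"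
proof (cases "A = {}")
  case True
  with that[of 1] show thesis by auto
next
  case False
  have "cf A (\<lambda>x. - \<bar>g x\<bar>)" using assms by (intro cf_minus cf_abs)
  with attains_inf[OF assms(1) _ False] obtain z where "\<And>x. x \<in> A \<Longrightarrow> \<bar>g x\<bar> \<le> \<bar>g z\<bar>"
    by (metis neg_le_iff_le)
  then show thesis using that[of "\<bar>g z\<bar> + 1"] by fastforce
qed

text \<open>On the compact set \<open>Y - U\<close> the function has a positive lower bound, and
  half of it excludes that set. In this way a neighbourhood of a zero set is replaced by a sublevel
  set.\<close>

lemma zero_set_nbhd:
  assumes "closedin X Y" "cf Y g" "openin X U" "\<And>x. x \<in> Y \<Longrightarrow> 0 \<le> g x"
    "\<And>x. x \<in> Y \<Longrightarrow> g x = 0 \<Longrightarrow> x \<in> U"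
  obtains \<eta> where "0 < \<eta>" "\<And>x. x \<in> Y \<Longrightarrow> g x \<le> \<eta> \<Longrightarrow> x \<in> U"
proof -
  have "closedin X (Y - U)" using assms(1,3) by (simp add: closedin_diff)
  moreover have "cf (Y - U) g" using assms(2) cf_mono by blast
  moreover have "0 < g x" if "x \<in> Y - U" for x using assms(4)[of x] assms(5)[of x] that by force
  ultimately obtain m where m: "0 < m" "\<And>x. x \<in> Y - U \<Longrightarrow> m \<le> g x" by (metis pos_min)
  show thesis by (rule that[of "m/2"]) (use m in \<open>fastforce+\<close>)
qed

lemma finite_subcover:
  assumes "closedin X Y" "\<And>x. x \<in> Y \<Longrightarrow> openin X (U x) \<and> x \<in> U x"
  obtains F where "finite F" "F \<subseteq> Y" "Y \<subseteq> (\<Union>x\<in>F. U x)"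
proof -
  have "compactin X Y" using assms compact_closed by blast
  then have "\<exists>\<F>. finite \<F> \<and> \<F> \<subseteq> U ` Y \<and> Y \<subseteq> \<Union>\<F>"
    unfolding compactin_def using assms(2) by (elim conjE allE[where x = "U ` Y"]) auto
  then obtain \<F> where "finite \<F>" "\<F> \<subseteq> U ` Y" "Y \<subseteq> \<Union>\<F>" by blast
  then obtain F where "finite F" "F \<subseteq> Y" "\<F> = U ` F" by (metis finite_subset_image)
  then show thesis using that \<open>Y \<subseteq> \<Union>\<F>\<close> by blast
qed

lemma closed_nbhd:
  assumes "closedin X A" "openin X U" "A \<subseteq> U"
  obtains N V where "closedin X N" "openin X V" "A \<subseteq> V" "V \<subseteq> N" "N \<subseteq> U"
proof -
  have "closedin X (topspace X - U)" "A \<inter> (topspace X - U) = {}"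
    using assms by auto
  then obtain u where u: "\<And>C. cf C u" "\<And>x. x \<in> A \<Longrightarrow> u x = 0" "\<And>x. x \<in> topspace X - U \<Longrightarrow> u x = (1::real)"
    by (metis urysohn assms(1))
  show thesis
  proof (rule that)
    show "closedin X {x \<in> topspace X. u x \<le> 1/2}" by (intro closedin_le) (auto simp: u)
    show "openin X {x \<in> topspace X. u x < 1/2}" by (intro openin_less) (auto simp: u)
    show "A \<subseteq> {x \<in> topspace X. u x < 1/2}" using closedin_subset[OF assms(1)] u by auto
    show "{x \<in> topspace X. u x \<le> 1/2} \<subseteq> U" using u(3) by fastforce
  qed auto
qed

end

section \<open>Maps into simplicial complexes\<close>

text \<open>The least \<open>b \<ge> 0\<close> such that no nonempty nonface lies in the set of
  vertices of \<open>W\<close> with coordinate above \<open>b\<close>. Subtracting it leaves a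
  vector that is zero or supported on a simplex.\<close>

definition nonface_level :: "'w set set \<Rightarrow> 'w set \<Rightarrow> ('w \<Rightarrow> real) \<Rightarrow> real" where
  "nonface_level K W c = Max (insert 0 ((\<lambda>s. Min (c ` s)) ` {s. s \<subseteq> W \<and> s \<noteq> {} \<and> s \<notin> K}))"

definition push :: "'w set set \<Rightarrow> 'w set \<Rightarrow> ('w \<Rightarrow> real) \<Rightarrow> 'w \<Rightarrow> real" where
  "push K W c = (\<lambda>w. if w \<in> W then max 0 (c w - nonface_level K W c) else 0)"

lemma push_nonneg: "0 \<le> push K W c w"
  by (simp add: push_def)

lemma push_outside: "w \<notin> W \<Longrightarrow> push K W c w = 0"
  by (simp add: push_def)

lemma nonface_level_ge: "finite W \<Longrightarrow> s \<subseteq> W \<Longrightarrow> s \<noteq> {} \<Longrightarrow> s \<notin> K \<Longrightarrow> Min (c ` s) \<le> nonface_level K W c"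
  unfolding nonface_level_def by (rule Max_ge) auto

lemma nonface_level_nonneg: "finite W \<Longrightarrow> 0 \<le> nonface_level K W c"
  unfolding nonface_level_def by (rule Max_ge) auto

lemma nonface_level_le:
  assumes "finite W" "0 \<le> b" "\<And>s. s \<subseteq> W \<Longrightarrow> s \<noteq> {} \<Longrightarrow> s \<notin> K \<Longrightarrow> Min (c ` s) \<le> b"
  shows "nonface_level K W c \<le> b"
  unfolding nonface_level_def using assms by (subst Max_le_iff) auto

lemma push_support:
  assumes "finite W"
  shows "{w. push K W c w \<noteq> 0} \<in> insert {} K"
proof (rule ccontr)
  let ?s = "{w. push K W c w \<noteq> 0}"
  assume a: "?s \<notin> insert {} K"
  have s: "?s = {w \<in> W. nonface_level K W c < c w}" by (auto simp: push_def)
  then have "Min (c ` ?s) \<le> nonface_level K W c"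
    using a assms by (intro nonface_level_ge) auto
  moreover have "finite ?s" using s assms by auto
  then have "Min (c ` ?s) \<in> c ` ?s" using a by (intro Min_in) auto
  ultimately show False using s by force
qed

lemma nonface_level_eq_0:
  assumes K: "abstract_simplicial_complex K" and "finite W" "{w. c w \<noteq> 0} \<in> insert {} K" "\<And>w. 0 \<le> c w"
  shows "nonface_level K W c = 0"
proof (rule antisym)
  show "nonface_level K W c \<le> 0"
  proof (rule nonface_level_le)
    fix s assume s: "s \<subseteq> W" "s \<noteq> {}" "s \<notin> K"
    have "\<exists>w\<in>s. c w = 0"
    proof (rule ccontr)
      assume "\<not> ?thesis"
      then have "s \<subseteq> {w. c w \<noteq> 0}" by auto
      with assms(3) s have "s \<in> K" using K unfolding abstract_simplicial_complex_def by blast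
      with s show False by simp
    qed
    then show "Min (c ` s) \<le> 0" using s finite_subset[OF _ assms(2)] by (auto intro!: Min_le simp: image_iff)
  qed (use assms in auto)
qed (simp add: nonface_level_nonneg assms)

lemma push_eq_self:
  assumes K: "abstract_simplicial_complex K" and "finite W" "{w. c w \<noteq> 0} \<in> insert {} K" "\<And>w. 0 \<le> c w"
    "\<And>w. w \<notin> W \<Longrightarrow> c w = 0"
  shows "push K W c = c"
  using nonface_level_eq_0[OF assms(1-4)] assms(4,5) by (auto simp: push_def)

text \<open>Raising coordinates by at most \<open>e\<close> raises every minimum by at most
  \<open>e\<close>. If \<open>c'\<close> is supported on a simplex its level is 0, so a vector that
  exceeds it by at most \<open>e\<close> has level at most \<open>e\<close>.\<close>

lemma nonface_level_mono_add:
  assumes "finite W" "0 \<le> e" "\<And>w. w \<in> W \<Longrightarrow> c w \<le> c' w + e"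
  shows "nonface_level K W c \<le> nonface_level K W c' + e"
proof (rule nonface_level_le)
  fix s assume s: "s \<subseteq> W" "s \<noteq> {}" "s \<notin> K"
  have fin: "finite s" using s assms finite_subset by blast
  then have "Min (c' ` s) \<in> c' ` s" using s by (intro Min_in) auto
  then obtain w where w: "w \<in> s" "Min (c' ` s) = c' w" by auto
  have "Min (c ` s) \<le> c w" using w fin by (intro Min_le) auto
  also have "\<dots> \<le> c' w + e" using assms w s by auto
  also have "c' w \<le> nonface_level K W c'" using nonface_level_ge[OF assms(1) s, of c'] w by simp
  finally show "Min (c ` s) \<le> nonface_level K W c' + e" by simp
qed (use assms nonface_level_nonneg[OF assms(1), of K c'] in auto)

context compact_metrizable
begin

lemma cf_nonface_level:
  assumes "finite W" "\<And>w. w \<in> W \<Longrightarrow> cf A (\<lambda>x. c x w)"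
  shows "cf A (\<lambda>x. nonface_level K W (c x))"
proof -
  let ?I = "{s. s \<subseteq> W \<and> s \<noteq> {} \<and> s \<notin> K}"
  have fin: "finite ?I" using assms(1) by simp
  show ?thesis
  proof (cases "?I = {}")
    case True
    have "nonface_level K W (c x) = 0" for x unfolding nonface_level_def True by simp
    then show ?thesis by simp
  next
    case False
    have "cf A (\<lambda>x. Max ((\<lambda>s. Min (c x ` s)) ` ?I))"
    proof (rule cf_Max[OF fin False])
      fix s assume "s \<in> ?I"
      then show "cf A (\<lambda>x. Min (c x ` s))"
        using assms finite_subset by (intro cf_Min) auto
    qed
    then have "cf A (\<lambda>x. max 0 (Max ((\<lambda>s. Min (c x ` s)) ` ?I)))" by (intro cf_max) auto
    moreover have "nonface_level K W (c x) = max 0 (Max ((\<lambda>s. Min (c x ` s)) ` ?I))" for x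
      unfolding nonface_level_def using fin False by (subst Max_insert) auto
    ultimately show ?thesis by simp
  qed
qed

lemma cf_push:
  assumes "finite W" "\<And>w. w \<in> W \<Longrightarrow> cf A (\<lambda>x. c x w)"
  shows "cf A (\<lambda>x. push K W (c x) w)"
  unfolding push_def using assms
  by (cases "w \<in> W") (auto intro!: cf_max cf_diff cf_nonface_level)

text \<open>Maps into the realization of \<open>K\<close>, in barycentric coordinates that are not normalized to
  have sum 1.\<close>

definition cm :: "'w set set \<Rightarrow> 'a set \<Rightarrow> ('a \<Rightarrow> 'w \<Rightarrow> real) \<Rightarrow> bool" where
  "cm K A \<phi> \<longleftrightarrow> (\<forall>w. cf A (\<lambda>x. \<phi> x w)) \<and> (\<forall>x\<in>A. (\<forall>w. 0 \<le> \<phi> x w) \<and> {w. \<phi> x w \<noteq> 0} \<in> K) \<and>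
     finite {w. \<exists>x\<in>A. \<phi> x w \<noteq> 0}"

lemma cmI:
  assumes "\<And>w. cf A (\<lambda>x. \<phi> x w)" "\<And>x w. x \<in> A \<Longrightarrow> 0 \<le> \<phi> x w" "\<And>x. x \<in> A \<Longrightarrow> {w. \<phi> x w \<noteq> 0} \<in> K"
    "finite W" "\<And>x w. x \<in> A \<Longrightarrow> w \<notin> W \<Longrightarrow> \<phi> x w = 0"
  shows "cm K A \<phi>"
proof -
  have "{w. \<exists>x\<in>A. \<phi> x w \<noteq> 0} \<subseteq> W" using assms(5) by auto
  then show ?thesis using assms finite_subset by (auto simp: cm_def)
qed

lemma cmD:
  assumes "cm K A \<phi>"
  shows "cf A (\<lambda>x. \<phi> x w)" "x \<in> A \<Longrightarrow> 0 \<le> \<phi> x w" "x \<in> A \<Longrightarrow> {w. \<phi> x w \<noteq> 0} \<in> K"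
  using assms by (auto simp: cm_def)

lemma cm_vertices:
  assumes "cm K A \<phi>"
  obtains W where "finite W" "\<And>x w. x \<in> A \<Longrightarrow> w \<notin> W \<Longrightarrow> \<phi> x w = 0"
  using assms unfolding cm_def by blast

lemma cm_mono:
  assumes "cm K A \<phi>" "B \<subseteq> A"
  shows "cm K B \<phi>"
proof -
  obtain W where "finite W" "\<And>x w. x \<in> A \<Longrightarrow> w \<notin> W \<Longrightarrow> \<phi> x w = 0" using cm_vertices assms(1) by blast
  then show ?thesis
    using assms(2) cf_mono[OF cmD(1)[OF assms(1)] assms(2)] cmD(2,3)[OF assms(1)]
    by (intro cmI[of B \<phi> K W]) blast+
qed

lemma cm_mono_complex: "cm K A \<phi> \<Longrightarrow> (\<And>x. x \<in> A \<Longrightarrow> {w. \<phi> x w \<noteq> 0} \<in> K') \<Longrightarrow> cm K' A \<phi>"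
  by (auto simp: cm_def)

lemma cm_insert: "cm K A \<phi> \<Longrightarrow> cm (insert {} K) A \<phi>"
  by (auto simp: cm_def)

lemma cm_cong:
  assumes "cm K A \<phi>" "\<And>x. x \<in> A \<Longrightarrow> \<phi> x = \<psi> x"
  shows "cm K A \<psi>"
proof -
  obtain W where W: "finite W" "\<And>x w. x \<in> A \<Longrightarrow> w \<notin> W \<Longrightarrow> \<phi> x w = 0" using cm_vertices assms(1) by blast
  show ?thesis
  proof (rule cmI[of A \<psi> K W])
    show "cf A (\<lambda>x. \<psi> x w)" for w
      by (rule cf_cong[OF cmD(1)[OF assms(1), of w]]) (simp add: assms(2))
    fix x assume "x \<in> A"
    then show "{w. \<psi> x w \<noteq> 0} \<in> K" "0 \<le> \<psi> x w" "w \<notin> W \<Longrightarrow> \<psi> x w = 0" for w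
      using assms(2)[of x] cmD(2,3)[OF assms(1), of x] W(2)[of x] by simp_all
  qed (rule W)
qed

lemma cm_glue:
  assumes "closedin X A" "closedin X B" "cm K A \<phi>" "cm K B \<phi>"
  shows "cm K (A \<union> B) \<phi>"
proof -
  obtain W1 where W1: "finite W1" "\<And>x w. x \<in> A \<Longrightarrow> w \<notin> W1 \<Longrightarrow> \<phi> x w = 0" using cm_vertices assms(3) by blast
  obtain W2 where W2: "finite W2" "\<And>x w. x \<in> B \<Longrightarrow> w \<notin> W2 \<Longrightarrow> \<phi> x w = 0" using cm_vertices assms(4) by blast
  show ?thesis
  proof (rule cmI[of _ _ _ "W1 \<union> W2"])
    show "cf (A \<union> B) (\<lambda>x. \<phi> x w)" for w
      by (intro cf_glue assms cmD(1)[OF assms(3)] cmD(1)[OF assms(4)])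
    show "finite (W1 \<union> W2)" using W1 W2 by simp
    fix x assume "x \<in> A \<union> B"
    then show "{w. \<phi> x w \<noteq> 0} \<in> K" "0 \<le> \<phi> x w" for w
      using cmD(2,3)[OF assms(3), of x] cmD(2,3)[OF assms(4), of x] by blast+
    show "\<phi> x w = 0" if "w \<notin> W1 \<union> W2" for w
      using W1(2)[of x w] W2(2)[of x w] that \<open>x \<in> A \<union> B\<close> by blast
  qed
qed

lemma cm_glue_if:
  assumes "closedin X A" "closedin X B" "cm K A \<phi>" "cm K B \<psi>" "\<And>x. x \<in> A \<Longrightarrow> x \<in> B \<Longrightarrow> \<phi> x = \<psi> x"
  shows "cm K (A \<union> B) (\<lambda>x. if x \<in> A then \<phi> x else \<psi> x)"
  by (intro cm_glue assms(1,2) cm_cong[OF assms(3)] cm_cong[OF assms(4)]) (simp_all add: assms(5))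

lemma cm_glue_finite:
  assumes "finite I" "\<And>i. i \<in> I \<Longrightarrow> closedin X (A i)" "\<And>i. i \<in> I \<Longrightarrow> cm K (A i) \<phi>"
  shows "cm K (\<Union>i\<in>I. A i) \<phi>"
  using assms
proof (induction I rule: finite_induct)
  case empty
  show ?case using cf_glue_finite[of "{}"] by (simp add: cm_def)
next
  case (insert i F)
  then have "cm K (A i \<union> (\<Union>i\<in>F. A i)) \<phi>"
    by (intro cm_glue closedin_Union) auto
  then show ?case by simp
qed

lemma cm_sum_pos:
  assumes "cm K A \<phi>" "{} \<notin> K" "finite W" "\<And>x w. x \<in> A \<Longrightarrow> w \<notin> W \<Longrightarrow> \<phi> x w = 0" "x \<in> A"
  shows "0 < (\<Sum>w\<in>W. \<phi> x w)"
proof -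
  have "{w. \<phi> x w \<noteq> 0} \<noteq> {}" using cmD(3)[OF assms(1,5)] assms(2) by metis
  then obtain w where "\<phi> x w \<noteq> 0" by auto
  then have "w \<in> W" "0 < \<phi> x w" using assms(4,5) cmD(2)[OF assms(1,5), of w] by force+
  then show ?thesis using assms(3) cmD(2)[OF assms(1,5)] by (intro sum_pos2[of W w]) auto
qed

text \<open>Pushing down by the largest level at which a set of vertices fails to be a simplex is a
  retraction of the orthant onto the cone over the complex; this gives all extension properties
  of simplicial complexes.\<close>

lemma cm_extend_push:
  assumes K: "abstract_simplicial_complex K" and "closedin X A" "cm (insert {} K) A \<rho>"
  obtains \<rho>' where "cm (insert {} K) (topspace X) \<rho>'" "\<And>x. x \<in> A \<Longrightarrow> \<rho>' x = \<rho> x"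
proof -
  obtain W where W: "finite W" "\<And>x w. x \<in> A \<Longrightarrow> w \<notin> W \<Longrightarrow> \<rho> x w = 0" using cm_vertices assms(3) by blast
  have "\<exists>g. (\<forall>B. cf B g) \<and> (\<forall>x\<in>topspace X. g x \<in> {0..}) \<and> (\<forall>x\<in>A. g x = \<rho> x w)" for w
  proof -
    obtain g where "\<And>B. cf B g" "\<And>x. x \<in> topspace X \<Longrightarrow> g x \<in> {0..}" "\<And>x. x \<in> A \<Longrightarrow> g x = \<rho> x w"
      by (rule tietze[OF assms(2) cmD(1)[OF assms(3), of w], of "{0..}"])
        (auto simp: cmD(2)[OF assms(3)] is_interval_ci)
    then show ?thesis by blast
  qed
  then obtain c where "\<And>w. (\<forall>B. cf B (c w)) \<and> (\<forall>x\<in>topspace X. c w x \<in> {0..}) \<and> (\<forall>x\<in>A. c w x = \<rho> x w)"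
    by metis
  then have c: "\<And>w B. cf B (c w)" "\<And>w x. x \<in> topspace X \<Longrightarrow> 0 \<le> c w x" "\<And>w x. x \<in> A \<Longrightarrow> c w x = \<rho> x w"
    by auto
  define \<rho>' where "\<rho>' = (\<lambda>x. push K W (\<lambda>w. c w x))"
  show thesis
  proof (rule that)
    show "cm (insert {} K) (topspace X) \<rho>'"
    proof (rule cmI[OF _ _ _ W(1)])
      show "cf (topspace X) (\<lambda>x. \<rho>' x w)" for w
        unfolding \<rho>'_def by (rule cf_push[OF W(1)]) (rule c)
      show "{w. \<rho>' x w \<noteq> 0} \<in> insert {} K" for x
        unfolding \<rho>'_def by (rule push_support[OF W(1)])
    qed (auto simp: \<rho>'_def push_nonneg push_outside)
    fix x assume "x \<in> A"
    then show "\<rho>' x = \<rho> x"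
      using c(3)[of x] cmD(2,3)[OF assms(3), of x] W(2)[of x] push_eq_self[OF K W(1), of "\<rho> x"]
      by (simp add: \<rho>'_def)
  qed
qed

text \<open>The map extends to the whole space with values in the cone. The apex is the only
  obstacle, and the sum of the coordinates is positive on \<open>A\<close>, hence on a
  neighbourhood.\<close>

lemma cm_extend_nbhd:
  assumes K: "abstract_simplicial_complex K" and A: "closedin X A" "cm K A \<phi>"
  obtains N V \<phi>' where "closedin X N" "openin X V" "A \<subseteq> V" "V \<subseteq> N" "cm K N \<phi>'" "\<And>x. x \<in> A \<Longrightarrow> \<phi>' x = \<phi> x"
proof -
  obtain \<rho> where \<rho>: "cm (insert {} K) (topspace X) \<rho>" "\<And>x. x \<in> A \<Longrightarrow> \<rho> x = \<phi> x"
    using cm_extend_push[OF K A(1) cm_insert[OF A(2)]] by blast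
  obtain W where W: "finite W" "\<And>x w. x \<in> topspace X \<Longrightarrow> w \<notin> W \<Longrightarrow> \<rho> x w = 0" using cm_vertices \<rho>(1) by blast
  have sub: "A \<subseteq> topspace X" using A closedin_subset by blast
  have K0: "{} \<notin> K" using K by (auto simp: abstract_simplicial_complex_def)
  let ?U = "{x \<in> topspace X. 0 < (\<Sum>w\<in>W. \<rho> x w)}"
  have "openin X ?U" by (intro openin_less cf_sum W cmD(1)[OF \<rho>(1)]) auto
  moreover have "A \<subseteq> ?U"
  proof
    fix x assume x: "x \<in> A"
    have "\<phi> y w = 0" if "y \<in> A" "w \<notin> W" for y w
      using W(2)[of y w] \<rho>(2)[of y] that sub by auto
    then have "0 < (\<Sum>w\<in>W. \<phi> x w)" by (rule cm_sum_pos[OF A(2) K0 W(1) _ x])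
    then show "x \<in> ?U" using sub x \<rho>(2)[OF x] by auto
  qed
  ultimately obtain N V where N: "closedin X N" "openin X V" "A \<subseteq> V" "V \<subseteq> N" "N \<subseteq> ?U"
    using closed_nbhd[OF A(1)] by blast
  have "cm K N \<rho>"
  proof (rule cm_mono_complex[OF cm_mono[OF \<rho>(1)]])
    show "N \<subseteq> topspace X" using N(5) by blast
    fix x assume x: "x \<in> N"
    then have "x \<in> topspace X" "(\<Sum>w\<in>W. \<rho> x w) \<noteq> 0" using N(5) by auto
    then have "{w. \<rho> x w \<noteq> 0} \<noteq> {}" by (auto intro: ccontr)
    then show "{w. \<rho> x w \<noteq> 0} \<in> K" using cmD(3)[OF \<rho>(1), of x] \<open>x \<in> topspace X\<close> by auto
  qed
  then show thesis using that N \<rho>(2) by blast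
qed

section \<open>Absolute extensors in terms of coordinates\<close>

definition AEc :: "'w set set \<Rightarrow> 'a set \<Rightarrow> bool" where
  "AEc K Y \<longleftrightarrow> (\<forall>A \<phi>. closedin X A \<and> A \<subseteq> Y \<and> cm K A \<phi> \<longrightarrow> (\<exists>\<phi>'. cm K Y \<phi>' \<and> (\<forall>x\<in>A. \<phi>' x = \<phi> x)))"

lemma AEcE:
  assumes "AEc K Y" "closedin X A" "A \<subseteq> Y" "cm K A \<phi>"
  obtains \<phi>' where "cm K Y \<phi>'" "\<And>x. x \<in> A \<Longrightarrow> \<phi>' x = \<phi> x"
proof -
  have "\<exists>\<phi>'. cm K Y \<phi>' \<and> (\<forall>x\<in>A. \<phi>' x = \<phi> x)"
    using assms(1)[unfolded AEc_def, THEN spec[of _ A], THEN spec[of _ \<phi>]] assms(2-4) by simp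
  then show thesis using that by auto
qed

text \<open>Closedness of \<open>A\<close> refers to \<open>X\<close>, so a problem in
  \<open>Z\<close> is literally a problem in \<open>Y\<close>, whose solution restricts.\<close>

lemma AEc_mono:
  assumes "AEc K Y" "Z \<subseteq> Y"
  shows "AEc K Z"
  unfolding AEc_def
proof (intro allI impI; elim conjE)
  fix A \<phi> assume "closedin X A" "A \<subseteq> Z" "cm K A (\<phi> :: 'a \<Rightarrow> 'b \<Rightarrow> real)"
  then obtain \<phi>' where "cm K Y \<phi>'" "\<And>x. x \<in> A \<Longrightarrow> \<phi>' x = \<phi> x"
    using AEcE[OF assms(1), of A \<phi>] assms(2) by blast
  then show "\<exists>\<phi>'. cm K Z \<phi>' \<and> (\<forall>x\<in>A. \<phi>' x = \<phi> x)"
    using cm_mono[OF _ assms(2)] by blast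
qed

lemma AEc_Un_disjoint:
  assumes "closedin X Y" "closedin X Z" "Y \<inter> Z = {}" "AEc K Y" "AEc K Z"
  shows "AEc K (Y \<union> Z)"
  unfolding AEc_def
proof (intro allI impI; elim conjE)
  fix A \<phi> assume A: "closedin X A" "A \<subseteq> Y \<union> Z" "cm K A (\<phi> :: 'a \<Rightarrow> 'b \<Rightarrow> real)"
  obtain \<phi>1 where 1: "cm K Y \<phi>1" "\<And>x. x \<in> A \<inter> Y \<Longrightarrow> \<phi>1 x = \<phi> x"
    by (rule AEcE[OF assms(4) closedin_Int[OF A(1) assms(1)] _ cm_mono[OF A(3)]]) auto
  obtain \<phi>2 where 2: "cm K Z \<phi>2" "\<And>x. x \<in> A \<inter> Z \<Longrightarrow> \<phi>2 x = \<phi> x"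
    by (rule AEcE[OF assms(5) closedin_Int[OF A(1) assms(2)] _ cm_mono[OF A(3)]]) auto
  have "cm K (Y \<union> Z) (\<lambda>x. if x \<in> Y then \<phi>1 x else \<phi>2 x)"
    using assms 1 2 by (intro cm_glue_if) auto
  then show "\<exists>\<phi>'. cm K (Y \<union> Z) \<phi>' \<and> (\<forall>x\<in>A. \<phi>' x = \<phi> x)"
    using 1 2 A by (intro exI conjI) auto
qed

lemma AEc_UN_disjoint:
  assumes "finite I" "\<And>i. i \<in> I \<Longrightarrow> closedin X (Y i) \<and> AEc K (Y i)"
    "\<And>i j. i \<in> I \<Longrightarrow> j \<in> I \<Longrightarrow> i \<noteq> j \<Longrightarrow> Y i \<inter> Y j = {}"
  shows "AEc K (\<Union>i\<in>I. Y i)"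
  using assms
proof (induction I rule: finite_induct)
  case empty
  show ?case by (auto simp: AEc_def)
next
  case (insert i F)
  have "Y i \<inter> (\<Union>i\<in>F. Y i) = {}" using insert by auto
  moreover have "closedin X (\<Union>i\<in>F. Y i)" using insert by (intro closedin_Union) auto
  ultimately have "AEc K (Y i \<union> (\<Union>i\<in>F. Y i))"
    using insert by (intro AEc_Un_disjoint) auto
  then show ?case by simp
qed

end

section \<open>Suspensions\<close>

text \<open>For distinct new vertices \<open>S\<close> and \<open>N\<close> this is the join of
  \<open>K\<close> with the complex consisting of these two points.\<close>

definition susp :: "'w set set \<Rightarrow> 'w \<Rightarrow> 'w \<Rightarrow> 'w set set" where
  "susp K S N = {t. t \<noteq> {} \<and> t - {S, N} \<in> insert {} K \<and> \<not> (S \<in> t \<and> N \<in> t)}"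

lemma susp_complex:
  assumes "abstract_simplicial_complex K"
  shows "abstract_simplicial_complex (susp K S N)"
  unfolding abstract_simplicial_complex_def
proof (intro conjI ballI allI impI; (elim conjE)?)
  have K: "\<And>s t. s \<in> K \<Longrightarrow> t \<subseteq> s \<Longrightarrow> t \<noteq> {} \<Longrightarrow> t \<in> K" "\<And>s. s \<in> K \<Longrightarrow> finite s"
    using assms unfolding abstract_simplicial_complex_def by blast+
  fix s assume "s \<in> susp K S N"
  then have s: "s \<noteq> {}" "s - {S, N} = {} \<or> s - {S, N} \<in> K" "\<not> (S \<in> s \<and> N \<in> s)"
    unfolding susp_def mem_Collect_eq insert_iff by satx+
  show "s \<noteq> {}" by fact
  from s(2) have "finite (s - {S, N})" using K(2) by (metis finite.emptyI)
  then show "finite s" by simp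
  fix t assume t: "t \<subseteq> s" "t \<noteq> {}"
  have "t - {S, N} \<subseteq> s - {S, N}" using t by (rule_tac Diff_mono) auto
  then have "t - {S, N} = {} \<or> t - {S, N} \<in> K" using s(2) K(1) by (metis subset_empty)
  moreover have "\<not> (S \<in> t \<and> N \<in> t)" using t(1) s(3) by (metis subsetD)
  ultimately show "t \<in> susp K S N" using t(2) by (simp only: susp_def mem_Collect_eq insert_iff) simp
qed

context compact_metrizable
begin

text \<open>Coordinates are nonnegative and finitely many of them matter, so vanishing is detected
  by a single sum.\<close>

lemma closedin_zero_set:
  assumes "closedin X A" "cm (insert {} K) A \<rho>"
  shows "closedin X {x \<in> A. \<rho> x = (\<lambda>_. 0)}"
proof -
  obtain W where W: "finite W" "\<And>x w. x \<in> A \<Longrightarrow> w \<notin> W \<Longrightarrow> \<rho> x w = 0" using cm_vertices assms(2) by blast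
  have "(\<rho> x = (\<lambda>_. 0)) \<longleftrightarrow> (\<Sum>w\<in>W. \<rho> x w) = 0" if "x \<in> A" for x
    using that W cmD(2)[OF assms(2) that] by (auto simp: sum_nonneg_eq_0_iff fun_eq_iff)
  then have "{x \<in> A. \<rho> x = (\<lambda>_. 0)} = {x \<in> A. (\<Sum>w\<in>W. \<rho> x w) = 0}" by auto
  moreover have "closedin X \<dots>"
    by (intro closedin_eq assms(1) cf_const cf_sum W(1) cmD(1)[OF assms(2)])
  ultimately show ?thesis by simp
qed

lemma cm_nonzero:
  assumes "cm (insert {} K) A \<rho>" "\<And>x. x \<in> A \<Longrightarrow> \<rho> x \<noteq> (\<lambda>_. 0)"
  shows "cm K A \<rho>"
proof (rule cm_mono_complex[OF assms(1)])
  fix x assume "x \<in> A"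
  then show "{w. \<rho> x w \<noteq> 0} \<in> K" using assms(2) cmD(3)[OF assms(1)] by (fastforce simp: fun_eq_iff)
qed

lemma cm_neq_zero: "cm K A \<phi> \<Longrightarrow> abstract_simplicial_complex K \<Longrightarrow> x \<in> A \<Longrightarrow> \<phi> x \<noteq> (\<lambda>_. 0)"
  using cmD(3)[of K A \<phi> x] by (auto simp: abstract_simplicial_complex_def)

lemma cm_paste:
  assumes "finite I" "\<And>i. i \<in> I \<Longrightarrow> closedin X (T i)" "\<And>i. i \<in> I \<Longrightarrow> cm K (T i) (g i)"
    "\<And>i j x. i \<in> I \<Longrightarrow> j \<in> I \<Longrightarrow> x \<in> T i \<Longrightarrow> x \<in> T j \<Longrightarrow> g i x = g j x"
  obtains \<phi> where "cm K (\<Union>i\<in>I. T i) \<phi>" "\<And>i x. i \<in> I \<Longrightarrow> x \<in> T i \<Longrightarrow> \<phi> x = g i x"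
proof -
  define \<phi> where "\<phi> x = g (SOME i. i \<in> I \<and> x \<in> T i) x" for x
  have eq: "\<phi> x = g i x" if "i \<in> I" "x \<in> T i" for i x
  proof -
    have "(SOME i. i \<in> I \<and> x \<in> T i) \<in> I \<and> x \<in> T (SOME i. i \<in> I \<and> x \<in> T i)"
      by (rule someI[of _ i]) (use that in simp)
    then show ?thesis unfolding \<phi>_def using assms(4) that by blast
  qed
  have "cm K (\<Union>i\<in>I. T i) \<phi>"
    by (rule cm_glue_finite[OF assms(1,2)]) (auto intro: cm_cong[OF assms(3)] simp: eq)
  then show thesis using that eq by blast
qed

text \<open>A map into the suspension of a complex is encoded by its coordinates \<open>\<rho>\<close> in the complex
  together with the difference \<open>d\<close> of the coordinates at the two poles.\<close>

definition sm :: "'w set set \<Rightarrow> 'a set \<Rightarrow> ('a \<Rightarrow> 'w \<Rightarrow> real) \<Rightarrow> ('a \<Rightarrow> real) \<Rightarrow> bool" where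
  "sm K A \<rho> d \<longleftrightarrow> cm (insert {} K) A \<rho> \<and> cf A d \<and> (\<forall>x\<in>A. \<rho> x = (\<lambda>_. 0) \<longrightarrow> d x \<noteq> 0)"

definition AEs :: "'w set set \<Rightarrow> 'a set \<Rightarrow> bool" where
  "AEs K Y \<longleftrightarrow> (\<forall>A \<rho> d. closedin X A \<and> A \<subseteq> Y \<and> sm K A \<rho> d \<longrightarrow>
     (\<exists>\<rho>' d'. sm K Y \<rho>' d' \<and> (\<forall>x\<in>A. \<rho>' x = \<rho> x \<and> d' x = d x)))"

lemma sm_mono: "sm K A \<rho> d \<Longrightarrow> B \<subseteq> A \<Longrightarrow> sm K B \<rho> d"
  unfolding sm_def using cm_mono cf_mono by blast

lemma AEsE:
  assumes "AEs K Y" "closedin X A" "A \<subseteq> Y" "sm K A \<rho> d"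
  obtains \<rho>' d' where "sm K Y \<rho>' d'" "\<And>x. x \<in> A \<Longrightarrow> \<rho>' x = \<rho> x" "\<And>x. x \<in> A \<Longrightarrow> d' x = d x"
proof -
  have "\<exists>\<rho>' d'. sm K Y \<rho>' d' \<and> (\<forall>x\<in>A. \<rho>' x = \<rho> x \<and> d' x = d x)"
    using assms(1)[unfolded AEs_def, THEN spec[of _ A], THEN spec[of _ \<rho>], THEN spec[of _ d]] assms(2-4) by simp
  then show thesis using that by auto
qed

lemma AEs_mono:
  assumes "AEs K Y" "Z \<subseteq> Y"
  shows "AEs K Z"
  unfolding AEs_def
proof (intro allI impI; elim conjE)
  fix A \<rho> d assume A: "closedin X A" "A \<subseteq> Z" "sm K A (\<rho> :: 'a \<Rightarrow> 'b \<Rightarrow> real) d"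
  have "A \<subseteq> Y" using A assms by simp
  from AEsE[OF assms(1) A(1) this A(3)] obtain \<rho>' d' where
    "sm K Y \<rho>' d'" "\<And>x. x \<in> A \<Longrightarrow> \<rho>' x = \<rho> x" "\<And>x. x \<in> A \<Longrightarrow> d' x = d x" by blast
  then show "\<exists>\<rho>' d'. sm K Z \<rho>' d' \<and> (\<forall>x\<in>A. \<rho>' x = \<rho> x \<and> d' x = d x)"
    using sm_mono[OF _ assms(2)] by blast
qed

text \<open>A simplex contains at most one pole, so the two pole coordinates are the negative and
  the positive part of their difference, and \<open>d\<close> alone recovers both.\<close>

lemma AEc_susp_iff:
  assumes "S \<noteq> N" "S \<notin> \<Union>K" "N \<notin> \<Union>K"
  shows "AEc (susp K S N) Y \<longleftrightarrow> AEs K Y"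
proof
  define join where "join = (\<lambda>(\<rho> :: 'a \<Rightarrow> 'b \<Rightarrow> real) d x w.
    if w = S then max 0 (- d x) else if w = N then max 0 (d x) else \<rho> x w)"
  define base where "base = (\<lambda>(\<phi> :: 'a \<Rightarrow> 'b \<Rightarrow> real) x w. if w = S \<or> w = N then 0 else \<phi> x w)"
  define ht where "ht = (\<lambda>(\<phi> :: 'a \<Rightarrow> 'b \<Rightarrow> real) x. \<phi> x N - \<phi> x S)"
  have join: "cm (susp K S N) A (join \<rho> d)" if "sm K A \<rho> d" for A \<rho> d
  proof -
    have c: "cm (insert {} K) A \<rho>" and d: "cf A d" and nz: "\<And>x. x \<in> A \<Longrightarrow> \<rho> x = (\<lambda>_. 0) \<Longrightarrow> d x \<noteq> 0"
      using that by (auto simp: sm_def)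
    obtain W where W: "finite W" "\<And>x w. x \<in> A \<Longrightarrow> w \<notin> W \<Longrightarrow> \<rho> x w = 0" using cm_vertices c by blast
    show ?thesis
    proof (rule cmI[where W = "insert S (insert N W)"])
      show "cf A (\<lambda>x. join \<rho> d x w)" for w
        unfolding join_def using d cmD(1)[OF c, of w]
        by (cases "w = S"; cases "w = N") (simp_all add: cf_max cf_minus)
      fix x assume x: "x \<in> A"
      show "0 \<le> join \<rho> d x w" for w using cmD(2)[OF c x] by (simp add: join_def)
      show "join \<rho> d x w = 0" if "w \<notin> insert S (insert N W)" for w
        using that W(2)[OF x] by (simp add: join_def)
      have s: "{w. \<rho> x w \<noteq> 0} \<in> insert {} K" using cmD(3)[OF c x] .
      then have "\<rho> x S = 0" "\<rho> x N = 0" using assms(2,3) by auto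
      then have "{w. join \<rho> d x w \<noteq> 0} - {S, N} = {w. \<rho> x w \<noteq> 0}" by (auto simp: join_def)
      moreover have "{w. join \<rho> d x w \<noteq> 0} \<noteq> {}"
      proof (cases "\<rho> x = (\<lambda>_. 0)")
        case True
        then have "join \<rho> d x S \<noteq> 0 \<or> join \<rho> d x N \<noteq> 0" using nz[OF x] assms(1) by (auto simp: join_def)
        then show ?thesis by auto
      qed (use calculation in auto)
      ultimately show "{w. join \<rho> d x w \<noteq> 0} \<in> susp K S N"
        using s assms(1) by (auto simp: susp_def join_def)
    qed (simp add: W)
  qed
  have split: "sm K A (base \<phi>) (ht \<phi>)" if c: "cm (susp K S N) A \<phi>" for A \<phi>
  proof -
    obtain W where W: "finite W" "\<And>x w. x \<in> A \<Longrightarrow> w \<notin> W \<Longrightarrow> \<phi> x w = 0" using cm_vertices c by blast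
    have "cm (insert {} K) A (base \<phi>)"
    proof (rule cmI[OF _ _ _ W(1)])
      show "cf A (\<lambda>x. base \<phi> x w)" for w unfolding base_def using cmD(1)[OF c, of w]
        by (cases "w = S \<or> w = N") simp_all
      fix x assume x: "x \<in> A"
      show "0 \<le> base \<phi> x w" for w using cmD(2)[OF c x] by (simp add: base_def)
      show "base \<phi> x w = 0" if "w \<notin> W" for w using W(2)[OF x that] by (simp add: base_def)
      have "{w. base \<phi> x w \<noteq> 0} = {w. \<phi> x w \<noteq> 0} - {S, N}" by (auto simp: base_def)
      then show "{w. base \<phi> x w \<noteq> 0} \<in> insert {} K" using cmD(3)[OF c x] by (auto simp: susp_def)
    qed
    moreover have "cf A (ht \<phi>)" unfolding ht_def by (intro cf_diff cmD(1)[OF c])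
    moreover have "ht \<phi> x \<noteq> 0" if x: "x \<in> A" "base \<phi> x = (\<lambda>_. 0)" for x
    proof
      assume h: "ht \<phi> x = 0"
      have t: "{w. \<phi> x w \<noteq> 0} \<in> susp K S N" using cmD(3)[OF c x(1)] .
      then have "\<phi> x S = 0 \<or> \<phi> x N = 0" by (auto simp: susp_def)
      then have "\<phi> x S = 0" "\<phi> x N = 0" using h by (auto simp: ht_def)
      then have "\<phi> x w = 0" for w using x(2) by (auto simp: base_def fun_eq_iff split: if_splits)
      then show False using t by (simp add: susp_def)
    qed
    ultimately show ?thesis by (auto simp: sm_def)
  qed
  have js: "base (join \<rho> d) x = \<rho> x" "ht (join \<rho> d) x = d x" if "sm K A \<rho> d" "x \<in> A" for A \<rho> d x
  proof -
    have "{w. \<rho> x w \<noteq> 0} \<in> insert {} K" using that cmD(3) by (force simp: sm_def)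
    then have "\<rho> x S = 0" "\<rho> x N = 0" using assms(2,3) by auto
    then show "base (join \<rho> d) x = \<rho> x" "ht (join \<rho> d) x = d x" using assms(1) by (auto simp: base_def join_def ht_def fun_eq_iff)
  qed
  have sj: "join (base \<phi>) (ht \<phi>) x = \<phi> x" if "cm (susp K S N) A \<phi>" "x \<in> A" for A \<phi> x
  proof -
    have "\<phi> x S = 0 \<or> \<phi> x N = 0" using cmD(3)[OF that] by (auto simp: susp_def)
    moreover have "0 \<le> \<phi> x S" "0 \<le> \<phi> x N" using cmD(2)[OF that] by auto
    ultimately show ?thesis by (auto simp: join_def base_def ht_def fun_eq_iff)
  qed
  show "AEs K Y" if ae: "AEc (susp K S N) Y"
    unfolding AEs_def
  proof (intro allI impI; elim conjE)
    fix A \<rho> d assume A: "closedin X A" "A \<subseteq> Y" "sm K A (\<rho> :: 'a \<Rightarrow> 'b \<Rightarrow> real) d"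
    obtain \<phi> where \<phi>: "cm (susp K S N) Y \<phi>" "\<And>x. x \<in> A \<Longrightarrow> \<phi> x = join \<rho> d x"
      using AEcE[OF ae A(1,2) join[OF A(3)]] by blast
    have "base \<phi> x = \<rho> x \<and> ht \<phi> x = d x" if "x \<in> A" for x
    proof -
      have "base \<phi> x = base (join \<rho> d) x" "ht \<phi> x = ht (join \<rho> d) x"
        by (simp_all only: base_def ht_def \<phi>(2)[OF that])
      then show ?thesis using js[OF A(3) that] by simp
    qed
    then show "\<exists>\<rho>' d'. sm K Y \<rho>' d' \<and> (\<forall>x\<in>A. \<rho>' x = \<rho> x \<and> d' x = d x)"
      using split[OF \<phi>(1)] by blast
  qed
  show "AEc (susp K S N) Y" if ae: "AEs K Y"
    unfolding AEc_def
  proof (intro allI impI; elim conjE)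
    fix A \<phi> assume A: "closedin X A" "A \<subseteq> Y" "cm (susp K S N) A (\<phi> :: 'a \<Rightarrow> 'b \<Rightarrow> real)"
    obtain \<rho> d where \<rho>: "sm K Y \<rho> d" "\<And>x. x \<in> A \<Longrightarrow> \<rho> x = base \<phi> x" "\<And>x. x \<in> A \<Longrightarrow> d x = ht \<phi> x"
      using AEsE[OF ae A(1,2) split[OF A(3)]] by blast
    have "join \<rho> d x = \<phi> x" if "x \<in> A" for x
    proof -
      have "join \<rho> d x = join (base \<phi>) (ht \<phi>) x"
        by (simp only: join_def \<rho>(2,3)[OF that] case_prod_conv)
      then show ?thesis using sj[OF A(3) that] by simp
    qed
    then show "\<exists>\<phi>'. cm (susp K S N) Y \<phi>' \<and> (\<forall>x\<in>A. \<phi>' x = \<phi> x)"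
      using join[OF \<rho>(1)] by blast
  qed
qed

text \<open>The hypothesis says that the values lie in the cone over the south pole.\<close>

lemma sm_extend_cone:
  assumes K: "abstract_simplicial_complex K" and A: "closedin X A" "sm K A \<rho> d"
    and neg: "\<And>x. x \<in> A \<Longrightarrow> \<rho> x = (\<lambda>_. 0) \<Longrightarrow> d x < 0"
  obtains \<rho>' d' where "sm K (topspace X) \<rho>' d'" "\<And>x. x \<in> A \<Longrightarrow> \<rho>' x = \<rho> x" "\<And>x. x \<in> A \<Longrightarrow> d' x = d x"
proof -
  have c: "cm (insert {} K) A \<rho>" and d: "cf A d" using A by (auto simp: sm_def)
  obtain \<rho>' where \<rho>': "cm (insert {} K) (topspace X) \<rho>'" "\<And>x. x \<in> A \<Longrightarrow> \<rho>' x = \<rho> x"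
    using cm_extend_push[OF K A(1) c] by blast
  define Z where "Z = {x \<in> topspace X. \<rho>' x = (\<lambda>_. 0)}"
  have Z: "closedin X Z" unfolding Z_def by (rule closedin_zero_set[OF closedin_topspace \<rho>'(1)])
  have "cf (A \<inter> Z) (\<lambda>x. - d x)" by (rule cf_mono[OF cf_minus[OF d]]) auto
  moreover have "0 < - d x" if "x \<in> A \<inter> Z" for x using neg[of x] \<rho>'(2)[of x] that by (auto simp: Z_def)
  ultimately obtain m where m: "0 < m" "\<And>x. x \<in> A \<inter> Z \<Longrightarrow> m \<le> - d x"
    using pos_min[OF closedin_Int[OF A(1) Z]] by blast
  obtain d0 where d0: "\<And>B. cf B d0" "\<And>x. x \<in> A \<Longrightarrow> d0 x = d x"
    using tietze[OF A(1) d, of UNIV] by (metis UNIV_I UNIV_not_empty is_interval_univ)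
  \<comment> \<open>On \<open>A \<inter> Z\<close> the two prescriptions coincide because
    \<open>d \<le> - m\<close> there. On all of \<open>Z\<close>, including the zeros outside
    \<open>A\<close>, the height is at most \<open>- m\<close>, hence nonzero.\<close>
  define h where "h x = (if x \<in> A then d x else min (d0 x) (- m))" for x
  have "cf A h" by (rule cf_cong[OF d]) (simp add: h_def)
  moreover have "cf Z h"
  proof (rule cf_cong)
    show "cf Z (\<lambda>x. min (d0 x) (- m))" by (intro cf_min d0 cf_const)
    show "min (d0 x) (- m) = h x" if "x \<in> Z" for x using that m(2)[of x] d0(2)[of x] by (auto simp: h_def min_def)
  qed
  ultimately have h: "cf (A \<union> Z) h" using A(1) Z by (intro cf_glue)
  obtain d' where d': "\<And>B. cf B d'" "\<And>x. x \<in> A \<union> Z \<Longrightarrow> d' x = h x"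
    using tietze[OF closedin_Un[OF A(1) Z] h, of UNIV] by (metis UNIV_I UNIV_not_empty is_interval_univ)
  show thesis
  proof (rule that)
    have "d' x \<noteq> 0" if "x \<in> Z" for x using d'(2)[of x] m(1) m(2)[of x] that by (auto simp: h_def min_def)
    then show "sm K (topspace X) \<rho>' d'" using \<rho>'(1) d'(1) by (auto simp: sm_def Z_def)
  qed (use \<rho>'(2) d'(2) in \<open>auto simp: h_def\<close>)
qed

lemma sm_uminus: "sm K A \<rho> d \<Longrightarrow> sm K A \<rho> (\<lambda>x. - d x)"
  by (auto simp: sm_def intro: cf_minus)

lemma sm_extend_cone':
  assumes K: "abstract_simplicial_complex K" and A: "closedin X A" "sm K A \<rho> d"
    and pos: "\<And>x. x \<in> A \<Longrightarrow> \<rho> x = (\<lambda>_. 0) \<Longrightarrow> d x > 0"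
  obtains \<rho>' d' where "sm K (topspace X) \<rho>' d'" "\<And>x. x \<in> A \<Longrightarrow> \<rho>' x = \<rho> x" "\<And>x. x \<in> A \<Longrightarrow> d' x = d x"
proof -
  obtain \<rho>' d' where r: "sm K (topspace X) \<rho>' d'" "\<And>x. x \<in> A \<Longrightarrow> \<rho>' x = \<rho> x" "\<And>x. x \<in> A \<Longrightarrow> d' x = - d x"
    by (rule sm_extend_cone[OF K A(1) sm_uminus[OF A(2)]]) (use pos in auto)
  show thesis
    by (rule that[OF sm_uminus[OF r(1)]]) (use r in auto)
qed

section \<open>From the fibres to the whole space\<close>

text \<open>The sum of the coordinate differences vanishes exactly on the fibre, which reduces the
  claim to a sublevel set.\<close>

lemma fibre_nbhd:
  fixes p :: "'j \<Rightarrow> 'a \<Rightarrow> real"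
  assumes Y: "closedin X Y" and J: "finite J" "\<And>j. j \<in> J \<Longrightarrow> cf Y (p j)" and V: "openin X V"
    and sub: "\<And>x. x \<in> Y \<Longrightarrow> (\<And>j. j \<in> J \<Longrightarrow> p j x = p j x0) \<Longrightarrow> x \<in> V"
  obtains r where "0 < r" "\<And>x. x \<in> Y \<Longrightarrow> (\<And>j. j \<in> J \<Longrightarrow> \<bar>p j x - p j x0\<bar> \<le> r) \<Longrightarrow> x \<in> V"
proof -
  define g where "g x = (\<Sum>j\<in>J. \<bar>p j x - p j x0\<bar>)" for x
  have "cf Y g" unfolding g_def by (intro cf_sum cf_abs cf_diff cf_const J)
  moreover have "x \<in> V" if "x \<in> Y" "g x = 0" for x
    using sub[OF that(1)] that(2) J(1) by (auto simp: g_def sum_nonneg_eq_0_iff)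
  moreover have "0 \<le> g x" for x by (auto simp: g_def intro: sum_nonneg)
  ultimately obtain \<eta> where \<eta>: "0 < \<eta>" "\<And>x. x \<in> Y \<Longrightarrow> g x \<le> \<eta> \<Longrightarrow> x \<in> V"
    using zero_set_nbhd[OF Y _ V] by metis
  \<comment> \<open>Each of the \<open>card J\<close> summands gets an equal share; the added 1
    covers the empty family.\<close>
  show thesis
  proof (rule that[of "\<eta> / (card J + 1)"])
    show "0 < \<eta> / (card J + 1)" using \<eta> by simp
    fix x assume x: "x \<in> Y" "\<And>j. j \<in> J \<Longrightarrow> \<bar>p j x - p j x0\<bar> \<le> \<eta> / (card J + 1)"
    then have "g x \<le> card J * (\<eta> / (card J + 1))"
      unfolding g_def using sum_bounded_above[of J "\<lambda>j. \<bar>p j x - p j x0\<bar>"] by blast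
    also have "\<dots> \<le> \<eta>" using \<eta>(1) by (simp add: field_simps)
    finally show "x \<in> V" using \<eta>(2) x by blast
  qed
qed

lemma openin_ball:
  assumes "finite J" "\<And>j. j \<in> J \<Longrightarrow> cf (topspace X) (p j)"
  shows "openin X {x \<in> topspace X. \<forall>j\<in>J. \<bar>p j x - p j x0\<bar> < (r::real)}"
  using assms
proof (induction J rule: finite_induct)
  case (insert i J)
  have "{x \<in> topspace X. \<forall>j\<in>insert i J. \<bar>p j x - p j x0\<bar> < r} =
    {x \<in> topspace X. \<bar>p i x - p i x0\<bar> < r} \<inter> {x \<in> topspace X. \<forall>j\<in>J. \<bar>p j x - p j x0\<bar> < r}" by auto
  moreover have "openin X {x \<in> topspace X. \<bar>p i x - p i x0\<bar> < r}"
    using insert by (intro openin_less cf_abs cf_diff) auto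
  ultimately show ?case using insert by auto
qed simp

text \<open>A Lebesgue number for the pseudometric given by the family \<open>p\<close>. The cover
  uses half radii: a set of diameter at most \<open>\<eta>\<close> that meets a half ball stays
  inside the full ball.\<close>

lemma lebesgue_fibres:
  assumes Y: "closedin X Y" and J: "finite J" "\<And>j. j \<in> J \<Longrightarrow> cf (topspace X) (p j)"
    and loc: "\<And>x0. x0 \<in> Y \<Longrightarrow> \<exists>r>0. Q {x \<in> Y. \<forall>j\<in>J. \<bar>p j x - p j x0\<bar> \<le> r}"
    and mono: "\<And>S T. Q S \<Longrightarrow> T \<subseteq> S \<Longrightarrow> Q T"
  obtains \<eta> where "0 < \<eta>"
    "\<And>T. T \<subseteq> Y \<Longrightarrow> T \<noteq> {} \<Longrightarrow> (\<And>x y j. x \<in> T \<Longrightarrow> y \<in> T \<Longrightarrow> j \<in> J \<Longrightarrow> \<bar>p j x - p j y\<bar> \<le> \<eta>) \<Longrightarrow> Q T"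
proof -
  have "\<forall>x0\<in>Y. \<exists>r. 0 < r \<and> Q {x \<in> Y. \<forall>j\<in>J. \<bar>p j x - p j x0\<bar> \<le> r}"
    using loc by simp
  from bchoice[OF this] obtain r where r: "\<And>x0. x0 \<in> Y \<Longrightarrow> 0 < r x0 \<and> Q {x \<in> Y. \<forall>j\<in>J. \<bar>p j x - p j x0\<bar> \<le> r x0}"
    by blast
  define U where "U x0 = {x \<in> topspace X. \<forall>j\<in>J. \<bar>p j x - p j x0\<bar> < r x0 / 2}" for x0
  have "openin X (U x0) \<and> x0 \<in> U x0" if "x0 \<in> Y" for x0
  proof
    show "openin X (U x0)" unfolding U_def by (rule openin_ball[OF J])
    show "x0 \<in> U x0" using closedin_subset[OF Y] r[OF that] that by (auto simp: U_def)
  qed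
  from finite_subcover[OF Y this] obtain F where F: "finite F" "F \<subseteq> Y" "Y \<subseteq> (\<Union>x\<in>F. U x)" by blast
  show thesis
  proof (cases "Y = {}")
    case True
    then show thesis using that[of 1] by auto
  next
    case False
    then have "F \<noteq> {}" using F(3) by auto
    define \<eta> where "\<eta> = Min ((\<lambda>x. r x / 2) ` F)"
    have \<eta>: "0 < \<eta>" "\<And>x. x \<in> F \<Longrightarrow> \<eta> \<le> r x / 2"
    proof -
      have "0 < r x / 2" if "x \<in> F" for x using r[of x] F(2) that by auto
      then show "0 < \<eta>" unfolding \<eta>_def using F(1) \<open>F \<noteq> {}\<close> by (subst Min_gr_iff) auto
      show "\<eta> \<le> r x / 2" if "x \<in> F" for x unfolding \<eta>_def using F(1) that by (intro Min_le) auto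
    qed
    show thesis
    proof (rule that[OF \<eta>(1)])
      fix T assume T: "T \<subseteq> Y" "T \<noteq> {}" "\<And>x y j. x \<in> T \<Longrightarrow> y \<in> T \<Longrightarrow> j \<in> J \<Longrightarrow> \<bar>p j x - p j y\<bar> \<le> \<eta>"
      then obtain y where y: "y \<in> T" by auto
      then obtain x0 where x0: "x0 \<in> F" "y \<in> U x0" using F(3) T(1) by blast
      have "T \<subseteq> {x \<in> Y. \<forall>j\<in>J. \<bar>p j x - p j x0\<bar> \<le> r x0}"
      proof clarify
        fix x assume x: "x \<in> T"
        have "\<bar>p j x - p j x0\<bar> \<le> r x0" if "j \<in> J" for j
        proof -
          have "\<bar>p j x - p j y\<bar> \<le> \<eta>" using T(3)[OF x y that] .
          moreover have "\<bar>p j y - p j x0\<bar> < r x0 / 2" using x0(2) that by (simp add: U_def)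
          ultimately show ?thesis using \<eta>(2)[OF x0(1)] by linarith
        qed
        then show "x \<in> Y \<and> (\<forall>j\<in>J. \<bar>p j x - p j x0\<bar> \<le> r x0)" using x T(1) by blast
      qed
      moreover have "Q {x \<in> Y. \<forall>j\<in>J. \<bar>p j x - p j x0\<bar> \<le> r x0}" using r x0(1) F(2) by blast
      ultimately show "Q T" using mono by blast
    qed
  qed
qed

text \<open>Extensions over neighbouring slabs need not agree on the fibre between them, so a
  separator of constant height does not work. With different heights the two extensions are
  prescribed on disjoint parts of that fibre, and the extension property of the fibre joins
  them.\<close>

lemma AEs_of_fibres:
  fixes K :: "'w set set"
  assumes K: "abstract_simplicial_complex K" and Y: "closedin X Y" and f: "cf Y f"
    and fib: "\<And>t. AEc K {x \<in> Y. f x = t}"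
  shows "AEs K Y"
  unfolding AEs_def
proof (intro allI impI; elim conjE)
  fix A \<rho> d assume A: "closedin X A" "A \<subseteq> Y" and sm: "sm K A (\<rho> :: 'a \<Rightarrow> 'w \<Rightarrow> real) d"
  have c: "cm (insert {} K) A \<rho>" and d: "cf A d" and nz: "\<And>x. x \<in> A \<Longrightarrow> \<rho> x = (\<lambda>_. 0) \<Longrightarrow> d x \<noteq> 0"
    using sm by (auto simp: sm_def)
  obtain f' where f': "\<And>B. cf B f'" "\<And>x. x \<in> Y \<Longrightarrow> f' x = f x"
    using tietze[OF Y f, of UNIV] by (metis UNIV_I UNIV_not_empty is_interval_univ)
  obtain d0 where d0: "\<And>B. cf B d0" "\<And>x. x \<in> A \<Longrightarrow> d0 x = d x"
    using tietze[OF A(1) d, of UNIV] by (metis UNIV_I UNIV_not_empty is_interval_univ)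
  have "closedin X {x \<in> A. \<rho> x = (\<lambda>_. 0)}" by (rule closedin_zero_set[OF A(1) c])
  moreover have "cf {x \<in> A. \<rho> x = (\<lambda>_. 0)} (\<lambda>x. \<bar>d x\<bar>)" by (rule cf_mono[OF cf_abs[OF d]]) auto
  ultimately obtain m where m: "0 < m" "\<And>x. x \<in> A \<Longrightarrow> \<rho> x = (\<lambda>_. 0) \<Longrightarrow> m \<le> \<bar>d x\<bar>"
    using pos_min nz by (smt (verit) mem_Collect_eq)
  \<comment> \<open>Halving makes the bound strict: where
    \<open>\<bar>d x\<bar> \<le> \<delta>\<close> the coordinates \<open>\<rho>\<close> do not
    vanish, so near the equator the map takes values in the complex itself.\<close>
  define \<delta> where "\<delta> = m / 2"
  have \<delta>: "0 < \<delta>" "\<And>x. x \<in> A \<Longrightarrow> \<rho> x = (\<lambda>_. 0) \<Longrightarrow> \<delta> < \<bar>d x\<bar>"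
    using m by (fastforce simp: \<delta>_def)+
  define A' where "A' = {x \<in> A. \<bar>d x\<bar> \<le> \<delta>}"
  have A': "closedin X A'" unfolding A'_def by (intro closedin_le A cf_abs d cf_const)
  have cA': "cm K A' \<rho>"
    by (rule cm_nonzero[OF cm_mono[OF c]]) (use \<delta> in \<open>fastforce simp: A'_def\<close>)+
  define Q where "Q T \<longleftrightarrow> (\<exists>\<phi>. cm K (A' \<union> T) \<phi> \<and> (\<forall>x\<in>A'. \<phi> x = \<rho> x))" for T
  \<comment> \<open>The map extends to the fibre by hypothesis, and then to a neighbourhood, which
    contains a thin band. The one-element index set adapts the statements about families to a single
    function.\<close>
  have loc: "\<exists>r>0. Q {x \<in> Y. \<forall>j\<in>{()}. \<bar>f' x - f' x0\<bar> \<le> r}" if "x0 \<in> Y" for x0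
  proof -
    define F where "F = {x \<in> Y. f' x = f' x0}"
    have F: "closedin X F" unfolding F_def by (intro closedin_eq Y f' cf_const)
    have "F = {x \<in> Y. f x = f' x0}" using f'(2) by (auto simp: F_def)
    then have Fe: "AEc K F" using fib by simp
    have "cm K (A' \<inter> F) \<rho>" by (rule cm_mono[OF cA']) auto
    from AEcE[OF Fe closedin_Int[OF A' F] _ this]
    obtain \<phi> where \<phi>: "cm K F \<phi>" "\<And>x. x \<in> A' \<inter> F \<Longrightarrow> \<phi> x = \<rho> x" by auto
    have "cm K (A' \<union> F) (\<lambda>x. if x \<in> A' then \<rho> x else \<phi> x)"
      by (rule cm_glue_if[OF A' F cA' \<phi>(1)]) (simp add: \<phi>(2))
    note glued = this
    obtain N V \<phi>' where N: "closedin X N" "openin X V" "A' \<union> F \<subseteq> V" "V \<subseteq> N" "cm K N \<phi>'"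
      "\<And>x. x \<in> A' \<union> F \<Longrightarrow> \<phi>' x = (if x \<in> A' then \<rho> x else \<phi> x)"
      by (rule cm_extend_nbhd[OF K closedin_Un[OF A' F] glued]) (rule that; (assumption | simp))
    obtain r where r: "0 < r" "\<And>x. x \<in> Y \<Longrightarrow> (\<And>j. j \<in> {()} \<Longrightarrow> \<bar>f' x - f' x0\<bar> \<le> r) \<Longrightarrow> x \<in> V"
      by (rule fibre_nbhd[OF Y, of "{()}" "\<lambda>_. f'" V x0]) (use f'(1) N(2,3) in \<open>auto simp: F_def\<close>)
    have "A' \<union> {x \<in> Y. \<forall>j\<in>{()}. \<bar>f' x - f' x0\<bar> \<le> r} \<subseteq> N"
    proof
      fix x assume "x \<in> A' \<union> {x \<in> Y. \<forall>j\<in>{()}. \<bar>f' x - f' x0\<bar> \<le> r}"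
      then have "x \<in> A' \<or> x \<in> V" using r(2)[of x] by auto
      then show "x \<in> N" using N(3,4) by blast
    qed
    then have "cm K (A' \<union> {x \<in> Y. \<forall>j\<in>{()}. \<bar>f' x - f' x0\<bar> \<le> r}) \<phi>'"
      by (rule cm_mono[OF N(5)])
    moreover have "\<forall>x\<in>A'. \<phi>' x = \<rho> x" using N(6) by simp
    ultimately show ?thesis unfolding Q_def using r(1) by blast
  qed
  have Qmono: "Q T" if QS: "Q S" "T \<subseteq> S" for S T
  proof -
    obtain \<phi> where "cm K (A' \<union> S) \<phi>" "\<forall>x\<in>A'. \<phi> x = \<rho> x" using QS(1) unfolding Q_def by blast
    moreover have "A' \<union> T \<subseteq> A' \<union> S" using QS(2) by blast
    ultimately show ?thesis unfolding Q_def using cm_mono by blast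
  qed
  obtain \<eta> where \<eta>: "0 < \<eta>"
    "\<And>T. T \<subseteq> Y \<Longrightarrow> T \<noteq> {} \<Longrightarrow> (\<And>x y j. x \<in> T \<Longrightarrow> y \<in> T \<Longrightarrow> j \<in> {()} \<Longrightarrow> \<bar>f' x - f' y\<bar> \<le> \<eta>) \<Longrightarrow> Q T"
    by (rule lebesgue_fibres[where p = "\<lambda>_. f'" and J = "{()}" and Q = Q, OF Y]) (use loc Qmono f'(1) in auto)
  obtain M where M: "0 < M" "\<And>x. x \<in> Y \<Longrightarrow> \<bar>f' x\<bar> \<le> M" using cf_bounded[OF Y f'(1)] by blast
  obtain n :: nat where "2 * M / \<eta> \<le> n" using real_arch_simple by blast
  then have n: "2 * M \<le> n * \<eta>" using \<eta>(1) by (simp add: field_simps)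
  define \<tau> where "\<tau> i = real i * \<eta> - M" for i
  have \<tau>_mono: "\<tau> i \<le> \<tau> j" if "i \<le> j" for i j using that \<eta>(1) by (simp add: \<tau>_def mult_right_mono)
  have \<tau>_less: "\<tau> i < \<tau> j" if "i < j" for i j using that \<eta>(1) by (simp add: \<tau>_def mult_strict_right_mono)
  define slab where "slab i = {x \<in> Y. \<tau> i \<le> f' x \<and> f' x \<le> \<tau> (Suc i)}" for i
  have slab: "closedin X (slab i)" for i
  proof -
    have "slab i = {x \<in> Y. \<tau> i \<le> f' x} \<inter> {x \<in> Y. f' x \<le> \<tau> (Suc i)}" by (auto simp: slab_def)
    moreover have "closedin X {x \<in> Y. \<tau> i \<le> f' x}" "closedin X {x \<in> Y. f' x \<le> \<tau> (Suc i)}"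
      by (intro closedin_le Y f' cf_const)+
    ultimately show ?thesis by (metis closedin_Int)
  qed
  have slabQ: "Q (slab i)" for i
  proof (cases "slab i = {}")
    case True
    then show ?thesis using cA' by (auto simp: Q_def)
  next
    case False
    show ?thesis
      by (rule \<eta>(2)[OF _ False]) (auto simp: slab_def \<tau>_def algebra_simps abs_le_iff)
  qed
  then obtain g where g: "\<And>i. cm K (A' \<union> slab i) (g i)" "\<And>i x. x \<in> A' \<Longrightarrow> g i x = \<rho> x"
    unfolding Q_def by metis
  have cover: "\<exists>i<n. x \<in> slab i" if "x \<in> Y" for x
  proof -
    define i where "i = nat \<lfloor>(f' x + M) / \<eta>\<rfloor>"
    have pos: "0 \<le> (f' x + M) / \<eta>" using M(2)[OF that] \<eta>(1) by simp
    have i: "real i \<le> (f' x + M) / \<eta>" "(f' x + M) / \<eta> < real i + 1"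
      using pos by (auto simp: i_def)
    show ?thesis
    proof (cases "i < n")
      case True
      have "x \<in> slab i" using i \<eta>(1) that by (simp add: slab_def \<tau>_def field_simps)
      then show ?thesis using True by blast
    next
      case False
      \<comment> \<open>Counting by half-open intervals misses only the top value
        \<open>\<tau> n\<close>, which belongs to the last closed slab.\<close>
      have "f' x \<le> M" using M(2)[OF that] by simp
      then have le: "(f' x + M) / \<eta> \<le> n" using n \<eta>(1) by (simp add: field_simps)
      have "0 < n" using n M(1) by (cases n) auto
      have "real n \<le> real i" using False by simp
      then have "(f' x + M) / \<eta> = n" using le i(1) by linarith
      then have eq: "f' x = \<tau> n" using \<eta>(1) by (simp add: \<tau>_def field_simps)
      have "Suc (n - 1) = n" using \<open>0 < n\<close> by simp
      then have "x \<in> slab (n - 1)"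
        using eq \<tau>_mono[of "n - 1" n] that by (simp add: slab_def)
      then show ?thesis using \<open>0 < n\<close> by (intro exI[of _ "n - 1"]) auto
    qed
  qed
  \<comment> \<open>Alternating heights make adjacent slabs use opposite levels, and both levels
    stay in the range where \<open>\<rho>\<close> has no zeros.\<close>
  define \<sigma> where "\<sigma> i = (if even i then \<delta> else - \<delta>)" for i :: nat
  have \<sigma>: "\<bar>\<sigma> i\<bar> = \<delta>" "\<sigma> (Suc i) = - \<sigma> i" for i using \<delta>(1) by (auto simp: \<sigma>_def)
  define F where "F i = {x \<in> Y. f' x = \<tau> i}" for i
  have F: "closedin X (F i)" for i unfolding F_def by (intro closedin_eq Y f' cf_const)
  have Fs: "F i \<subseteq> slab i" "F (Suc i) \<subseteq> slab i" for i
    using \<tau>_mono[of i "Suc i"] by (auto simp: F_def slab_def)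
  \<comment> \<open>Three prescriptions on the fibre between two slabs: \<open>\<rho>\<close> on
    \<open>A'\<close>, and the two slab extensions at their own heights. The latter live on disjoint
    sets and both agree with \<open>\<rho>\<close> on \<open>A'\<close>, so the fibre admits a
    common extension.\<close>
  have ex_e: "\<exists>e. cm K (F (Suc i)) e \<and> (\<forall>x\<in>F (Suc i) \<inter> A'. e x = \<rho> x) \<and>
      (\<forall>x\<in>F (Suc i). (d0 x = \<sigma> i \<longrightarrow> e x = g i x) \<and> (d0 x = \<sigma> (Suc i) \<longrightarrow> e x = g (Suc i) x))" for i
  proof -
    define T where "T k = (if k = 0 then F (Suc i) \<inter> A' else if k = 1 then {x \<in> F (Suc i). d0 x = \<sigma> i}
      else {x \<in> F (Suc i). d0 x = \<sigma> (Suc i)})" for k :: nat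
    have Tcl: "closedin X (T k)" for k
      unfolding T_def using F A' by (auto intro!: closedin_eq d0 cf_const closedin_Int)
    define h where "h k = (if k = 0 then \<rho> else if k = 1 then g i else g (Suc i))" for k :: nat
    obtain \<phi> where \<phi>: "cm K (\<Union>k\<in>{0,1,2}. T k) \<phi>" "\<And>k x. k \<in> {0,1,2} \<Longrightarrow> x \<in> T k \<Longrightarrow> \<phi> x = h k x"
    proof (rule cm_paste[of "{0,1,2}" T K h])
      fix k :: nat assume "k \<in> {0,1,2}"
      show "closedin X (T k)" by (rule Tcl)
      have "T k \<subseteq> A'" if "k = 0" using that by (auto simp: T_def)
      moreover have "T k \<subseteq> A' \<union> slab i" if "k = 1" using that Fs(2) by (auto simp: T_def)
      moreover have "T k \<subseteq> A' \<union> slab (Suc i)" if "k = 2" using that Fs(1) by (auto simp: T_def)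
      ultimately show "cm K (T k) (h k)" using \<open>k \<in> {0,1,2}\<close> cm_mono[OF cA'] cm_mono[OF g(1)]
        by (auto simp: h_def)
    next
      fix k l x assume "k \<in> {0,1,2}" "l \<in> {0,1,2}" "x \<in> T k" "x \<in> T l"
      then show "h k x = h l x"
        using g(2) \<sigma>(2)[of i] \<sigma>(1)[of i] \<delta>(1) by (auto simp: T_def h_def split: if_splits)
    qed auto
    have cl: "closedin X (\<Union>k\<in>{0,1,2}. T k)"
      using Tcl by (intro closedin_Union) auto
    have "F (Suc i) = {x \<in> Y. f x = \<tau> (Suc i)}" using f'(2) by (auto simp: F_def)
    then have "AEc K (F (Suc i))" using fib by simp
    from AEcE[OF this cl _ \<phi>(1)] obtain e where e: "cm K (F (Suc i)) e" "\<And>x. x \<in> (\<Union>k\<in>{0,1,2}. T k) \<Longrightarrow> e x = \<phi> x"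
      by (auto simp: T_def)
    show ?thesis
    proof (intro exI conjI ballI impI)
      fix x assume x: "x \<in> F (Suc i) \<inter> A'"
      then have "x \<in> T 0" by (simp add: T_def)
      then show "e x = \<rho> x" using e(2)[of x] \<phi>(2)[of 0 x] by (simp add: h_def)
    next
      fix x assume x: "x \<in> F (Suc i)" "d0 x = \<sigma> i"
      then have "x \<in> T 1" by (simp add: T_def)
      then show "e x = g i x" using e(2)[of x] \<phi>(2)[of 1 x] by (simp add: h_def)
    next
      fix x assume x: "x \<in> F (Suc i)" "d0 x = \<sigma> (Suc i)"
      then have "x \<in> T 2" by (simp add: T_def)
      then show "e x = g (Suc i) x" using e(2)[of x] \<phi>(2)[of 2 x] by (simp add: h_def)
    qed (rule e)
  qed
  then obtain e where e: "\<And>i. cm K (F (Suc i)) (e i)" "\<And>i x. x \<in> F (Suc i) \<Longrightarrow> x \<in> A' \<Longrightarrow> e i x = \<rho> x"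
    "\<And>i x. x \<in> F (Suc i) \<Longrightarrow> d0 x = \<sigma> i \<Longrightarrow> e i x = g i x"
    "\<And>i x. x \<in> F (Suc i) \<Longrightarrow> d0 x = \<sigma> (Suc i) \<Longrightarrow> e i x = g (Suc i) x"
    by (metis IntI)
  text \<open>The staircase: vertical at height \<open>\<sigma> i\<close> over the slabs, horizontal over the interfaces.\<close>
  define T where "T k = (case k of None \<Rightarrow> A' | Some (Inl i) \<Rightarrow> {x \<in> slab i. d0 x = \<sigma> i}
    | Some (Inr i) \<Rightarrow> {x \<in> F (Suc i). \<bar>d0 x\<bar> \<le> \<delta>})" for k :: "(nat + nat) option"
  define h where "h k = (case k of None \<Rightarrow> \<rho> | Some (Inl i) \<Rightarrow> g i | Some (Inr i) \<Rightarrow> e i)" for k :: "(nat + nat) option"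
  define I where "I = insert None (Some ` ((Inl ` {..<n}) \<union> (Inr ` {..<n})) :: (nat + nat) option set)"
  have slabs_meet: "j \<le> Suc i \<and> (j = Suc i \<longrightarrow> x \<in> F (Suc i))" if "x \<in> slab i" "x \<in> slab j" "i < j" for x i j
  proof -
    have "\<tau> j \<le> \<tau> (Suc i)" using that by (auto simp: slab_def)
    then have "j \<le> Suc i" using \<tau>_less[of "Suc i" j] by (meson linorder_not_less)
    moreover from this have "j = Suc i" using that(3) by simp
    ultimately show ?thesis using that(1,2) by (simp add: slab_def F_def)
  qed
  have F_slab: "k = Suc i \<or> k = i" if "x \<in> F (Suc i)" "x \<in> slab k" for x i k
  proof -
    have "\<tau> k \<le> \<tau> (Suc i)" "\<tau> (Suc i) \<le> \<tau> (Suc k)" using that by (auto simp: slab_def F_def)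
    then have "k \<le> Suc i" "Suc i \<le> Suc k" using \<tau>_less by (meson linorder_not_less)+
    then show ?thesis by auto
  qed
  have F_inj: "k = i" if "x \<in> F (Suc i)" "x \<in> F (Suc k)" for x i k
    using that \<tau>_less[of "Suc i" "Suc k"] \<tau>_less[of "Suc k" "Suc i"] by (auto simp: F_def) (metis less_irrefl linorder_neqE_nat)
  obtain \<gamma> where \<gamma>: "cm K (\<Union>k\<in>I. T k) \<gamma>" "\<And>k x. k \<in> I \<Longrightarrow> x \<in> T k \<Longrightarrow> \<gamma> x = h k x"
  proof (rule cm_paste[of I T K h])
    show "finite I" by (simp add: I_def)
    fix k assume k: "k \<in> I"
    show "closedin X (T k)"
      unfolding T_def using slab F A' by (auto intro!: closedin_eq closedin_le cf_abs d0 cf_const split: option.split sum.split)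
    show "cm K (T k) (h k)"
      using cA' cm_mono[OF g(1), of "{x \<in> slab _. d0 x = \<sigma> _}"] cm_mono[OF e(1), of "{x \<in> F (Suc _). \<bar>d0 x\<bar> \<le> \<delta>}"]
      by (auto simp: T_def h_def split: option.split sum.split)
  next
    \<comment> \<open>Distinct slabs that meet are adjacent, and their heights have opposite signs,
      so only equal indices occur.\<close>
    have LL: "g i x = g j x" if "x \<in> slab i" "d0 x = \<sigma> i" "x \<in> slab j" "d0 x = \<sigma> j" for i j x
    proof -
      have "False" if ij: "i < j" "x \<in> slab i" "d0 x = \<sigma> i" "x \<in> slab j" "d0 x = \<sigma> j" for i j
      proof -
        have "j = Suc i" using slabs_meet[OF ij(2,4,1)] ij(1) by simp
        then show False using ij(3,5) \<sigma>[of i] \<delta>(1) by auto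
      qed
      then show ?thesis using that by (metis linorder_neqE_nat)
    qed
    have LR: "g k x = e i x" if "x \<in> slab k" "d0 x = \<sigma> k" "x \<in> F (Suc i)" for i k x
      using F_slab[OF that(3,1)] e(3,4)[OF that(3)] that(2) by auto
    fix k l x assume kl: "k \<in> I" "l \<in> I" "x \<in> T k" "x \<in> T l"
    consider "k = None" | "l = None" | i j where "k = Some (Inl i)" "l = Some (Inl j)"
      | i j where "k = Some (Inl i)" "l = Some (Inr j)" | i j where "k = Some (Inr i)" "l = Some (Inl j)"
      | i j where "k = Some (Inr i)" "l = Some (Inr j)"
      by (metis option.exhaust old.sum.exhaust)
    then show "h k x = h l x"
    proof cases
      case 1
      then show ?thesis using kl g(2) e(2) by (auto simp: T_def h_def split: option.splits sum.splits)
    next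
      case 2
      then show ?thesis using kl g(2) e(2) by (auto simp: T_def h_def split: option.splits sum.splits)
    next
      case (3 i j)
      then show ?thesis using kl LL[of x i j] by (simp add: T_def h_def)
    next
      case (4 i j)
      then show ?thesis using kl LR[of x i j] by (simp add: T_def h_def)
    next
      case (5 i j)
      then show ?thesis using kl LR[of x j i] by (simp add: T_def h_def)
    next
      case (6 i j)
      then show ?thesis using kl F_inj[of x i j] by (simp add: T_def h_def)
    qed
  qed (rule that; (assumption | simp))
  define Xm where "Xm = (\<Union>i<n. {x \<in> slab i. d0 x \<le> \<sigma> i})"
  define Xp where "Xp = (\<Union>i<n. {x \<in> slab i. \<sigma> i \<le> d0 x})"
  have Xm: "closedin X Xm" unfolding Xm_def by (intro closedin_Union) (auto intro!: closedin_le slab d0 cf_const)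
  have Xp: "closedin X Xp" unfolding Xp_def by (intro closedin_Union) (auto intro!: closedin_le slab d0 cf_const)
  have XY: "Xm \<union> Xp = Y"
  proof
    show "Xm \<union> Xp \<subseteq> Y" by (auto simp: Xm_def Xp_def slab_def)
    show "Y \<subseteq> Xm \<union> Xp"
    proof
      fix x assume "x \<in> Y"
      then obtain i where i: "i < n" "x \<in> slab i" using cover by blast
      then have "x \<in> Xm \<or> x \<in> Xp" unfolding Xm_def Xp_def
        by (cases "d0 x \<le> \<sigma> i") (force, rule disjI2, force)
      then show "x \<in> Xm \<union> Xp" by simp
    qed
  qed
  define \<Gamma> where "\<Gamma> = Xm \<inter> Xp"
  have \<Gamma>: "closedin X \<Gamma>" using Xm Xp by (auto simp: \<Gamma>_def)
  \<comment> \<open>A point both below and above the staircase lies on it: over a single slab it is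
    at height \<open>\<sigma> i\<close>; over two different slabs it lies in their common fibre, at
    a height between the two.\<close>
  have \<Gamma>T: "x \<in> (\<Union>k\<in>I. T k) \<and> \<bar>d0 x\<bar> \<le> \<delta>" if "x \<in> \<Gamma>" for x
  proof -
    obtain i j where ij: "i < n" "j < n" "x \<in> slab i" "x \<in> slab j" "d0 x \<le> \<sigma> i" "\<sigma> j \<le> d0 x"
      using \<open>x \<in> \<Gamma>\<close> by (auto simp: \<Gamma>_def Xm_def Xp_def)
    have b: "\<bar>d0 x\<bar> \<le> \<delta>" using ij(5,6) \<sigma>(1)[of i] \<sigma>(1)[of j] by linarith
    have "\<exists>k\<in>I. x \<in> T k"
    proof (cases "i = j")
      case True
      then have "x \<in> T (Some (Inl i))" using ij by (simp add: T_def)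
      then show ?thesis using ij(1) unfolding I_def by blast
    next
      case False
      define l where "l = min i j"
      have "x \<in> F (Suc l)"
      proof (cases "i < j")
        case True
        then have "j = Suc i" using slabs_meet[OF ij(3,4) True] by simp
        then show ?thesis using slabs_meet[OF ij(3,4) True] True by (simp add: l_def)
      next
        case f: False
        then have lt: "j < i" using False by simp
        then have "i = Suc j" using slabs_meet[OF ij(4,3) lt] by simp
        then show ?thesis using slabs_meet[OF ij(4,3) lt] lt by (simp add: l_def)
      qed
      then have "x \<in> T (Some (Inr l))" using b by (simp add: T_def)
      moreover have "Some (Inr l) \<in> I" using ij(1,2) unfolding I_def l_def by (auto simp: min_def)
      ultimately show ?thesis by blast
    qed
    then show ?thesis using b by blast
  qed
  define \<rho>s where "\<rho>s x = (if x \<in> A then \<rho> x else \<gamma> x)" for x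
  have "None \<in> I" by (simp add: I_def)
  have \<gamma>A: "\<gamma> x = \<rho> x" if "x \<in> A'" for x using \<gamma>(2)[OF \<open>None \<in> I\<close>, of x] that by (simp add: T_def h_def)
  have sms: "sm K (A \<union> \<Gamma>) \<rho>s d0"
  proof -
    have "cm (insert {} K) \<Gamma> \<gamma>" by (rule cm_insert[OF cm_mono[OF \<gamma>(1)]]) (use \<Gamma>T in blast)
    moreover have "\<rho> x = \<gamma> x" if "x \<in> A" "x \<in> \<Gamma>" for x
      using \<gamma>A[of x] \<Gamma>T[OF that(2)] that d0(2)[of x] by (auto simp: A'_def)
    ultimately have "cm (insert {} K) (A \<union> \<Gamma>) \<rho>s"
      unfolding \<rho>s_def by (intro cm_glue_if A(1) \<Gamma> c) auto
    moreover have "d0 x \<noteq> 0" if "x \<in> A \<union> \<Gamma>" "\<rho>s x = (\<lambda>_. 0)" for x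
    proof (cases "x \<in> A")
      case True
      then show ?thesis using nz[of x] d0(2)[of x] that by (simp add: \<rho>s_def)
    next
      case False
      then show ?thesis using that \<Gamma>T[of x] cm_neq_zero[OF \<gamma>(1) K, of x] by (auto simp: \<rho>s_def)
    qed
    ultimately show ?thesis using d0 by (auto simp: sm_def)
  qed
  \<comment> \<open>Zeros occur only on \<open>A\<close>, farther than \<open>\<delta>\<close> from
    the equator. Below the staircase the height is at most \<open>\<delta>\<close>, so zeros there
    have negative height; above it they have positive height. This is what extension over a cone
    requires.\<close>
  have big: "\<delta> < \<bar>d0 x\<bar>" if "x \<in> A \<union> \<Gamma>" "\<rho>s x = (\<lambda>_. 0)" for x
  proof (cases "x \<in> A")
    case True
    then show ?thesis using \<delta>(2)[of x] d0(2)[of x] that by (simp add: \<rho>s_def)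
  next
    case False
    then show ?thesis using that \<Gamma>T[of x] cm_neq_zero[OF \<gamma>(1) K, of x] by (auto simp: \<rho>s_def)
  qed
  have low: "d0 x \<le> \<delta>" if x: "x \<in> Xm" for x
  proof -
    obtain i where "d0 x \<le> \<sigma> i" using x by (auto simp: Xm_def)
    then show ?thesis using \<sigma>(1)[of i] by linarith
  qed
  have high: "- \<delta> \<le> d0 x" if x: "x \<in> Xp" for x
  proof -
    obtain i where "\<sigma> i \<le> d0 x" using x by (auto simp: Xp_def)
    then show ?thesis using \<sigma>(1)[of i] by linarith
  qed
  have clAG: "closedin X (A \<union> \<Gamma>)" using A(1) \<Gamma> by (rule closedin_Un)
  obtain \<rho>1 d1 where 1: "sm K (topspace X) \<rho>1 d1" "\<And>x. x \<in> (A \<union> \<Gamma>) \<inter> Xm \<Longrightarrow> \<rho>1 x = \<rho>s x"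
    "\<And>x. x \<in> (A \<union> \<Gamma>) \<inter> Xm \<Longrightarrow> d1 x = d0 x"
  proof (rule sm_extend_cone[OF K closedin_Int[OF clAG Xm] sm_mono[OF sms]])
    fix x assume "x \<in> (A \<union> \<Gamma>) \<inter> Xm" "\<rho>s x = (\<lambda>_. 0)"
    then show "d0 x < 0" using big[of x] low[of x] \<delta>(1) by auto
  qed auto
  obtain \<rho>2 d2 where 2: "sm K (topspace X) \<rho>2 d2" "\<And>x. x \<in> (A \<union> \<Gamma>) \<inter> Xp \<Longrightarrow> \<rho>2 x = \<rho>s x"
    "\<And>x. x \<in> (A \<union> \<Gamma>) \<inter> Xp \<Longrightarrow> d2 x = d0 x"
  proof (rule sm_extend_cone'[OF K closedin_Int[OF clAG Xp] sm_mono[OF sms]])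
    fix x assume "x \<in> (A \<union> \<Gamma>) \<inter> Xp" "\<rho>s x = (\<lambda>_. 0)"
    then show "d0 x > 0" using big[of x] high[of x] \<delta>(1) by auto
  qed auto
  have top: "Xm \<subseteq> topspace X" "Xp \<subseteq> topspace X" using Xm Xp closedin_subset by blast+
  define \<rho>' where "\<rho>' x = (if x \<in> Xm then \<rho>1 x else \<rho>2 x)" for x
  define d' where "d' x = (if x \<in> Xm then d1 x else d2 x)" for x
  have meet: "\<rho>1 x = \<rho>2 x \<and> d1 x = d2 x" if "x \<in> Xm" "x \<in> Xp" for x
    using 1(2,3)[of x] 2(2,3)[of x] that by (auto simp: \<Gamma>_def)
  show "\<exists>\<rho>' d'. sm K Y \<rho>' d' \<and> (\<forall>x\<in>A. \<rho>' x = \<rho> x \<and> d' x = d x)"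
  proof (intro exI conjI ballI)
    have "cm (insert {} K) (Xm \<union> Xp) \<rho>'"
      unfolding \<rho>'_def
      by (rule cm_glue_if[OF Xm Xp]) (use 1(1) 2(1) top meet in \<open>auto simp: sm_def elim: cm_mono\<close>)
    moreover have "cf (Xm \<union> Xp) d'"
    proof (rule cf_glue[OF Xm Xp])
      show "cf Xm d'" by (rule cf_cong[of _ d1]) (use 1(1) top in \<open>auto simp: sm_def d'_def elim: cf_mono\<close>)
      show "cf Xp d'" by (rule cf_cong[of _ d2]) (use 2(1) top meet in \<open>auto simp: sm_def d'_def elim: cf_mono\<close>)
    qed
    moreover have "d' x \<noteq> 0" if "x \<in> Xm \<union> Xp" "\<rho>' x = (\<lambda>_. 0)" for x
      using that 1(1) 2(1) top by (auto simp: sm_def \<rho>'_def d'_def split: if_splits)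
    ultimately show "sm K Y \<rho>' d'" using XY by (auto simp: sm_def)
    fix x assume x: "x \<in> A"
    then have "x \<in> Xm \<or> x \<in> Xp" using A(2) XY by blast
    then show "\<rho>' x = \<rho> x" "d' x = d x"
      using x 1(2,3)[of x] 2(2,3)[of x] d0(2)[OF x] by (auto simp: \<rho>'_def d'_def \<rho>s_def)
  qed
qed

section \<open>Level sets\<close>

lemma tietze_real:
  assumes "closedin X A" "cf A f"
  obtains g where "\<And>B. cf B g" "\<And>x. x \<in> A \<Longrightarrow> g x = f x"
  by (rule tietze[OF assms, of UNIV]) (auto simp: is_interval_univ intro: that)

text \<open>Two applications of the extension property: the zero set \<open>\<Gamma>\<close> of an extension of
  \<open>cos (pi * f0 / \<epsilon>)\<close> separates the level sets of \<open>f0\<close> at consecutive multiples of \<open>\<epsilon>\<close>;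
  then the part of \<open>E\<close> to which \<open>\<psi>\<close> does not extend avoids \<open>\<Gamma>\<close>, so that it falls apart
  into finitely many closed pieces on which \<open>f0\<close> is almost constant.\<close>

lemma fibre_decomposition:
  fixes K :: "'w set set" and \<epsilon> :: real
  assumes K: "abstract_simplicial_complex K" and E: "closedin X E" "AEs K E"
    and B: "closedin X B" "cm K B \<psi>" and f0: "cf E f0" and \<epsilon>: "0 < \<epsilon>"
  obtains \<rho> v where "cm (insert {} K) E \<rho>" "\<And>x. x \<in> E \<Longrightarrow> x \<in> B \<Longrightarrow> \<rho> x = \<psi> x"
    "cf {x \<in> E. \<rho> x = (\<lambda>_. 0)} v"
    "\<And>x. x \<in> E \<Longrightarrow> \<rho> x = (\<lambda>_. 0) \<Longrightarrow> (\<exists>k::int. v x = \<epsilon> * k) \<and> f0 x + \<epsilon> < v x \<and> v x < f0 x + 4 * \<epsilon>"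
proof -
  define z where "z x = f0 x / \<epsilon>" for x
  have z: "cf E z" unfolding z_def using \<epsilon> by (intro cf_divide f0 cf_const) auto
  define d0 where "d0 x = cos (pi * z x)" for x
  have d0: "cf E d0" unfolding d0_def
    by (rule cf_compose[where h = cos and S = UNIV]) (auto intro!: cf_mult z continuous_intros)
  define A1 where "A1 = E \<inter> B"
  define A2 where "A2 = {x \<in> E. \<bar>d0 x\<bar> = 1}"
  have A1: "closedin X A1" unfolding A1_def using E(1) B(1) by (rule closedin_Int)
  have A2: "closedin X A2" unfolding A2_def by (intro closedin_eq E cf_abs d0 cf_const)
  have A1E: "A1 \<subseteq> E" "A2 \<subseteq> E" by (auto simp: A1_def A2_def)
  have \<psi>1: "cm K A1 \<psi>" by (rule cm_mono[OF B(2)]) (simp add: A1_def)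
  obtain W where W: "finite W" "\<And>x w. x \<in> A1 \<Longrightarrow> w \<notin> W \<Longrightarrow> \<psi> x w = 0" using cm_vertices \<psi>1 by blast
  \<comment> \<open>The factor vanishes where the height is 1 or -1, which makes the two
    prescriptions agree. It is 1 where the height is 0, so that the extension equals
    \<open>\<psi>\<close> on \<open>A1 \<inter> \<Gamma>\<close>.\<close>
  define \<rho>0 where "\<rho>0 x = (if x \<in> A1 then (\<lambda>w. (1 - \<bar>d0 x\<bar>) * \<psi> x w) else (\<lambda>_. 0))" for x
  have d0_le: "\<bar>d0 x\<bar> \<le> 1" for x by (simp add: d0_def)
  have "cm (insert {} K) (A1 \<union> A2) \<rho>0"
  proof (rule cm_glue[OF A1 A2])
    show "cm (insert {} K) A1 \<rho>0"
    proof (rule cmI[OF _ _ _ W(1)])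
      show "cf A1 (\<lambda>x. \<rho>0 x w)" for w
      proof (rule cf_cong)
        show "cf A1 (\<lambda>x. (1 - \<bar>d0 x\<bar>) * \<psi> x w)"
          by (intro cf_mult cf_diff cf_abs cf_const cf_mono[OF d0] A1E cmD(1)[OF \<psi>1])
      qed (simp add: \<rho>0_def)
      fix x assume x: "x \<in> A1"
      show "0 \<le> \<rho>0 x w" for w using d0_le[of x] cmD(2)[OF \<psi>1 x] by (simp add: \<rho>0_def)
      show "\<rho>0 x w = 0" if "w \<notin> W" for w using W(2)[OF x that] by (simp add: \<rho>0_def)
      show "{w. \<rho>0 x w \<noteq> 0} \<in> insert {} K"
      proof (cases "\<bar>d0 x\<bar> = 1")
        case False
        then have "{w. \<rho>0 x w \<noteq> 0} = {w. \<psi> x w \<noteq> 0}" using x by (auto simp: \<rho>0_def)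
        then show ?thesis using cmD(3)[OF \<psi>1 x] by simp
      qed (simp add: \<rho>0_def)
    qed
    have "cm (insert {} K) A2 (\<lambda>x w. 0)" by (simp add: cm_def)
    then show "cm (insert {} K) A2 \<rho>0" by (rule cm_cong) (auto simp: \<rho>0_def A2_def)
  qed
  moreover have "d0 x \<noteq> 0" if "x \<in> A1 \<union> A2" "\<rho>0 x = (\<lambda>_. 0)" for x
  proof (cases "x \<in> A2")
    case False
    then have x: "x \<in> A1" using that by simp
    then obtain w where "\<psi> x w \<noteq> 0" using cm_neq_zero[OF \<psi>1 K x] by (auto simp: fun_eq_iff)
    moreover have "(1 - \<bar>d0 x\<bar>) * \<psi> x w = 0" using fun_cong[OF that(2), of w] x by (simp add: \<rho>0_def)
    ultimately show ?thesis by auto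
  qed (auto simp: A2_def)
  ultimately have sm0: "sm K (A1 \<union> A2) \<rho>0 d0"
    using cf_mono[OF d0] A1E by (auto simp: sm_def)
  obtain \<rho>1 d1 where 1: "sm K E \<rho>1 d1" "\<And>x. x \<in> A1 \<union> A2 \<Longrightarrow> \<rho>1 x = \<rho>0 x" "\<And>x. x \<in> A1 \<union> A2 \<Longrightarrow> d1 x = d0 x"
    by (rule AEsE[OF E(2) closedin_Un[OF A1 A2] _ sm0]) (use A1E in \<open>auto intro: that\<close>)
  define \<Gamma> where "\<Gamma> = {x \<in> E. d1 x = 0}"
  have d1: "cf E d1" using 1(1) by (simp add: sm_def)
  have \<Gamma>: "closedin X \<Gamma>" unfolding \<Gamma>_def by (intro closedin_eq E cf_const d1)
  have \<rho>1\<Gamma>: "cm K \<Gamma> \<rho>1"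
  proof (rule cm_nonzero[OF cm_mono])
    show "cm (insert {} K) E \<rho>1" using 1(1) by (simp add: sm_def)
    show "\<rho>1 x \<noteq> (\<lambda>_. 0)" if "x \<in> \<Gamma>" for x using 1(1) that by (auto simp: sm_def \<Gamma>_def)
  qed (auto simp: \<Gamma>_def)
  define \<psi>' where "\<psi>' x = (if x \<in> A1 then \<psi> x else \<rho>1 x)" for x
  have \<psi>': "cm K (A1 \<union> \<Gamma>) \<psi>'"
    unfolding \<psi>'_def
  proof (rule cm_glue_if[OF A1 \<Gamma> \<psi>1 \<rho>1\<Gamma>])
    fix x assume x: "x \<in> A1" "x \<in> \<Gamma>"
    then have "d0 x = 0" using 1(3)[of x] by (simp add: \<Gamma>_def)
    then show "\<psi> x = \<rho>1 x" using 1(2)[of x] x by (simp add: \<rho>0_def)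
  qed
  \<comment> \<open>Second application, at height 0: the coordinates that extend
    \<open>\<psi>'\<close> are nonzero on \<open>A1 \<union> \<Gamma>\<close>, so the set
    \<open>C\<close> of their zeros avoids \<open>\<Gamma>\<close>.\<close>
  have sm\<psi>': "sm K (A1 \<union> \<Gamma>) \<psi>' (\<lambda>_. 0)"
    using cm_insert[OF \<psi>'] cm_neq_zero[OF \<psi>' K] by (auto simp: sm_def)
  have sub: "A1 \<union> \<Gamma> \<subseteq> E" using A1E by (auto simp: \<Gamma>_def)
  obtain \<rho> d2 where 2: "sm K E \<rho> d2" "\<And>x. x \<in> A1 \<union> \<Gamma> \<Longrightarrow> \<rho> x = \<psi>' x"
    by (rule AEsE[OF E(2) closedin_Un[OF A1 \<Gamma>] sub sm\<psi>']) blast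
  have \<rho>: "cm (insert {} K) E \<rho>" using 2(1) by (simp add: sm_def)
  define C where "C = {x \<in> E. \<rho> x = (\<lambda>_. 0)}"
  have C: "closedin X C" unfolding C_def by (rule closedin_zero_set[OF E(1) \<rho>])
  have C\<Gamma>: "d1 x \<noteq> 0" if "x \<in> C" for x
  proof
    assume "d1 x = 0"
    then have "x \<in> \<Gamma>" using that by (simp add: C_def \<Gamma>_def)
    then show False using 2(2)[of x] cm_neq_zero[OF \<psi>' K, of x] that by (simp add: C_def)
  qed
  \<comment> \<open>In units of \<open>\<epsilon>\<close>: where \<open>d1 > 0\<close> the value
    \<open>z\<close> misses the odd integers and lies in some interval (2m - 1, 2m + 1); where
    \<open>d1 < 0\<close> it misses the even ones and lies in some (2m, 2m + 2). The chosen value is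
    one more than the right end, hence locally constant on \<open>C\<close> and above
    \<open>z\<close> by between 1 and 3.\<close>
  define v where "v x = (if d1 x > 0 then \<epsilon> * (2 * of_int \<lfloor>(z x + 1) / 2\<rfloor> + 2) else \<epsilon> * (2 * of_int \<lfloor>z x / 2\<rfloor> + 3))" for x
  have cos_at: "d1 x = (if even m then 1 else -1)" if "x \<in> E" "z x = of_int m" for x m
  proof -
    have "d0 x = (if even m then 1 else -1)" unfolding d0_def that(2) by (rule cos_npi_int)
    moreover from this have "x \<in> A2" using that by (simp add: A2_def)
    ultimately show ?thesis using 1(3)[of x] by simp
  qed
  have odd: "(z x + 1) / 2 \<notin> \<int>" if "x \<in> E" "0 < d1 x" for x
  proof
    assume "(z x + 1) / 2 \<in> \<int>"
    then obtain m where "(z x + 1) / 2 = of_int m" by (elim Ints_cases)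
    then have "z x = of_int (2 * m - 1)" by simp
    from cos_at[OF that(1) this] that(2) show False by simp
  qed
  have even: "z x / 2 \<notin> \<int>" if "x \<in> E" "d1 x < 0" for x
  proof
    assume "z x / 2 \<in> \<int>"
    then obtain m where "z x / 2 = of_int m" by (elim Ints_cases)
    then have "z x = of_int (2 * m)" by simp
    from cos_at[OF that(1) this] that(2) show False by simp
  qed
  show thesis
  proof (rule that[OF \<rho>])
    show "\<rho> x = \<psi> x" if "x \<in> E" "x \<in> B" for x using 2(2)[of x] that by (simp add: A1_def \<psi>'_def)
    have zC: "cf C z" "cf C d1" using cf_mono[OF z] cf_mono[OF d1] by (auto simp: C_def)
    define Cp where "Cp = {x \<in> C. 0 \<le> d1 x}"
    define Cn where "Cn = {x \<in> C. d1 x \<le> 0}"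
    have cl: "closedin X Cp" "closedin X Cn" unfolding Cp_def Cn_def by (intro closedin_le C zC cf_const)+
    have "cf Cp v"
    proof (rule cf_cong)
      have "cf Cp (\<lambda>x. (z x + 1) / 2)"
        by (intro cf_divide cf_add cf_const cf_mono[OF z]) (auto simp: Cp_def C_def)
      then have "cf Cp (\<lambda>x. of_int \<lfloor>(z x + 1) / 2\<rfloor>)"
        by (rule cf_compose[OF _ continuous_on_of_int_floor]) (use odd C\<Gamma> in \<open>force simp: Cp_def C_def\<close>)
      then show "cf Cp (\<lambda>x. \<epsilon> * (2 * of_int \<lfloor>(z x + 1) / 2\<rfloor> + 2))" by (intro cf_mult cf_add cf_const)
      show "\<epsilon> * (2 * of_int \<lfloor>(z x + 1) / 2\<rfloor> + 2) = v x" if "x \<in> Cp" for x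
        using that C\<Gamma>[of x] by (auto simp: v_def Cp_def)
    qed
    moreover have "cf Cn v"
    proof (rule cf_cong)
      have "cf Cn (\<lambda>x. z x / 2)"
        by (intro cf_divide cf_add cf_const cf_mono[OF z]) (auto simp: Cn_def C_def)
      then have "cf Cn (\<lambda>x. of_int \<lfloor>z x / 2\<rfloor>)"
        by (rule cf_compose[OF _ continuous_on_of_int_floor]) (use even C\<Gamma> in \<open>force simp: Cn_def C_def\<close>)
      then show "cf Cn (\<lambda>x. \<epsilon> * (2 * of_int \<lfloor>z x / 2\<rfloor> + 3))" by (intro cf_mult cf_add cf_const)
      show "\<epsilon> * (2 * of_int \<lfloor>z x / 2\<rfloor> + 3) = v x" if "x \<in> Cn" for x
        using that by (auto simp: v_def Cn_def)
    qed
    ultimately have "cf (Cp \<union> Cn) v" by (rule cf_glue[OF cl])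
    moreover have "Cp \<union> Cn = C" by (auto simp: Cp_def Cn_def)
    ultimately show "cf {x \<in> E. \<rho> x = (\<lambda>_. 0)} v" by (simp add: C_def)
    fix x assume x: "x \<in> E" "\<rho> x = (\<lambda>_. 0)"
    then have "x \<in> C" by (simp add: C_def)
    have f0z: "f0 x = \<epsilon> * z x" using \<epsilon> by (simp add: z_def)
    show "(\<exists>k::int. v x = \<epsilon> * k) \<and> f0 x + \<epsilon> < v x \<and> v x < f0 x + 4 * \<epsilon>"
    proof (cases "0 < d1 x")
      case True
      define m where "m = \<lfloor>(z x + 1) / 2\<rfloor>"
      have m: "of_int m \<le> (z x + 1) / 2" "(z x + 1) / 2 < of_int m + 1"
        unfolding m_def by linarith+
      have "z x + 1 < 2 * of_int m + 2" "2 * of_int m + 2 < z x + 4"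
        using m by (simp_all add: field_simps)
      then have "\<epsilon> * (z x + 1) < \<epsilon> * (2 * of_int m + 2)" "\<epsilon> * (2 * of_int m + 2) < \<epsilon> * (z x + 4)"
        using \<epsilon> by (simp_all only: mult_less_cancel_left_pos)
      moreover have v: "v x = \<epsilon> * (2 * of_int m + 2)" using True by (simp add: v_def m_def)
      moreover have "v x = \<epsilon> * of_int (2 * m + 2)" by (simp add: v)
      ultimately show ?thesis by (intro conjI exI[of _ "2 * m + 2"]) (simp_all add: f0z algebra_simps)
    next
      case False
      then have neg: "d1 x < 0" using C\<Gamma>[OF \<open>x \<in> C\<close>] by simp
      define m where "m = \<lfloor>z x / 2\<rfloor>"
      have m: "of_int m \<le> z x / 2" "z x / 2 < of_int m + 1"
        unfolding m_def by linarith+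
      have "z x + 1 < 2 * of_int m + 3" "2 * of_int m + 3 < z x + 4"
        using m by (simp_all add: field_simps)
      then have "\<epsilon> * (z x + 1) < \<epsilon> * (2 * of_int m + 3)" "\<epsilon> * (2 * of_int m + 3) < \<epsilon> * (z x + 4)"
        using \<epsilon> by (simp_all only: mult_less_cancel_left_pos)
      moreover have v: "v x = \<epsilon> * (2 * of_int m + 3)" using False by (simp add: v_def m_def)
      moreover have "v x = \<epsilon> * of_int (2 * m + 3)" by (simp add: v)
      ultimately show ?thesis by (intro conjI exI[of _ "2 * m + 3"]) (simp_all add: f0z algebra_simps)
    qed
  qed
qed

section \<open>Leaves, and the stability of extension problems under perturbation\<close>

definition leaf :: "('j \<Rightarrow> 'a \<Rightarrow> real) \<Rightarrow> 'j set \<Rightarrow> 'a set \<Rightarrow> ('a \<Rightarrow> real) \<Rightarrow> 'a \<Rightarrow> 'a set" where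
  "leaf p J Y f x0 = {x \<in> Y. (\<forall>j\<in>J. p j x = p j x0) \<and> f x = f x0}"

definition extends_over :: "'w set set \<Rightarrow> 'a set \<Rightarrow> ('a \<Rightarrow> 'w \<Rightarrow> real) \<Rightarrow> 'a set \<Rightarrow> bool" where
  "extends_over K B \<psi> W \<longleftrightarrow> (\<exists>\<phi>. cm K W \<phi> \<and> (\<forall>x\<in>W \<inter> B. \<phi> x = \<psi> x))"

lemma closedin_fibre:
  assumes "closedin X Y" "finite J" "\<And>j. j \<in> J \<Longrightarrow> cf Y (p j)"
  shows "closedin X {x \<in> Y. \<forall>j\<in>J. p j x = p j x0}"
  using assms(2,3)
proof (induction J rule: finite_induct)
  case (insert i J)
  have eq: "{x \<in> Y. \<forall>j\<in>insert i J. p j x = p j x0} = {x \<in> Y. p i x = p i x0} \<inter> {x \<in> Y. \<forall>j\<in>J. p j x = p j x0}" by auto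
  have "closedin X {x \<in> Y. p i x = p i x0}" by (intro closedin_eq assms(1) cf_const insert.prems) simp
  moreover have "closedin X {x \<in> Y. \<forall>j\<in>J. p j x = p j x0}" using insert by blast
  ultimately show ?case unfolding eq by (rule closedin_Int)
qed (simp add: assms)

lemma closedin_leaf:
  assumes "closedin X Y" "finite J" "\<And>j. j \<in> J \<Longrightarrow> cf Y (p j)" "cf Y f"
  shows "closedin X (leaf p J Y f x0)"
proof -
  have eq: "leaf p J Y f x0 = {x \<in> Y. \<forall>j\<in>J. p j x = p j x0} \<inter> {x \<in> Y. f x = f x0}" by (auto simp: leaf_def)
  have "closedin X {x \<in> Y. \<forall>j\<in>J. p j x = p j x0}" by (rule closedin_fibre) (use assms in auto)
  moreover have "closedin X {x \<in> Y. f x = f x0}" using assms by (intro closedin_eq cf_const)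
  ultimately show ?thesis unfolding eq by (rule closedin_Int)
qed

lemma extends_over_mono: "extends_over K B \<psi> W \<Longrightarrow> V \<subseteq> W \<Longrightarrow> extends_over K B \<psi> V"
  unfolding extends_over_def using cm_mono by blast

lemma AEc_extends_over:
  assumes "AEc K W" "closedin X W" "closedin X B" "cm K B \<psi>"
  shows "extends_over K B \<psi> W"
proof -
  have "cm K (W \<inter> B) \<psi>" by (rule cm_mono[OF assms(4)]) auto
  from AEcE[OF assms(1) closedin_Int[OF assms(2,3)] _ this] obtain \<phi> where
    "cm K W \<phi>" "\<And>x. x \<in> W \<inter> B \<Longrightarrow> \<phi> x = \<psi> x" by auto
  then show ?thesis unfolding extends_over_def by (intro exI[of _ \<phi>]) simp
qed

text \<open>A solution on a fibre extends to a neighbourhood, and by compactness finitely many such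
  neighbourhoods absorb a uniform perturbation of \<open>P\<close>. With \<open>dl\<close>
  constantly 0 this is the openness of a test condition; in general it gives a margin around the
  zero set of \<open>dl\<close>.\<close>

lemma extends_over_fibres_stable:
  fixes P :: "'k \<Rightarrow> 'a \<Rightarrow> real"
  assumes K: "abstract_simplicial_complex K" and Y: "closedin X Y"
    and I: "finite I" "\<And>k. k \<in> I \<Longrightarrow> cf (topspace X) (P k)" and dl: "cf Y dl"
    and B: "closedin X B" "cm K B \<psi>"
    and good: "\<And>x0. x0 \<in> Y \<Longrightarrow> dl x0 = 0 \<Longrightarrow> extends_over K B \<psi> {x \<in> Y. \<forall>k\<in>I. P k x = P k x0}"
  obtains \<eta> where "0 < \<eta>"
    "\<And>P' x0. (\<And>k x. k \<in> I \<Longrightarrow> x \<in> Y \<Longrightarrow> \<bar>P' k x - P k x\<bar> \<le> \<eta>) \<Longrightarrow> x0 \<in> Y \<Longrightarrow> \<bar>dl x0\<bar> \<le> \<eta> \<Longrightarrow>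
       extends_over K B \<psi> {x \<in> Y. \<forall>k\<in>I. P' k x = P' k x0}"
proof -
  define D where "D = {x \<in> Y. dl x = 0}"
  have YX: "Y \<subseteq> topspace X" using Y closedin_subset by blast
  have D: "closedin X D" unfolding D_def by (intro closedin_eq Y dl cf_const)
  have "\<exists>r>0. \<forall>Z\<subseteq>Y. (\<forall>x\<in>Z. \<forall>k\<in>I. \<bar>P k x - P k x0\<bar> \<le> r) \<longrightarrow> extends_over K B \<psi> Z" if x0: "x0 \<in> D" for x0
  proof -
    let ?W = "{x \<in> Y. \<forall>k\<in>I. P k x = P k x0}"
    have W: "closedin X ?W" by (rule closedin_fibre[OF Y I(1)]) (rule cf_mono[OF I(2) YX])
    have "extends_over K B \<psi> ?W" by (rule good) (use x0 in \<open>auto simp: D_def\<close>)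
    then obtain \<phi> where \<phi>: "cm K ?W \<phi>" "\<forall>x\<in>?W \<inter> B. \<phi> x = \<psi> x"
      unfolding extends_over_def by (elim exE conjE) (rule that)
    have glued: "cm K (B \<union> ?W) (\<lambda>x. if x \<in> B then \<psi> x else \<phi> x)"
      by (rule cm_glue_if[OF B(1) W B(2) \<phi>(1)]) (use \<phi>(2) in auto)
    obtain N V \<phi>' where N: "closedin X N" "openin X V" "B \<union> ?W \<subseteq> V" "V \<subseteq> N" "cm K N \<phi>'"
      "\<And>x. x \<in> B \<union> ?W \<Longrightarrow> \<phi>' x = (if x \<in> B then \<psi> x else \<phi> x)"
      by (rule cm_extend_nbhd[OF K closedin_Un[OF B(1) W] glued]) (rule that; (assumption | simp))
    obtain r where r: "0 < r" "\<And>x. x \<in> Y \<Longrightarrow> (\<And>k. k \<in> I \<Longrightarrow> \<bar>P k x - P k x0\<bar> \<le> r) \<Longrightarrow> x \<in> V"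
    proof (rule fibre_nbhd[OF Y I(1) _ N(2)])
      show "cf Y (P k)" if "k \<in> I" for k using cf_mono[OF I(2)[OF that] YX] .
      fix x assume x: "x \<in> Y" "\<And>k. k \<in> I \<Longrightarrow> P k x = P k x0"
      then have "x \<in> ?W" by simp
      then show "x \<in> V" using N(3) by blast
    qed blast
    have "extends_over K B \<psi> Z" if Z: "Z \<subseteq> Y" "\<forall>x\<in>Z. \<forall>k\<in>I. \<bar>P k x - P k x0\<bar> \<le> r" for Z
    proof -
      have "Z \<subseteq> N" using r(2) Z N(4) by blast
      then show ?thesis unfolding extends_over_def
        using cm_mono[OF N(5)] N(6) by (intro exI[of _ \<phi>']) auto
    qed
    then show ?thesis using r(1) by blast
  qed
  then have "\<forall>x0\<in>D. \<exists>r. 0 < r \<and> (\<forall>Z\<subseteq>Y. (\<forall>x\<in>Z. \<forall>k\<in>I. \<bar>P k x - P k x0\<bar> \<le> r) \<longrightarrow> extends_over K B \<psi> Z)"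
    by simp
  then obtain r where "\<forall>x0\<in>D. 0 < r x0 \<and> (\<forall>Z\<subseteq>Y. (\<forall>x\<in>Z. \<forall>k\<in>I. \<bar>P k x - P k x0\<bar> \<le> r x0) \<longrightarrow> extends_over K B \<psi> Z)"
    by (rule bchoice[THEN exE])
  then have r: "\<And>x0. x0 \<in> D \<Longrightarrow> 0 < r x0"
    "\<And>x0 Z. x0 \<in> D \<Longrightarrow> Z \<subseteq> Y \<Longrightarrow> \<forall>x\<in>Z. \<forall>k\<in>I. \<bar>P k x - P k x0\<bar> \<le> r x0 \<Longrightarrow> extends_over K B \<psi> Z"
    by simp_all
  \<comment> \<open>A quarter of the radius, since three such errors are added: from
    \<open>x0\<close> to the centre \<open>y\<close>, and from \<open>P\<close> to \<open>P'\<close>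
    both at \<open>x\<close> and at \<open>x0\<close>.\<close>
  define U where "U x0 = {x \<in> topspace X. \<forall>k\<in>I. \<bar>P k x - P k x0\<bar> < r x0 / 4}" for x0
  have U: "openin X (U x0) \<and> x0 \<in> U x0" if "x0 \<in> D" for x0
  proof
    show "openin X (U x0)" unfolding U_def by (rule openin_ball[OF I])
    show "x0 \<in> U x0" using YX r(1)[OF that] that by (auto simp: U_def D_def)
  qed
  from finite_subcover[OF D this] obtain F where F: "finite F" "F \<subseteq> D" "D \<subseteq> (\<Union>x\<in>F. U x)" by blast
  have "openin X (\<Union>x\<in>F. U x)" using U F(2) by (intro openin_Union) auto
  then obtain \<eta>1 where \<eta>1: "0 < \<eta>1" "\<And>x. x \<in> Y \<Longrightarrow> \<bar>dl x\<bar> \<le> \<eta>1 \<Longrightarrow> x \<in> (\<Union>x\<in>F. U x)"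
    by (rule zero_set_nbhd[OF Y cf_abs[OF dl]]) (use F(3) in \<open>auto simp: D_def\<close>)
  define \<eta> where "\<eta> = Min (insert \<eta>1 ((\<lambda>x. r x / 4) ` F))"
  have \<eta>: "0 < \<eta>" "\<eta> \<le> \<eta>1" "\<And>x. x \<in> F \<Longrightarrow> \<eta> \<le> r x / 4"
  proof -
    have "0 < r x / 4" if "x \<in> F" for x using r(1)[of x] F(2) that by auto
    then show "0 < \<eta>" unfolding \<eta>_def using F(1) \<eta>1(1) by (subst Min_gr_iff) auto
    show "\<eta> \<le> \<eta>1" unfolding \<eta>_def using F(1) by (intro Min_le) auto
    show "\<eta> \<le> r x / 4" if "x \<in> F" for x unfolding \<eta>_def using F(1) that by (intro Min_le) auto
  qed
  show thesis
  proof (rule that[OF \<eta>(1)])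
    fix P' x0 assume P': "\<And>k x. k \<in> I \<Longrightarrow> x \<in> Y \<Longrightarrow> \<bar>P' k x - P k x\<bar> \<le> \<eta>" and x0: "x0 \<in> Y" "\<bar>dl x0\<bar> \<le> \<eta>"
    then obtain y where y: "y \<in> F" "x0 \<in> U y" using \<eta>1(2)[of x0] \<eta>(2) by auto
    show "extends_over K B \<psi> {x \<in> Y. \<forall>k\<in>I. P' k x = P' k x0}"
    proof (rule r(2))
      show "y \<in> D" using y(1) F(2) by blast
      show "\<forall>x\<in>{x \<in> Y. \<forall>k\<in>I. P' k x = P' k x0}. \<forall>k\<in>I. \<bar>P k x - P k y\<bar> \<le> r y"
      proof (intro ballI)
        fix x k assume x: "x \<in> {x \<in> Y. \<forall>k\<in>I. P' k x = P' k x0}" and k: "k \<in> I"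
        have "\<bar>P k x0 - P k y\<bar> < r y / 4" using y(2) k by (simp add: U_def)
        moreover have "P' k x = P' k x0" "x \<in> Y" using x k by auto
        moreover have "\<bar>P' k x - P k x\<bar> \<le> r y / 4" "\<bar>P' k x0 - P k x0\<bar> \<le> r y / 4"
          using P'[OF k \<open>x \<in> Y\<close>] P'[OF k x0(1)] \<eta>(3)[OF y(1)] by linarith+
        ultimately show "\<bar>P k x - P k y\<bar> \<le> r y" by linarith
      qed
    qed auto
  qed
qed

lemma extends_over_leaves_stable:
  fixes p :: "'j \<Rightarrow> 'a \<Rightarrow> real"
  assumes K: "abstract_simplicial_complex K" and Y: "closedin X Y"
    and J: "finite J" "\<And>j. j \<in> J \<Longrightarrow> cf (topspace X) (p j)" and f: "cf (topspace X) f" and dl: "cf Y dl"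
    and B: "closedin X B" "cm K B \<psi>"
    and good: "\<And>x0. x0 \<in> Y \<Longrightarrow> dl x0 = 0 \<Longrightarrow> extends_over K B \<psi> (leaf p J Y f x0)"
  obtains \<eta> where "0 < \<eta>"
    "\<And>f' x0. (\<And>x. x \<in> Y \<Longrightarrow> \<bar>f' x - f x\<bar> \<le> \<eta>) \<Longrightarrow> x0 \<in> Y \<Longrightarrow> \<bar>dl x0\<bar> \<le> \<eta> \<Longrightarrow> extends_over K B \<psi> (leaf p J Y f' x0)"
proof -
  \<comment> \<open>Adjoining the extra function to the family under the index \<open>None\<close>
    turns leaves into fibres.\<close>
  define P where "P g k = (case k of None \<Rightarrow> g | Some j \<Rightarrow> p j)" for g k
  define I where "I = insert None (Some ` J)"
  have I: "finite I" "\<And>k. k \<in> I \<Longrightarrow> cf (topspace X) (P f k)" using J f by (auto simp: I_def P_def)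
  have leaf_eq: "leaf p J Y g x0 = {x \<in> Y. \<forall>k\<in>I. P g k x = P g k x0}" for g x0
    by (auto simp: leaf_def P_def I_def)
  obtain \<eta> where \<eta>: "0 < \<eta>"
    "\<And>P' x0. (\<And>k x. k \<in> I \<Longrightarrow> x \<in> Y \<Longrightarrow> \<bar>P' k x - P f k x\<bar> \<le> \<eta>) \<Longrightarrow> x0 \<in> Y \<Longrightarrow> \<bar>dl x0\<bar> \<le> \<eta> \<Longrightarrow>
       extends_over K B \<psi> {x \<in> Y. \<forall>k\<in>I. P' k x = P' k x0}"
    by (rule extends_over_fibres_stable[OF K Y I dl B good[unfolded leaf_eq]]) (assumption | blast)+
  show thesis
  proof (rule that[OF \<eta>(1)])
    fix f' x0 assume *: "\<And>x. x \<in> Y \<Longrightarrow> \<bar>f' x - f x\<bar> \<le> \<eta>" "x0 \<in> Y" "\<bar>dl x0\<bar> \<le> \<eta>"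
    show "extends_over K B \<psi> (leaf p J Y f' x0)"
      unfolding leaf_eq
    proof (rule \<eta>(2)[OF _ *(2,3)])
      show "\<bar>P f' k x - P f k x\<bar> \<le> \<eta>" if "k \<in> I" "x \<in> Y" for k x
        using *(1)[OF that(2)] \<eta>(1) by (cases k) (simp_all add: P_def)
    qed
  qed
qed

end

lemma complex_face:
  assumes "abstract_simplicial_complex K" "s \<in> K" "t \<subseteq> s" "t \<noteq> {}"
  shows "t \<in> K"
  using assms unfolding abstract_simplicial_complex_def by blast

lemma complex_vertex:
  assumes "abstract_simplicial_complex K" "K \<noteq> {}"
  obtains v where "{v} \<in> K"
proof -
  obtain s where s: "s \<in> K" using assms(2) by blast
  then have "s \<noteq> {}" using assms(1) unfolding abstract_simplicial_complex_def by simp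
  then obtain v where "v \<in> s" by blast
  then show thesis using that[of v] complex_face[OF assms(1) s, of "{v}"] by simp
qed

context compact_metrizable
begin

text \<open>On \<open>T\<close> the map \<open>\<psi>\<close> extends off the set \<open>u > 3/4\<close>, near which the function
  \<open>f0\<close> may be replaced by the locally constant integer multiple of \<open>\<epsilon>\<close> closest to \<open>w\<close>.\<close>

definition local_data :: "('a \<Rightarrow> real) \<Rightarrow> real \<Rightarrow> 'w set set \<Rightarrow> 'a set \<Rightarrow> ('a \<Rightarrow> 'w \<Rightarrow> real) \<Rightarrow> 'a set \<Rightarrow> bool" where
  "local_data f0 \<epsilon> K B \<psi> T \<longleftrightarrow> (\<exists>u w \<rho>. cf (topspace X) u \<and> cf (topspace X) w \<and>
     (\<forall>x\<in>T. 0 \<le> u x \<and> u x \<le> 1) \<and>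
     (\<forall>x\<in>T. 0 < u x \<longrightarrow> x \<notin> B \<and> (\<exists>k::int. \<bar>w x - \<epsilon> * k\<bar> < \<epsilon> / 4 \<and> f0 x + \<epsilon> < \<epsilon> * k \<and> \<epsilon> * k < f0 x + 5 * \<epsilon>)) \<and>
     cm K {x \<in> T. u x \<le> 3/4} \<rho> \<and> (\<forall>x\<in>T \<inter> B. \<rho> x = \<psi> x))"

lemma local_data_mono:
  assumes "local_data f0 \<epsilon> K B \<psi> T" "S \<subseteq> T"
  shows "local_data f0 \<epsilon> K B \<psi> S"
proof -
  obtain u w \<rho> where *: "cf (topspace X) u" "cf (topspace X) w"
     "\<forall>x\<in>T. 0 \<le> u x \<and> u x \<le> 1"
     "\<forall>x\<in>T. 0 < u x \<longrightarrow> x \<notin> B \<and> (\<exists>k::int. \<bar>w x - \<epsilon> * k\<bar> < \<epsilon> / 4 \<and> f0 x + \<epsilon> < \<epsilon> * k \<and> \<epsilon> * k < f0 x + 5 * \<epsilon>)"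
     "cm K {x \<in> T. u x \<le> 3/4} \<rho>" "\<forall>x\<in>T \<inter> B. \<rho> x = \<psi> x"
    using assms(1) unfolding local_data_def by (elim exE conjE) (rule that)
  have "cm K {x \<in> S. u x \<le> 3/4} \<rho>" by (rule cm_mono[OF *(5)]) (use assms(2) in blast)
  moreover have "\<forall>x\<in>S \<inter> B. \<rho> x = \<psi> x" using *(6) assms(2) by blast
  moreover have "\<forall>x\<in>S. 0 \<le> u x \<and> u x \<le> 1" using *(3) assms(2) by blast
  moreover have "\<forall>x\<in>S. 0 < u x \<longrightarrow> x \<notin> B \<and> (\<exists>k::int. \<bar>w x - \<epsilon> * k\<bar> < \<epsilon> / 4 \<and> f0 x + \<epsilon> < \<epsilon> * k \<and> \<epsilon> * k < f0 x + 5 * \<epsilon>)"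
    using *(4) assms(2) by blast
  ultimately show ?thesis
    unfolding local_data_def using *(1,2) by (intro exI[of _ u] exI[of _ w] exI[of _ \<rho>] conjI)
qed

text \<open>The decomposition of the fibre is described by open conditions. They persist nearby once
  \<open>v\<close> is extended to \<open>w\<close> and the exceptional set is marked by a Urysohn
  function \<open>u\<close>; the coordinates extend by the neighbourhood property.\<close>

lemma local_data_near_fibre:
  fixes K :: "'w set set" and p :: "'j \<Rightarrow> 'a \<Rightarrow> real" and \<epsilon> :: real
  assumes K: "abstract_simplicial_complex K" and Y: "closedin X Y"
    and J: "finite J" "\<And>j. j \<in> J \<Longrightarrow> cf (topspace X) (p j)"
    and E: "AEs K {x \<in> Y. \<forall>j\<in>J. p j x = p j x0}"
    and B: "closedin X B" "cm K B \<psi>" and f0: "cf (topspace X) f0" and \<epsilon>: "0 < \<epsilon>"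
  shows "\<exists>r>0. local_data f0 \<epsilon> K B \<psi> {x \<in> Y. \<forall>j\<in>J. \<bar>p j x - p j x0\<bar> \<le> r}"
proof -
  have YX: "Y \<subseteq> topspace X" using Y closedin_subset by blast
  define E where "E = {x \<in> Y. \<forall>j\<in>J. p j x = p j x0}"
  have clE: "closedin X E" unfolding E_def by (rule closedin_fibre[OF Y J(1)]) (rule cf_mono[OF J(2) YX])
  have EY: "E \<subseteq> Y" by (auto simp: E_def)
  have f0E: "cf E f0" by (rule cf_mono[OF f0]) (use EY YX in blast)
  have "AEs K E" using E by (simp add: E_def)
  from fibre_decomposition[OF K clE this B f0E \<epsilon>]
  obtain \<rho> v where \<rho>: "cm (insert {} K) E \<rho>" "\<And>x. x \<in> E \<Longrightarrow> x \<in> B \<Longrightarrow> \<rho> x = \<psi> x"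
    and v: "cf {x \<in> E. \<rho> x = (\<lambda>_. 0)} v"
    "\<And>x. x \<in> E \<Longrightarrow> \<rho> x = (\<lambda>_. 0) \<Longrightarrow> (\<exists>k::int. v x = \<epsilon> * k) \<and> f0 x + \<epsilon> < v x \<and> v x < f0 x + 4 * \<epsilon>"
    by blast
  define C where "C = {x \<in> E. \<rho> x = (\<lambda>_. 0)}"
  have C: "closedin X C" unfolding C_def by (rule closedin_zero_set[OF clE \<rho>(1)])
  obtain w where w: "\<And>A. cf A w" "\<And>x. x \<in> C \<Longrightarrow> w x = v x"
    by (rule tietze_real[OF C]) (use v(1) in \<open>auto simp: C_def intro: that\<close>)
  \<comment> \<open>Within \<open>\<epsilon> / 4\<close> of a multiple of \<open>\<epsilon>\<close>
    that multiple is unique, so rounding \<open>w\<close> will be continuous there.\<close>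
  define G where "G k = {x \<in> topspace X. \<bar>w x - \<epsilon> * k\<bar> < \<epsilon> / 4} \<inter> {x \<in> topspace X. f0 x + \<epsilon> < \<epsilon> * k}
      \<inter> {x \<in> topspace X. \<epsilon> * k < f0 x + 5 * \<epsilon>}" for k :: int
  have G: "openin X (G k)" for k
    unfolding G_def by (intro openin_Int openin_less cf_abs cf_diff cf_add cf_const w f0)
  define O' where "O' = (\<Union>k. G k) - B"
  have O': "openin X O'" unfolding O'_def by (intro openin_diff openin_Union B(1)) (use G in auto)
  have CO: "x \<in> O'" if "x \<in> C" for x
  proof -
    have x: "x \<in> E" "\<rho> x = (\<lambda>_. 0)" using that by (auto simp: C_def)
    then obtain k :: int where k: "v x = \<epsilon> * k" using v(2) by blast
    then have "x \<in> G k" using v(2)[OF x] w(2)[OF that] x(1) EY YX \<epsilon> by (auto simp: G_def)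
    moreover have "x \<notin> B" using \<rho>(2)[OF x(1)] cm_neq_zero[OF B(2) K, of x] x(2) by argo
    ultimately show ?thesis by (auto simp: O'_def)
  qed
  have "closedin X (topspace X - O')" using O' by auto
  moreover have "(topspace X - O') \<inter> C = {}" using CO by auto
  ultimately obtain u where u: "\<And>A. cf A u" "\<And>x. x \<in> topspace X \<Longrightarrow> 0 \<le> u x \<and> u x \<le> 1"
    "\<And>x. x \<in> topspace X - O' \<Longrightarrow> u x = 0" "\<And>x. x \<in> C \<Longrightarrow> u x = 1"
    using urysohn[OF _ C] by blast
  define E1 where "E1 = {x \<in> E. u x \<le> 3/4}"
  have E1: "closedin X E1" unfolding E1_def by (intro closedin_le clE u cf_const)
  have \<rho>E1: "cm K E1 \<rho>"
  proof (rule cm_nonzero[OF cm_mono[OF \<rho>(1)]])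
    show "\<rho> x \<noteq> (\<lambda>_. 0)" if "x \<in> E1" for x using u(4)[of x] that by (auto simp: E1_def C_def)
  qed (auto simp: E1_def)
  have glued: "cm K (B \<union> E1) (\<lambda>x. if x \<in> B then \<psi> x else \<rho> x)"
    by (rule cm_glue_if[OF B(1) E1 B(2) \<rho>E1]) (use \<rho>(2) in \<open>auto simp: E1_def\<close>)
  obtain N V \<phi> where N: "closedin X N" "openin X V" "B \<union> E1 \<subseteq> V" "V \<subseteq> N" "cm K N \<phi>"
    "\<And>x. x \<in> B \<union> E1 \<Longrightarrow> \<phi> x = (if x \<in> B then \<psi> x else \<rho> x)"
    by (rule cm_extend_nbhd[OF K closedin_Un[OF B(1) E1] glued]) (rule that; (assumption | simp))
  \<comment> \<open>Close to the fibre a point either lies where the coordinates extend or has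
    \<open>u > 3/4\<close>, where none are asked for.\<close>
  let ?V = "V \<union> {x \<in> topspace X. 3/4 < u x}"
  have oV: "openin X ?V" by (intro openin_Un N(2) openin_less u cf_const)
  obtain r where r: "0 < r" "\<And>x. x \<in> Y \<Longrightarrow> (\<And>j. j \<in> J \<Longrightarrow> \<bar>p j x - p j x0\<bar> \<le> r) \<Longrightarrow> x \<in> ?V"
  proof (rule fibre_nbhd[OF Y J(1) _ oV])
    show "cf Y (p j)" if "j \<in> J" for j using cf_mono[OF J(2)[OF that] YX] .
    fix x assume x: "x \<in> Y" "\<And>j. j \<in> J \<Longrightarrow> p j x = p j x0"
    then have "x \<in> E" by (simp add: E_def)
    then show "x \<in> ?V" using N(3) EY YX by (cases "u x \<le> 3/4") (auto simp: E1_def)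
  qed blast
  let ?T = "{x \<in> Y. \<forall>j\<in>J. \<bar>p j x - p j x0\<bar> \<le> r}"
  have "local_data f0 \<epsilon> K B \<psi> ?T"
    unfolding local_data_def
  proof (intro exI conjI)
    show "cf (topspace X) u" "cf (topspace X) w" using u w by auto
    show "\<forall>x\<in>?T. 0 \<le> u x \<and> u x \<le> 1" using u(2) YX by blast
    show "\<forall>x\<in>?T. 0 < u x \<longrightarrow> x \<notin> B \<and> (\<exists>k::int. \<bar>w x - \<epsilon> * k\<bar> < \<epsilon> / 4 \<and> f0 x + \<epsilon> < \<epsilon> * k \<and> \<epsilon> * k < f0 x + 5 * \<epsilon>)"
    proof (intro ballI impI)
      fix x assume "x \<in> ?T" "0 < u x"
      then have "x \<in> O'" using u(3)[of x] YX by force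
      then show "x \<notin> B \<and> (\<exists>k::int. \<bar>w x - \<epsilon> * k\<bar> < \<epsilon> / 4 \<and> f0 x + \<epsilon> < \<epsilon> * k \<and> \<epsilon> * k < f0 x + 5 * \<epsilon>)"
        by (auto simp: O'_def G_def)
    qed
    have "{x \<in> ?T. u x \<le> 3/4} \<subseteq> N" using r(2) N(4) by fastforce
    then show "cm K {x \<in> ?T. u x \<le> 3/4} \<phi>" by (rule cm_mono[OF N(5)])
    show "\<forall>x\<in>?T \<inter> B. \<phi> x = \<psi> x" using N(6) by auto
  qed
  then show ?thesis using r(1) by blast
qed

lemma leaf_mono: "Z \<subseteq> Y \<Longrightarrow> leaf p J Z f x0 \<subseteq> leaf p J Y f x0"
  by (auto simp: leaf_def)

text \<open>The function \<open>f1\<close> is moved linearly to the locally constant \<open>v > f1\<close> where \<open>u \<ge> 1/2\<close>.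
  At time \<open>t < 1\<close> a leaf meets this set in pieces of leaves of \<open>f1\<close>, over which the extension
  exists by genericity; at time 1 it meets it in an open and closed set disjoint from \<open>B\<close>.
  Fading out the movement near the zero set of \<open>dl\<close> therefore does no harm.\<close>

lemma solve_local:
  fixes K :: "'w set set" and p :: "'j \<Rightarrow> 'a \<Rightarrow> real" and \<epsilon> :: real
  assumes K: "abstract_simplicial_complex K" "K \<noteq> {}" and Y: "closedin X Y"
    and J: "finite J" "\<And>j. j \<in> J \<Longrightarrow> cf (topspace X) (p j)"
    and B: "closedin X B" "cm K B \<psi>" and \<epsilon>: "0 < \<epsilon>"
    and ld: "local_data f0 \<epsilon> K B \<psi> Y"
    and f1: "cf (topspace X) f1" "\<And>x. x \<in> Y \<Longrightarrow> \<bar>f1 x - f0 x\<bar> < \<epsilon>"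
    and dl: "cf (topspace X) dl" "\<And>x y. x \<in> Y \<Longrightarrow> y \<in> Y \<Longrightarrow> (\<And>j. j \<in> J \<Longrightarrow> p j x = p j y) \<Longrightarrow> dl x = dl y"
    and gen: "\<And>x0. x0 \<in> Y \<Longrightarrow> dl x0 = 0 \<Longrightarrow> AEc K (leaf p J Y f1 x0)"
  obtains f2 where "cf Y f2" "\<And>x. x \<in> Y \<Longrightarrow> dl x = 0 \<Longrightarrow> f2 x = f1 x"
    "\<And>x. x \<in> Y \<Longrightarrow> \<bar>f2 x - f0 x\<bar> < 7 * \<epsilon>"
    "\<And>x0. x0 \<in> Y \<Longrightarrow> extends_over K B \<psi> (leaf p J Y f2 x0)"
proof -
  have YX: "Y \<subseteq> topspace X" using Y closedin_subset by blast
  obtain u w \<rho> where *: "cf (topspace X) u" "cf (topspace X) w"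
     "\<forall>x\<in>Y. 0 \<le> u x \<and> u x \<le> 1"
     "\<forall>x\<in>Y. 0 < u x \<longrightarrow> x \<notin> B \<and> (\<exists>k::int. \<bar>w x - \<epsilon> * k\<bar> < \<epsilon> / 4 \<and> f0 x + \<epsilon> < \<epsilon> * k \<and> \<epsilon> * k < f0 x + 5 * \<epsilon>)"
     "cm K {x \<in> Y. u x \<le> 3/4} \<rho>" "\<forall>x\<in>Y \<inter> B. \<rho> x = \<psi> x"
    using ld unfolding local_data_def by (elim exE conjE) (rule that)
  note u = *(1) and w = *(2) and uk = *(4)[rule_format]
  have \<rho>: "cm K {x \<in> Y. u x \<le> 3/4} \<rho>" "\<And>x. x \<in> Y \<Longrightarrow> x \<in> B \<Longrightarrow> \<rho> x = \<psi> x"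
    using *(5,6) by blast+
  have uY: "cf Y u" and wY: "cf Y w" and f1Y: "cf Y f1" and dlY: "cf Y dl"
    using cf_mono[OF _ YX] u w f1 dl by auto
  have pY: "cf Y (p j)" if "j \<in> J" for j using cf_mono[OF J(2)[OF that] YX] .
  \<comment> \<open>Rises from 0 at \<open>u = 1/4\<close> to 1 at \<open>u = 1/2\<close>. The
    coordinates \<open>\<rho>\<close> exist up to \<open>u = 3/4\<close>, so the band from 1/2 to
    3/4 is left for gluing.\<close>
  define uh where "uh x = max 0 (min 1 (4 * u x - 1))" for x
  have uh: "cf Y uh" unfolding uh_def by (intro cf_max cf_min cf_diff cf_mult cf_const uY)
  have uh01: "0 \<le> uh x" "uh x \<le> 1" for x by (auto simp: uh_def)
  have uh0: "uh x = 0 \<longleftrightarrow> u x \<le> 1/4" and uh1: "uh x = 1 \<longleftrightarrow> 1/2 \<le> u x" for x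
    by (auto simp: uh_def max_def min_def)
  \<comment> \<open>Rounding to the nearest multiple of \<open>\<epsilon>\<close>. Where
    \<open>u > 0\<close> the quotient \<open>w x / \<epsilon>\<close> is within 1/4 of an integer,
    so the floor does not jump.\<close>
  define v where "v x = \<epsilon> * of_int \<lfloor>w x / \<epsilon> + 1 / 2\<rfloor>" for x
  have kfloor: "\<lfloor>w x / \<epsilon> + 1 / 2\<rfloor> = k \<and> w x / \<epsilon> + 1 / 2 \<notin> \<int>" if "\<bar>w x - \<epsilon> * k\<bar> < \<epsilon> / 4" for x and k :: int
  proof -
    have "\<bar>w x / \<epsilon> - k\<bar> < 1 / 4" using that \<epsilon> by (simp add: field_simps abs_less_iff)
    then have b: "of_int k + 1/4 < w x / \<epsilon> + 1 / 2" "w x / \<epsilon> + 1 / 2 < of_int k + 3/4" by linarith+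
    then have fl: "\<lfloor>w x / \<epsilon> + 1 / 2\<rfloor> = k" by linarith
    have "w x / \<epsilon> + 1 / 2 \<notin> \<int>"
    proof
      assume "w x / \<epsilon> + 1 / 2 \<in> \<int>"
      then obtain m where "w x / \<epsilon> + 1 / 2 = of_int m" by (elim Ints_cases)
      moreover from this have "m = k" using fl by simp
      ultimately show False using b by simp
    qed
    then show ?thesis using fl by blast
  qed
  have v: "\<exists>k::int. v x = \<epsilon> * k \<and> w x / \<epsilon> + 1 / 2 \<notin> \<int> \<and> f0 x + \<epsilon> < v x \<and> v x < f0 x + 5 * \<epsilon>" if x: "x \<in> Y" "0 < u x" for x
  proof -
    obtain k :: int where k: "\<bar>w x - \<epsilon> * k\<bar> < \<epsilon> / 4" "f0 x + \<epsilon> < \<epsilon> * k" "\<epsilon> * k < f0 x + 5 * \<epsilon>"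
      using uk[OF x] by (elim conjE exE)
    have "v x = \<epsilon> * k" using kfloor[OF k(1)] by (simp add: v_def)
    then show ?thesis using kfloor[OF k(1)] k(2,3) by auto
  qed
  define Yq where "Yq = {x \<in> Y. 1/4 \<le> u x}"
  have Yq: "closedin X Yq" unfolding Yq_def by (intro closedin_le Y cf_const uY)
  have vq: "cf Yq v"
  proof -
    have sub: "Yq \<subseteq> Y" by (auto simp: Yq_def)
    have "cf Yq (\<lambda>x. w x / \<epsilon> + 1 / 2)"
      using \<epsilon> by (intro cf_add cf_divide cf_const cf_mono[OF wY sub]) auto
    then have "cf Yq (\<lambda>x. of_int \<lfloor>w x / \<epsilon> + 1 / 2\<rfloor>)"
      by (rule cf_compose[OF _ continuous_on_of_int_floor]) (use v in \<open>force simp: Yq_def\<close>)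
    then show ?thesis unfolding v_def by (intro cf_mult cf_const)
  qed
  define q where "q x = uh x * (v x - f1 x)" for x
  have q: "cf Y q"
  proof -
    have "cf Yq q" unfolding q_def
      by (intro cf_mult cf_diff vq cf_mono[OF f1Y] cf_mono[OF uh]) (auto simp: Yq_def)
    moreover have "cf {x \<in> Y. u x \<le> 1/4} q"
      by (rule cf_cong[OF cf_const[of _ 0]]) (use uh0 in \<open>auto simp: q_def\<close>)
    moreover have "closedin X {x \<in> Y. u x \<le> 1/4}" by (intro closedin_le Y cf_const uY)
    ultimately have "cf (Yq \<union> {x \<in> Y. u x \<le> 1/4}) q" using Yq by (intro cf_glue)
    moreover have "Yq \<union> {x \<in> Y. u x \<le> 1/4} = Y" by (auto simp: Yq_def)
    ultimately show ?thesis by simp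
  qed
  define F where "F t x = f1 x + t * q x" for t x
  have F: "cf Y (F t)" for t unfolding F_def by (intro cf_add cf_mult cf_const f1Y q)
  have W: "closedin X (leaf p J Y (F t) x0)" for t x0 by (rule closedin_leaf[OF Y J(1) pY F])
  have one: "extends_over K B \<psi> (leaf p J Y (F 1) x0)" if x0: "x0 \<in> Y" for x0
  proof -
    define W where "W = leaf p J Y (F 1) x0"
    define y where "y = F 1 x0"
    have W: "closedin X W" "W \<subseteq> Y" "\<And>x. x \<in> W \<Longrightarrow> F 1 x = y"
      using closedin_leaf[OF Y J(1) pY F] by (auto simp: W_def leaf_def y_def)
    obtain w0 where w0: "{w0} \<in> K" using complex_vertex[OF K] .
    \<comment> \<open>The least multiple of \<open>\<epsilon>\<close> above \<open>y\<close>. Where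
      the movement is complete, \<open>v = y\<close>; where it is partial, \<open>f1 < v\<close>
      gives \<open>y < v\<close> and hence \<open>y' \<le> v\<close>. This gap makes
      \<open>P2\<close> closed and disjoint from \<open>P1\<close>.\<close>
    define y' where "y' = \<epsilon> * (of_int \<lfloor>y / \<epsilon>\<rfloor> + 1)"
    define P1 where "P1 = {x \<in> W. 1/2 \<le> u x}"
    define P2 where "P2 = {x \<in> W. u x \<le> 1/4} \<union> {x \<in> {x \<in> {x \<in> W. 1/4 \<le> u x}. u x \<le> 1/2}. y' \<le> v x}"
    have cW: "cf W u" "cf Y u" using uY W(2) cf_mono by blast+
    have P1: "closedin X P1" unfolding P1_def by (intro closedin_le W cW cf_const)
    have c1: "closedin X {x \<in> W. 1/4 \<le> u x}" by (intro closedin_le W cW cf_const)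
    have "cf {x \<in> W. 1/4 \<le> u x} u" by (rule cf_mono[OF cW(1)]) auto
    then have "closedin X {x \<in> {x \<in> W. 1/4 \<le> u x}. u x \<le> 1/2}" by (rule closedin_le[OF c1 _ cf_const])
    moreover have "cf {x \<in> {x \<in> W. 1/4 \<le> u x}. u x \<le> 1/2} v"
      by (rule cf_mono[OF vq]) (use W(2) in \<open>auto simp: Yq_def\<close>)
    ultimately have "closedin X {x \<in> {x \<in> {x \<in> W. 1/4 \<le> u x}. u x \<le> 1/2}. y' \<le> v x}"
      by (rule closedin_le[OF _ cf_const])
    moreover have "closedin X {x \<in> W. u x \<le> 1/4}" by (intro closedin_le W cW cf_const)
    ultimately have P2: "closedin X P2" unfolding P2_def by (intro closedin_Un)
    have y'_gt: "y < y'"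
    proof -
      have "y / \<epsilon> < of_int \<lfloor>y / \<epsilon>\<rfloor> + 1" by linarith
      then show ?thesis using \<epsilon> by (simp add: y'_def field_simps)
    qed
    have veq: "v x = y" if "x \<in> P1" for x
    proof -
      have "uh x = 1" using that uh1[of x] by (simp add: P1_def)
      then show ?thesis using W(3)[of x] that by (simp add: P1_def F_def q_def)
    qed
    have vgt: "y' \<le> v x" if x: "x \<in> W" "1/4 < u x" "u x < 1/2" for x
    proof -
      have uu: "0 < uh x" "uh x < 1" using uh0[of x] uh1[of x] uh01[of x] x by (simp_all add: less_le)
      have xY: "x \<in> Y" using x W(2) by blast
      obtain k :: int where k: "v x = \<epsilon> * k" "f0 x + \<epsilon> < v x" using v[OF xY] x(2) by force
      have lt: "f1 x < v x" using f1(2)[OF xY] k(2) by linarith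
      have "y = f1 x + uh x * (v x - f1 x)" using W(3)[OF x(1)] by (simp add: F_def q_def)
      also have "\<dots> < f1 x + 1 * (v x - f1 x)" using uu lt by (intro add_strict_left_mono mult_strict_right_mono) auto
      finally have "y < \<epsilon> * k" using k by simp
      then have "y / \<epsilon> < k" using \<epsilon> by (simp add: field_simps)
      then have "\<lfloor>y / \<epsilon>\<rfloor> < k" by (simp add: floor_less_iff)
      then have "of_int \<lfloor>y / \<epsilon>\<rfloor> + 1 \<le> real_of_int k" by linarith
      then show ?thesis using \<epsilon> k(1) by (simp add: y'_def)
    qed
    have disj: "x \<notin> P2" if "x \<in> P1" for x
      using veq[OF that] y'_gt that by (auto simp: P1_def P2_def)
    have un: "P1 \<union> P2 = W"
    proof
      show "P1 \<union> P2 \<subseteq> W" by (auto simp: P1_def P2_def)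
      show "W \<subseteq> P1 \<union> P2"
      proof
        fix x assume x: "x \<in> W"
        consider "u x \<le> 1/4" | "1/4 < u x" "u x < 1/2" | "1/2 \<le> u x" by linarith
        then show "x \<in> P1 \<union> P2" by cases (use x vgt[OF x] in \<open>auto simp: P1_def P2_def\<close>)
      qed
    qed
    \<comment> \<open>\<open>P1\<close> does not meet \<open>B\<close>, since \<open>u > 0\<close>
      there, so the constant map at a vertex will do.\<close>
    have "cm K P1 (\<lambda>x w. if w = w0 then 1 else 0)"
    proof (rule cmI[where W = "{w0}"])
      have "{w. (if w = w0 then 1 else 0) \<noteq> (0::real)} = {w0}" by auto
      then show "{w. (if w = w0 then 1 else 0) \<noteq> (0::real)} \<in> K" using w0 by simp
    qed auto
    moreover have "cm K P2 \<rho>"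
      by (rule cm_mono[OF \<rho>(1)]) (use W(2) in \<open>auto simp: P2_def\<close>)
    ultimately have "cm K (P1 \<union> P2) (\<lambda>x. if x \<in> P1 then (\<lambda>w. if w = w0 then 1 else 0) else \<rho> x)"
      using disj by (intro cm_glue_if P1 P2) blast+
    moreover have "(if x \<in> P1 then (\<lambda>w. if w = w0 then 1 else 0) else \<rho> x) = \<psi> x" if x: "x \<in> W \<inter> B" for x
    proof -
      have "x \<notin> P1" using uk[of x] W(2) x by (auto simp: P1_def)
      then show ?thesis using \<rho>(2)[of x] x W(2) by auto
    qed
    ultimately show ?thesis unfolding extends_over_def W_def[symmetric] un by blast
  qed
  have less_one: "extends_over K B \<psi> (leaf p J Y (F t) x0)" if x0: "x0 \<in> Y" "dl x0 = 0" and t: "t < 1" for x0 t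
  proof -
    define W where "W = leaf p J Y (F t) x0"
    have W: "closedin X W" "W \<subseteq> Y" "\<And>x. x \<in> W \<Longrightarrow> F t x = F t x0" "\<And>x j. x \<in> W \<Longrightarrow> j \<in> J \<Longrightarrow> p j x = p j x0"
      using closedin_leaf[OF Y J(1) pY F] by (auto simp: W_def leaf_def)
    have cW: "cf W u" using uY W(2) cf_mono by blast
    define Wh where "Wh = {x \<in> W. 1/2 \<le> u x}"
    have Wh: "closedin X Wh" unfolding Wh_def by (intro closedin_le W cW cf_const)
    have WhY: "Wh \<subseteq> Yq" using W(2) by (auto simp: Wh_def Yq_def)
    have vWh: "cf Wh v" by (rule cf_mono[OF vq WhY])
    obtain M where M: "0 < M" "\<And>x. x \<in> Wh \<Longrightarrow> \<bar>v x\<bar> \<le> M" using cf_bounded[OF Wh vWh] by blast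
    define I where "I = {- \<lceil>M / \<epsilon>\<rceil>..\<lceil>M / \<epsilon>\<rceil>}"
    \<comment> \<open>On \<open>P k\<close> both \<open>F t\<close> and \<open>v\<close> are
      constant and \<open>F t = (1 - t) * f1 + t * v\<close>. As \<open>t < 1\<close>, also
      \<open>f1\<close> is constant, so \<open>P k\<close> lies in a leaf of \<open>f1\<close>.
      Since \<open>v\<close> is bounded, finitely many \<open>k\<close> suffice.\<close>
    define P where "P k = {x \<in> Wh. v x = \<epsilon> * of_int k}" for k :: int
    have "AEc K (\<Union>k\<in>I. P k)"
    proof (rule AEc_UN_disjoint)
      show "finite I" by (simp add: I_def)
      fix k assume "k \<in> I"
      have "AEc K (P k)"
      proof (cases "P k = {}")
        case True
        then show ?thesis by (auto simp: AEc_def)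
      next
        case False
        then obtain x1 where x1: "x1 \<in> P k" by auto
        then have x1W: "x1 \<in> W" "x1 \<in> Y" using W(2) by (auto simp: P_def Wh_def)
        have "dl x1 = dl x0" by (rule dl(2)) (use x1W W x0 in auto)
        then have ae: "AEc K (leaf p J Y f1 x1)" using gen x0(2) x1W by simp
        have "P k \<subseteq> leaf p J Y f1 x1"
        proof
          fix x assume x: "x \<in> P k"
          then have xW: "x \<in> W" "x \<in> Y" using W(2) by (auto simp: P_def Wh_def)
          have "uh x = 1" "uh x1 = 1" using x x1 uh1 by (auto simp: P_def Wh_def)
          moreover have "v x = v x1" using x x1 by (simp add: P_def)
          moreover have "F t x = F t x1" using W(3) xW(1) x1W(1) by simp
          ultimately have "(1 - t) * f1 x = (1 - t) * f1 x1" by (simp add: F_def q_def algebra_simps)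
          then have "f1 x = f1 x1" using t by simp
          then show "x \<in> leaf p J Y f1 x1" using W(4) xW x1W by (auto simp: leaf_def)
        qed
        then show ?thesis by (rule AEc_mono[OF ae])
      qed
      moreover have "closedin X (P k)" unfolding P_def by (intro closedin_eq Wh vWh cf_const)
      ultimately show "closedin X (P k) \<and> AEc K (P k)" by blast
    next
      fix i j :: int assume "i \<noteq> j"
      then show "P i \<inter> P j = {}" using \<epsilon> by (auto simp: P_def)
    qed
    moreover have "Wh \<subseteq> (\<Union>k\<in>I. P k)"
    proof
      fix x assume x: "x \<in> Wh"
      then have xY: "x \<in> Y" "0 < u x" using W(2) by (auto simp: Wh_def)
      obtain k :: int where k: "v x = \<epsilon> * k" using v[OF xY] by blast
      have "\<bar>\<epsilon> * k\<bar> \<le> M" using M(2)[OF x] k by simp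
      then have "\<bar>real_of_int k\<bar> \<le> M / \<epsilon>" using \<epsilon> by (simp add: abs_mult field_simps)
      then have "k \<in> I" unfolding I_def by (simp add: abs_le_iff) linarith
      then show "x \<in> (\<Union>k\<in>I. P k)" using x k by (auto simp: P_def)
    qed
    ultimately have aeWh: "AEc K Wh" by (rule AEc_mono)
    define Wm where "Wm = {x \<in> Wh. u x \<le> 3/4}"
    have Wm: "closedin X Wm" unfolding Wm_def
      by (intro closedin_le Wh cf_const cf_mono[OF cW]) (auto simp: Wh_def)
    have "cm K Wm \<rho>" by (rule cm_mono[OF \<rho>(1)]) (use W(2) in \<open>auto simp: Wm_def Wh_def\<close>)
    from AEcE[OF aeWh Wm _ this] obtain \<phi> where \<phi>: "cm K Wh \<phi>" "\<And>x. x \<in> Wm \<Longrightarrow> \<phi> x = \<rho> x"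
      by (auto simp: Wm_def)
    define Wl where "Wl = {x \<in> W. u x \<le> 3/4}"
    have Wl: "closedin X Wl" unfolding Wl_def by (intro closedin_le W cf_const cW)
    have "cm K Wl \<rho>" by (rule cm_mono[OF \<rho>(1)]) (use W(2) in \<open>auto simp: Wl_def\<close>)
    then have "cm K (Wl \<union> Wh) (\<lambda>x. if x \<in> Wl then \<rho> x else \<phi> x)"
      using \<phi> by (intro cm_glue_if Wl Wh) (auto simp: Wl_def Wm_def)
    moreover have "Wl \<union> Wh = W" by (auto simp: Wl_def Wh_def)
    moreover have "(if x \<in> Wl then \<rho> x else \<phi> x) = \<psi> x" if x: "x \<in> W \<inter> B" for x
    proof -
      have "\<not> 0 < u x" using uk[of x] W(2) x by auto
      then have "x \<in> Wl" using x by (auto simp: Wl_def)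
      then show ?thesis using \<rho>(2)[of x] x W(2) by auto
    qed
    ultimately show ?thesis unfolding extends_over_def W_def[symmetric] by auto
  qed
  obtain M where M: "0 < M" "\<And>x. x \<in> Y \<Longrightarrow> \<bar>q x\<bar> \<le> M" using cf_bounded[OF Y q] by blast
  \<comment> \<open>Changing \<open>t\<close> by less than \<open>\<eta> / M\<close> changes
    \<open>F t\<close> by at most \<open>\<eta>\<close>, so extendability is open in
    \<open>t\<close>; compactness of the interval then gives one margin for all times.\<close>
  have "\<exists>\<eta>>0. \<forall>t'. \<bar>t' - t\<bar> < \<eta> / M \<longrightarrow> (\<forall>x0\<in>Y. \<bar>dl x0\<bar> \<le> \<eta> \<longrightarrow> extends_over K B \<psi> (leaf p J Y (F t') x0))"
    if t: "t \<in> {0..1}" for t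
  proof -
    obtain F' where F': "\<And>A. cf A F'" "\<And>x. x \<in> Y \<Longrightarrow> F' x = F t x" using tietze_real[OF Y F] by blast
    have leaf_eq: "leaf p J Y F' x0 = leaf p J Y (F t) x0" if "x0 \<in> Y" for x0
      using F'(2) that by (auto simp: leaf_def)
    have "extends_over K B \<psi> (leaf p J Y F' x0)" if "x0 \<in> Y" "dl x0 = 0" for x0
      using one[of x0] less_one[of x0 t] that t leaf_eq[of x0] by (cases "t = 1") auto
    from extends_over_leaves_stable[OF K(1) Y J F'(1) dlY B this]
    obtain \<eta> where \<eta>: "0 < \<eta>"
      "\<And>f' x0. (\<And>x. x \<in> Y \<Longrightarrow> \<bar>f' x - F' x\<bar> \<le> \<eta>) \<Longrightarrow> x0 \<in> Y \<Longrightarrow> \<bar>dl x0\<bar> \<le> \<eta> \<Longrightarrow> extends_over K B \<psi> (leaf p J Y f' x0)"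
      by blast
    show ?thesis
    proof (intro exI[of _ \<eta>] conjI allI impI ballI \<eta>(1))
      fix t' x0 assume t': "\<bar>t' - t\<bar> < \<eta> / M" and x0: "x0 \<in> Y" "\<bar>dl x0\<bar> \<le> \<eta>"
      show "extends_over K B \<psi> (leaf p J Y (F t') x0)"
      proof (rule \<eta>(2)[OF _ x0])
        fix x assume x: "x \<in> Y"
        have "\<bar>F t' x - F' x\<bar> = \<bar>t' - t\<bar> * \<bar>q x\<bar>"
          using F'(2)[OF x] by (simp add: F_def flip: abs_mult) (simp add: algebra_simps)
        also have "\<dots> \<le> \<eta> / M * M" using t' M(2)[OF x] M(1) \<eta>(1) by (intro mult_mono) auto
        finally show "\<bar>F t' x - F' x\<bar> \<le> \<eta>" using M(1) by simp
      qed
    qed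
  qed
  then have "\<forall>t\<in>{0..1}. \<exists>\<eta>. 0 < \<eta> \<and> (\<forall>t'. \<bar>t' - t\<bar> < \<eta> / M \<longrightarrow> (\<forall>x0\<in>Y. \<bar>dl x0\<bar> \<le> \<eta> \<longrightarrow> extends_over K B \<psi> (leaf p J Y (F t') x0)))"
    by simp
  then obtain e where e: "\<forall>t\<in>{0..1}. 0 < e t \<and> (\<forall>t'. \<bar>t' - t\<bar> < e t / M \<longrightarrow> (\<forall>x0\<in>Y. \<bar>dl x0\<bar> \<le> e t \<longrightarrow> extends_over K B \<psi> (leaf p J Y (F t') x0)))"
    by (rule bchoice[THEN exE])
  have cov: "{0..1} \<subseteq> (\<Union>t\<in>{0..1}. ball t (e t / M))" using e M(1) by auto
  obtain T where T: "T \<subseteq> {0..1}" "finite T" "{0..1} \<subseteq> (\<Union>t\<in>T. ball t (e t / M))"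
    by (rule compactE_image[OF compact_Icc _ cov]) auto
  define \<eta> where "\<eta> = Min (e ` T)"
  have "T \<noteq> {}" using T(3) by auto
  have \<eta>: "0 < \<eta>" "\<And>t. t \<in> T \<Longrightarrow> \<eta> \<le> e t"
  proof -
    have "0 < e t" if "t \<in> T" for t using e T(1) that by blast
    then show "0 < \<eta>" unfolding \<eta>_def using T(2) \<open>T \<noteq> {}\<close> by (subst Min_gr_iff) auto
    show "\<eta> \<le> e t" if "t \<in> T" for t unfolding \<eta>_def using T(2) that by (intro Min_le) auto
  qed
  have near: "extends_over K B \<psi> (leaf p J Y (F t) x0)" if t: "t \<in> {0..1}" and x0: "x0 \<in> Y" "\<bar>dl x0\<bar> \<le> \<eta>" for t x0
  proof -
    obtain t0 where t0: "t0 \<in> T" "t \<in> ball t0 (e t0 / M)" using T(3) t by blast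
    then have "\<bar>t - t0\<bar> < e t0 / M" by (simp add: dist_real_def abs_minus_commute)
    moreover have "\<bar>dl x0\<bar> \<le> e t0" using x0(2) \<eta>(2)[OF t0(1)] by simp
    ultimately show ?thesis using e T(1) t0(1) x0(1) by blast
  qed
  define \<theta> where "\<theta> x = min 1 (\<bar>dl x\<bar> / \<eta>)" for x
  have \<theta>: "cf Y \<theta>" unfolding \<theta>_def using \<eta>(1) by (intro cf_min cf_divide cf_abs cf_const dlY) auto
  have \<theta>01: "0 \<le> \<theta> x" "\<theta> x \<le> 1" for x using \<eta>(1) by (auto simp: \<theta>_def)
  define f2 where "f2 x = f1 x + \<theta> x * q x" for x
  show thesis
  proof (rule that)
    show "cf Y f2" unfolding f2_def by (intro cf_add cf_mult f1Y \<theta> q)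
    show "f2 x = f1 x" if "x \<in> Y" "dl x = 0" for x using that by (simp add: f2_def \<theta>_def)
    show "\<bar>f2 x - f0 x\<bar> < 7 * \<epsilon>" if x: "x \<in> Y" for x
    proof -
      \<comment> \<open>Where there is movement, \<open>v\<close> is within
        \<open>5 * \<epsilon>\<close> of \<open>f0\<close> and \<open>f1\<close> within
        \<open>\<epsilon>\<close>, hence the factor 6; the distance from \<open>f1\<close> to
        \<open>f0\<close> then raises it to 7.\<close>
      have "\<bar>q x\<bar> \<le> 6 * \<epsilon>"
      proof (cases "uh x = 0")
        case False
        then have "0 < u x" using uh0[of x] by auto
        then have b: "f0 x + \<epsilon> < v x" "v x < f0 x + 5 * \<epsilon>" using v[OF x] by blast+
        then have b: "\<bar>v x - f1 x\<bar> \<le> 6 * \<epsilon>" using f1(2)[OF x] by linarith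
        have "\<bar>q x\<bar> = uh x * \<bar>v x - f1 x\<bar>" using uh01[of x] by (simp add: q_def abs_mult)
        also have "\<dots> \<le> 1 * (6 * \<epsilon>)" using uh01[of x] b \<epsilon> by (intro mult_mono) auto
        finally show ?thesis by simp
      qed (use \<epsilon> in \<open>simp add: q_def\<close>)
      then have "\<theta> x * \<bar>q x\<bar> \<le> 1 * (6 * \<epsilon>)" using \<theta>01[of x] \<epsilon> by (intro mult_mono) auto
      then have "\<bar>f2 x - f1 x\<bar> \<le> 6 * \<epsilon>" using \<theta>01[of x] by (simp add: f2_def abs_mult)
      then show ?thesis using f1(2)[OF x] by linarith
    qed
    show "extends_over K B \<psi> (leaf p J Y f2 x0)" if x0: "x0 \<in> Y" for x0
    proof -
      have "\<theta> x = \<theta> x0" if "x \<in> Y" "\<And>j. j \<in> J \<Longrightarrow> p j x = p j x0" for x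
        using dl(2)[OF that(1) x0 that(2)] by (simp add: \<theta>_def)
      then have eq: "leaf p J Y f2 x0 = leaf p J Y (F (\<theta> x0)) x0"
        by (auto simp: leaf_def f2_def F_def)
      show ?thesis
      proof (cases "\<bar>dl x0\<bar> \<le> \<eta>")
        case True
        then show ?thesis unfolding eq using near[of "\<theta> x0" x0] \<theta>01[of x0] x0 by simp
      next
        case False
        then have "\<theta> x0 = 1" using \<eta>(1) by (simp add: \<theta>_def field_simps)
        then show ?thesis unfolding eq using one[OF x0] by simp
      qed
    qed
  qed
qed

section \<open>Countably many test problems\<close>

lemma countable_dense_nonneg:
  obtains \<D> :: "('a \<Rightarrow> real) set" where "countable \<D>" "\<And>d A. d \<in> \<D> \<Longrightarrow> cf A d"
    "\<And>f \<epsilon>. cf (topspace X) f \<Longrightarrow> (\<And>x. x \<in> topspace X \<Longrightarrow> 0 \<le> f x) \<Longrightarrow> 0 < \<epsilon> \<Longrightarrow>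
      \<exists>d\<in>\<D>. \<forall>x\<in>topspace X. \<bar>f x - d x\<bar> \<le> \<epsilon>"
proof -
  obtain M d where Md: "Metric_space M d" and X: "X = Metric_space.mtopology M d"
    using metrizableX unfolding metrizable_space_def by blast
  interpret Metric_space M d by fact
  have topX: "topspace X = M" by (simp add: X)
  have "compactin mtopology M" using compactX by (simp add: X compact_space_def)
  then have "mtotally_bounded M" by (rule compactin_imp_mtotally_bounded)
  then have "\<exists>F. finite F \<and> F \<subseteq> M \<and> M \<subseteq> (\<Union>x\<in>F. mball x (1 / real (Suc n)))" for n
    unfolding mtotally_bounded_def by simp
  then obtain F where F: "\<And>n. finite (F n)" "\<And>n. F n \<subseteq> M" "\<And>n. M \<subseteq> (\<Union>x\<in>F n. mball x (1 / real (Suc n)))"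
    by metis
  define S where "S = (\<Union>n. F n)"
  have S: "countable S" "S \<subseteq> M" using F by (auto simp: S_def intro: countable_finite)
  have dense: "\<exists>a\<in>S. d a x < r" if x: "x \<in> M" and r: "0 < r" for x r
  proof -
    obtain n where n: "1 / real (Suc n) < r" using nat_approx_posE[OF r] by blast
    obtain a where "a \<in> F n" "x \<in> mball a (1 / real (Suc n))" using F(3)[of n] x by blast
    then show ?thesis using n by (intro bexI[of _ a]) (auto simp: S_def)
  qed
  have dcont: "cf A (\<lambda>x. d a x)" if "a \<in> M" for a A
  proof -
    have "dist (d a b) (d a x) < \<epsilon>" if "b \<in> M" "x \<in> M" "d b x < \<epsilon>" for b x \<epsilon>
      using triangle[of a b x] triangle[of a x b] commute[of b x] that \<open>a \<in> M\<close>
      unfolding dist_real_def by (simp add: abs_less_iff)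
    then have "continuous_map mtopology (Metric_space.mtopology UNIV dist) (\<lambda>x. d a x)"
      unfolding metric_continuous_map[OF Met_TC.Metric_space_axioms] by blast
    then have "continuous_map mtopology euclideanreal (\<lambda>x. d a x)" by simp
    then have "continuous_map X euclideanreal (\<lambda>x. d a x)" by (simp add: X)
    then show ?thesis unfolding cf_def by (rule continuous_map_from_subtopology)
  qed
  \<comment> \<open>Downward cones with rational height, integer slope and apex in a countable dense
    set. Finite maxima of them and 0 approximate a nonnegative function from below: each point has
    such a cone that is nowhere above the function and close to it nearby.\<close>
  define tent where "tent = (\<lambda>(q :: real, k :: nat, a) x. q - k * d a x)"
  define I where "I = (\<rat> :: real set) \<times> (UNIV :: nat set) \<times> S"
  have I: "countable I" unfolding I_def using S(1) by (intro countable_SIGMA countable_rat) auto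
  define g where "g T x = Max (insert 0 ((\<lambda>i. tent i x) ` T))" for T x
  define \<D> where "\<D> = g ` {T. finite T \<and> T \<subseteq> I}"
  show thesis
  proof (rule that)
    show "countable \<D>" unfolding \<D>_def using I by (intro countable_image countable_Collect_finite_subset)
    fix e A assume "e \<in> \<D>"
    then obtain T where T: "finite T" "T \<subseteq> I" "e = g T" by (auto simp: \<D>_def)
    have t: "cf A (\<lambda>x. tent i x)" if "i \<in> T" for i
      using that T(2) S(2) dcont by (cases i) (auto simp: tent_def I_def intro!: cf_diff cf_mult)
    show "cf A e"
    proof (cases "T = {}")
      case True
      then have "e = (\<lambda>x. 0)" using T(3) by (simp add: g_def fun_eq_iff)
      then show ?thesis by simp
    next
      case False
      have "cf A (\<lambda>x. max 0 (Max ((\<lambda>i. tent i x) ` T)))"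
        by (intro cf_max cf_const cf_Max T False t)
      moreover have "e = (\<lambda>x. max 0 (Max ((\<lambda>i. tent i x) ` T)))"
        unfolding T(3) g_def using False T(1) by (auto simp: fun_eq_iff)
      ultimately show ?thesis by simp
    qed
  next
    fix f and \<epsilon>' :: real
    assume f: "cf (topspace X) f" "\<And>x. x \<in> topspace X \<Longrightarrow> 0 \<le> f x" and e': "0 < \<epsilon>'"
    \<comment> \<open>Five shares: one for the oscillation of \<open>f\<close> near
      \<open>x\<close>, two for the gap between \<open>f x\<close> and the height \<open>q\<close>,
      two for the slope.\<close>
    define \<epsilon> where "\<epsilon> = \<epsilon>' / 5"
    have e: "0 < \<epsilon>" using e' by (simp add: \<epsilon>_def)
    have "\<exists>i r. i \<in> I \<and> 0 < r \<and> (\<forall>y\<in>M. tent i y \<le> f y) \<and> (\<forall>y\<in>mball x r. f y \<le> tent i y + 5 * \<epsilon>)" if x: "x \<in> M" for x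
    proof -
      have "openin X {y \<in> topspace X. \<bar>f y - f x\<bar> < \<epsilon>}" by (intro openin_less cf_abs cf_diff cf_const f)
      moreover have "x \<in> {y \<in> topspace X. \<bar>f y - f x\<bar> < \<epsilon>}" using x e topX by simp
      ultimately obtain r0 where r0: "0 < r0" "mball x r0 \<subseteq> {y \<in> topspace X. \<bar>f y - f x\<bar> < \<epsilon>}"
        unfolding X openin_mtopology by blast
      define r where "r = r0 / 2"
      have r: "0 < r" "\<And>y. y \<in> M \<Longrightarrow> d x y < 2 * r \<Longrightarrow> \<bar>f y - f x\<bar> < \<epsilon>"
        using r0 x by (auto simp: r_def subset_iff)
      obtain q where q: "q \<in> \<rat>" "f x - 2 * \<epsilon> < q" "q < f x - \<epsilon>" using Rats_dense_in_real[of "f x - 2 * \<epsilon>" "f x - \<epsilon>"] e by auto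
      \<comment> \<open>Steep enough for the cone to be nonpositive at distance \<open>r\<close>
        from its apex; closer to the apex \<open>f\<close> itself exceeds \<open>q\<close>.\<close>
      obtain k :: nat where "q / r \<le> k" using real_arch_simple by blast
      then have k: "q \<le> k * r" using r(1) by (simp add: field_simps)
      define s where "s = min r (\<epsilon> / (k + 1))"
      have s: "0 < s" "s \<le> r" "s * k \<le> \<epsilon>"
      proof -
        show "0 < s" using r e by (simp add: s_def)
        show "s \<le> r" by (simp add: s_def)
        have "s * k \<le> \<epsilon> / (k + 1) * k" by (intro mult_right_mono) (auto simp: s_def)
        also have "\<dots> \<le> \<epsilon>" using e by (simp add: field_simps)
        finally show "s * k \<le> \<epsilon>" .
      qed
      obtain a where a: "a \<in> S" "d a x < s" using dense[OF x s(1)] by blast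
      then have aM: "a \<in> M" using S by blast
      have "tent (q, k, a) y \<le> f y" if y: "y \<in> M" for y
      proof (cases "d a y < r")
        case True
        have "d x y \<le> d x a + d a y" using x y aM by (rule_tac triangle)
        then have "d x y < 2 * r" using True a(2) s(2) commute[of a x] by simp
        then have "\<bar>f y - f x\<bar> < \<epsilon>" using r(2) y by blast
        then have "q \<le> f y" using q(3) by linarith
        moreover have "0 \<le> k * d a y" by simp
        moreover have "tent (q, k, a) y = q - k * d a y" by (simp add: tent_def)
        ultimately show ?thesis by linarith
      next
        case False
        then have "k * r \<le> k * d a y" by (intro mult_left_mono) auto
        then have "tent (q, k, a) y \<le> 0" using k by (simp add: tent_def)
        then show ?thesis using f(2)[of y] y topX by simp
      qed
      moreover have "f y \<le> tent (q, k, a) y + 5 * \<epsilon>" if "y \<in> mball x s" for y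
      proof -
        have y: "y \<in> M" "d x y < s" using that by auto
        then have "\<bar>f y - f x\<bar> < \<epsilon>" using r(2)[of y] s by simp
        moreover have "d a y \<le> d a x + d x y" using x y(1) aM by (rule_tac triangle)
        then have "d a y \<le> 2 * s" using a y by simp
        then have "k * d a y \<le> k * (2 * s)" by (intro mult_left_mono) auto
        then have "k * d a y \<le> 2 * \<epsilon>" using s(3) by (simp add: mult.commute mult.left_commute)
        ultimately show ?thesis using q(2) by (simp add: tent_def)
      qed
      moreover have "(q, k, a) \<in> I" using q(1) a(1) by (simp add: I_def)
      ultimately show ?thesis using s(1) by blast
    qed
    then obtain i r where ir: "\<And>x. x \<in> M \<Longrightarrow> i x \<in> I \<and> 0 < r x \<and> (\<forall>y\<in>M. tent (i x) y \<le> f y) \<and> (\<forall>y\<in>mball x (r x). f y \<le> tent (i x) y + 5 * \<epsilon>)"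
      by metis
    have "openin X (mball x (r x)) \<and> x \<in> mball x (r x)" if "x \<in> topspace X" for x
      using ir[of x] that topX by (simp add: X)
    from finite_subcover[OF closedin_topspace this] obtain C where C: "finite C" "C \<subseteq> topspace X"
      "topspace X \<subseteq> (\<Union>x\<in>C. mball x (r x))" by blast
    show "\<exists>d\<in>\<D>. \<forall>x\<in>topspace X. \<bar>f x - d x\<bar> \<le> \<epsilon>'"
    proof
      show "g (i ` C) \<in> \<D>" using C ir topX by (auto simp: \<D>_def)
      show "\<forall>x\<in>topspace X. \<bar>f x - g (i ` C) x\<bar> \<le> \<epsilon>'"
      proof
        fix x assume x: "x \<in> topspace X"
        then obtain y where y: "y \<in> C" "x \<in> mball y (r y)" using C(3) by blast
        have "g (i ` C) x \<le> f x"
          unfolding g_def using C(1,2) ir f(2)[OF x] x topX by (subst Max_le_iff) auto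
        moreover have "tent (i y) x \<le> g (i ` C) x"
          unfolding g_def using C(1) y(1) by (intro Max_ge) auto
        moreover have "f x \<le> tent (i y) x + 5 * \<epsilon>" using ir[of y] y C(2) topX by blast
        ultimately show "\<bar>f x - g (i ` C) x\<bar> \<le> \<epsilon>'" by (simp add: \<epsilon>_def)
      qed
    qed
  qed
qed

text \<open>A test problem takes functions of the countable dense family as coordinates at finitely
  many vertices and pushes them into the cone. Every problem is close to a test problem, and an
  extension of the latter can be corrected by the small difference and pushed into the complex
  again.\<close>

lemma detecting_family:
  fixes K :: "'w set set"
  assumes K: "abstract_simplicial_complex K" and count: "countable (\<Union>K)"
  obtains B :: "nat \<Rightarrow> 'a set" and \<psi> :: "nat \<Rightarrow> 'a \<Rightarrow> 'w \<Rightarrow> real" where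
    "\<And>i. closedin X (B i)" "\<And>i. cm K (B i) (\<psi> i)"
    "\<And>F. closedin X F \<Longrightarrow> (\<And>i. extends_over K (B i) (\<psi> i) F) \<Longrightarrow> AEc K F"
proof -
  obtain \<D> :: "('a \<Rightarrow> real) set" where \<D>: "countable \<D>" "\<And>d A. d \<in> \<D> \<Longrightarrow> cf A d"
    "\<And>f \<epsilon>. cf (topspace X) f \<Longrightarrow> (\<And>x. x \<in> topspace X \<Longrightarrow> 0 \<le> f x) \<Longrightarrow> 0 < \<epsilon> \<Longrightarrow>
      \<exists>d\<in>\<D>. \<forall>x\<in>topspace X. \<bar>f x - d x\<bar> \<le> \<epsilon>"
    using countable_dense_nonneg by blast
  define I where "I = (SIGMA W:{W. finite W \<and> W \<subseteq> \<Union>K}. Pi\<^sub>E W (\<lambda>_. \<D>)) \<times> (UNIV :: nat set)"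
  have cI: "countable I" unfolding I_def
    by (intro countable_SIGMA countable_Collect_finite_subset[OF count]) (auto intro!: countable_PiE \<D>(1))
  have "(({}, \<lambda>_. undefined), 0) \<in> I" by (auto simp: I_def)
  then have nI: "I \<noteq> {}" by blast
  define \<psi>0 where "\<psi>0 = (\<lambda>((W, d), m :: nat) x. push K W (\<lambda>w. (d :: 'w \<Rightarrow> 'a \<Rightarrow> real) w x))"
  \<comment> \<open>A pushed vector may be the apex. The lower bound on the sum cuts out a closed
    set away from it, and \<open>m\<close> lets these sets grow.\<close>
  define B0 where "B0 = (\<lambda>((W, d), m :: nat). {x \<in> topspace X. 1 / real (Suc m) \<le> (\<Sum>w\<in>W. \<psi>0 ((W, d), m) x w)})"
  have \<psi>0cf: "cf A (\<lambda>x. \<psi>0 ((W, d), m) x w)" if "((W, d), m) \<in> I" for W d m w A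
    unfolding \<psi>0_def using that \<D>(2) by (auto simp: I_def PiE_def Pi_def intro!: cf_push)
  have B0: "closedin X (B0 j) \<and> cm K (B0 j) (\<psi>0 j)" if j: "j \<in> I" for j
  proof -
    obtain W d m where jj: "j = ((W, d), m)" by (metis surj_pair)
    have W: "finite W" using j by (auto simp: jj I_def)
    have "closedin X (B0 j)" unfolding jj B0_def prod.case
      by (intro closedin_le closedin_topspace cf_const cf_sum W) (use j \<psi>0cf in \<open>auto simp: jj\<close>)
    moreover have "cm (insert {} K) (B0 j) (\<psi>0 j)"
    proof (rule cmI[OF _ _ _ W])
      show "cf (B0 j) (\<lambda>x. \<psi>0 j x w)" for w using \<psi>0cf j by (simp add: jj)
      show "{w. \<psi>0 j x w \<noteq> 0} \<in> insert {} K" for x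
        using push_support[OF W, of K "\<lambda>w. d w x"] by (simp add: \<psi>0_def jj)
    qed (auto simp: \<psi>0_def jj push_nonneg push_outside)
    moreover have "\<psi>0 j x \<noteq> (\<lambda>_. 0)" if "x \<in> B0 j" for x
    proof
      assume "\<psi>0 j x = (\<lambda>_. 0)"
      then have "(\<Sum>w\<in>W. \<psi>0 ((W, d), m) x w) = 0" by (simp add: jj)
      then show False using that by (simp add: B0_def jj)
    qed
    ultimately show ?thesis using cm_nonzero by blast
  qed
  define J where "J = from_nat_into I"
  have J: "J i \<in> I" for i using from_nat_into[OF nI] by (simp add: J_def)
  have surjJ: "\<exists>i. J i = j" if "j \<in> I" for j
    using range_from_nat_into[OF nI cI] that unfolding J_def by (metis imageE)
  show thesis
  proof (rule that[of "\<lambda>i. B0 (J i)" "\<lambda>i. \<psi>0 (J i)"])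
    show "closedin X (B0 (J i))" "cm K (B0 (J i)) (\<psi>0 (J i))" for i using B0[OF J] by auto
    fix F assume F: "closedin X F" and ext: "\<And>i. extends_over K (B0 (J i)) (\<psi>0 (J i)) F"
    have FX: "F \<subseteq> topspace X" using F closedin_subset by blast
    show "AEc K F"
      unfolding AEc_def
    proof (intro allI impI; elim conjE)
      fix A \<phi> assume A: "closedin X A" "A \<subseteq> F" and \<phi>: "cm K A (\<phi> :: 'a \<Rightarrow> 'w \<Rightarrow> real)"
      have K0: "{} \<notin> K" using K by (auto simp: abstract_simplicial_complex_def)
      obtain W0 where W0: "finite W0" "\<And>x w. x \<in> A \<Longrightarrow> w \<notin> W0 \<Longrightarrow> \<phi> x w = 0" using cm_vertices \<phi> by blast
      define W where "W = W0 \<inter> \<Union>K"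
      have W: "finite W" "W \<subseteq> \<Union>K" using W0 by (auto simp: W_def)
      have W\<phi>: "\<phi> x w = 0" if "x \<in> A" "w \<notin> W" for x w
      proof (rule ccontr)
        assume "\<phi> x w \<noteq> 0"
        then have "w \<in> W0" "w \<in> \<Union>K" using W0(2)[OF that(1)] cmD(3)[OF \<phi> that(1)] by auto
        then show False using that(2) by (simp add: W_def)
      qed
      define n where "n = real (card W) + 1"
      have n: "1 \<le> n" "real (card W) \<le> n" by (simp_all add: n_def)
      have "cf A (\<lambda>x. \<Sum>w\<in>W. \<phi> x w)" by (intro cf_sum W(1) cmD(1)[OF \<phi>])
      moreover have "0 < (\<Sum>w\<in>W. \<phi> x w)" if "x \<in> A" for x by (rule cm_sum_pos[OF \<phi> K0 W(1) W\<phi> that])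
      ultimately obtain \<mu> where \<mu>: "0 < \<mu>" "\<And>x. x \<in> A \<Longrightarrow> \<mu> \<le> (\<Sum>w\<in>W. \<phi> x w)"
        using pos_min[OF A(1)] by blast
      \<comment> \<open>Small enough for two purposes. The total error is at most
        \<open>\<mu> / 32\<close>, which keeps the sum of \<open>\<psi>\<close> above
        \<open>\<mu> / 2\<close> on \<open>A\<close>. A sum of \<open>\<beta>\<close> above
        \<open>\<mu> / 4\<close> forces a coordinate above \<open>8 * \<delta>\<close>, which
        survives a change by \<open>2 * \<delta>\<close> and the subtraction of a level of at most
        \<open>2 * \<delta>\<close>.\<close>
      define \<delta> where "\<delta> = \<mu> / (64 * n)"
      have \<delta>: "0 < \<delta>" using \<mu> n by (simp add: \<delta>_def)
      have n\<delta>: "64 * (n * \<delta>) = \<mu>" using n by (simp add: \<delta>_def)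
      have Wn: "real (card W) * (2 * \<delta>) \<le> \<mu> / 32"
      proof -
        have "real (card W) * (2 * \<delta>) \<le> n * (2 * \<delta>)" using n \<delta> by (intro mult_right_mono) auto
        then show ?thesis using n\<delta> by simp
      qed
      have "\<exists>d\<in>\<D>. \<forall>x\<in>A. \<bar>\<phi> x w - d x\<bar> \<le> \<delta>" for w
      proof -
        obtain c where c: "\<And>B. cf B c" "\<And>x. x \<in> topspace X \<Longrightarrow> c x \<in> {0..}" "\<And>x. x \<in> A \<Longrightarrow> c x = \<phi> x w"
          by (rule tietze[OF A(1) cmD(1)[OF \<phi>, of w], of "{0..}"])
            (auto simp: cmD(2)[OF \<phi>] is_interval_ci)
        obtain d where "d \<in> \<D>" "\<forall>x\<in>topspace X. \<bar>c x - d x\<bar> \<le> \<delta>" using \<D>(3)[OF c(1) _ \<delta>] c(2) by auto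
        moreover have "\<forall>x\<in>A. \<bar>\<phi> x w - d x\<bar> \<le> \<delta>"
        proof
          fix x assume x: "x \<in> A"
          then have "x \<in> topspace X" using A(2) FX by blast
          then show "\<bar>\<phi> x w - d x\<bar> \<le> \<delta>" using calculation(2) c(3)[OF x] by fastforce
        qed
        ultimately show ?thesis by blast
      qed
      then obtain d0 where d0: "\<And>w. d0 w \<in> \<D>" "\<And>w x. x \<in> A \<Longrightarrow> \<bar>\<phi> x w - d0 w x\<bar> \<le> \<delta>" by metis
      define d where "d = restrict d0 W"
      \<comment> \<open>Chosen so that the domain of the test problem contains
        \<open>A\<close>.\<close>
      obtain m where m: "1 / real (Suc m) < \<mu> / 2" using nat_approx_posE[of "\<mu> / 2"] \<mu>(1) by auto
      define j where "j = ((W, d), m)"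
      have jI: "j \<in> I" unfolding j_def I_def d_def using W d0(1) by auto
      then obtain i where i: "J i = j" using surjJ by blast
      define \<psi> where "\<psi> = \<psi>0 j"
      have close: "\<bar>\<phi> x w - \<psi> x w\<bar> \<le> 2 * \<delta>" if x: "x \<in> A" for x w
      proof (cases "w \<in> W")
        case False
        then show ?thesis using W\<phi>[OF x False] \<delta> by (simp add: \<psi>_def \<psi>0_def j_def push_outside)
      next
        case True
        let ?l = "nonface_level K W (\<lambda>w. d w x)"
        have "nonface_level K W (\<phi> x) = 0"
          by (rule nonface_level_eq_0[OF K W(1)]) (use cmD(2,3)[OF \<phi> x] in auto)
        moreover have "?l \<le> nonface_level K W (\<phi> x) + \<delta>"
        proof (rule nonface_level_mono_add[OF W(1)])
          fix w assume "w \<in> W"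
          then show "d w x \<le> \<phi> x w + \<delta>" using d0(2)[OF x, of w] by (simp add: d_def abs_le_iff)
        qed (use \<delta> in simp)
        ultimately have l: "0 \<le> ?l" "?l \<le> \<delta>" using nonface_level_nonneg[OF W(1)] by auto
        have "\<psi> x w = max 0 (d w x - ?l)" using True by (simp add: \<psi>_def \<psi>0_def j_def push_def)
        moreover have "\<bar>\<phi> x w - d w x\<bar> \<le> \<delta>" using d0(2)[OF x, of w] True by (simp add: d_def)
        moreover have "0 \<le> \<phi> x w" using cmD(2)[OF \<phi> x] .
        ultimately show ?thesis using l \<delta> by (simp add: abs_le_iff max_def)
      qed
      have \<psi>sum: "\<mu> / 2 \<le> (\<Sum>w\<in>W. \<psi> x w)" if x: "x \<in> A" for x
      proof -
        have "(\<Sum>w\<in>W. \<phi> x w) - (\<Sum>w\<in>W. \<psi> x w) = (\<Sum>w\<in>W. \<phi> x w - \<psi> x w)" by (simp add: sum_subtractf)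
        also have "\<dots> \<le> real (card W) * (2 * \<delta>)"
          by (rule sum_bounded_above) (use close[OF x] in \<open>simp add: abs_le_iff\<close>)
        finally show ?thesis using Wn \<mu>(2)[OF x] \<mu>(1) by linarith
      qed
      have AB: "A \<subseteq> B0 j"
        using \<psi>sum m A(2) FX by (fastforce simp: B0_def j_def \<psi>_def)
      have \<psi>c: "cm K A \<psi>" unfolding \<psi>_def by (rule cm_mono[OF _ AB]) (use B0[OF jI] in blast)
      obtain \<beta> where \<beta>: "cm K F \<beta>" "\<And>x. x \<in> A \<Longrightarrow> \<beta> x = \<psi> x"
        using ext[of i] AB A(2) unfolding extends_over_def i \<psi>_def by blast
      obtain W' where W': "finite W'" "\<And>x w. x \<in> F \<Longrightarrow> w \<notin> W' \<Longrightarrow> \<beta> x w = 0" using cm_vertices \<beta>(1) by blast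
      have "\<exists>e. (\<forall>B. cf B e) \<and> (\<forall>x\<in>topspace X. e x \<in> {- 2 * \<delta>..2 * \<delta>}) \<and> (\<forall>x\<in>A. e x = \<phi> x w - \<psi> x w)" for w
      proof -
        have "cf A (\<lambda>x. \<phi> x w - \<psi> x w)" by (intro cf_diff cmD(1)[OF \<phi>] cmD(1)[OF \<psi>c])
        moreover have "\<phi> x w - \<psi> x w \<in> {- 2 * \<delta>..2 * \<delta>}" if "x \<in> A" for x using close[OF that, of w] by auto
        ultimately obtain e where "\<And>B. cf B e" "\<And>x. x \<in> topspace X \<Longrightarrow> e x \<in> {- 2 * \<delta>..2 * \<delta>}" "\<And>x. x \<in> A \<Longrightarrow> e x = \<phi> x w - \<psi> x w"
          using tietze[OF A(1), of "\<lambda>x. \<phi> x w - \<psi> x w" "{- 2 * \<delta>..2 * \<delta>}"] \<delta> is_interval_cc by auto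
        then show ?thesis by blast
      qed
      then obtain e where "\<And>w. (\<forall>B. cf B (e w)) \<and> (\<forall>x\<in>topspace X. e w x \<in> {- 2 * \<delta>..2 * \<delta>}) \<and> (\<forall>x\<in>A. e w x = \<phi> x w - \<psi> x w)"
        by metis
      then have e: "\<And>w B. cf B (e w)" "\<And>w x. x \<in> topspace X \<Longrightarrow> e w x \<in> {- 2 * \<delta>..2 * \<delta>}" "\<And>w x. x \<in> A \<Longrightarrow> e w x = \<phi> x w - \<psi> x w"
        by blast+
      \<comment> \<open>Where the coordinates of \<open>\<beta>\<close> on \<open>W\<close> are
        small, the correction could push the value to the apex. It is switched off there by
        \<open>\<kappa>\<close>, which is possible because the sum is at least
        \<open>\<mu> / 2\<close> on \<open>A\<close>.\<close>
      define Z where "Z = {x \<in> F. (\<Sum>w\<in>W. \<beta> x w) \<le> \<mu> / 4}"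
      have Z: "closedin X Z" unfolding Z_def by (intro closedin_le F cf_const cf_sum W(1) cmD(1)[OF \<beta>(1)])
      have ZA: "Z \<inter> A = {}"
      proof -
        have "x \<notin> Z" if "x \<in> A" for x using \<psi>sum[OF that] \<beta>(2)[OF that] \<mu>(1) by (simp add: Z_def)
        then show ?thesis by blast
      qed
      obtain \<kappa> where \<kappa>: "\<And>C. cf C \<kappa>" "\<And>x. x \<in> topspace X \<Longrightarrow> 0 \<le> \<kappa> x \<and> \<kappa> x \<le> 1"
        "\<And>x. x \<in> Z \<Longrightarrow> \<kappa> x = 0" "\<And>x. x \<in> A \<Longrightarrow> \<kappa> x = 1"
        by (rule urysohn[OF Z A(1) ZA]) (rule that; (assumption | simp))
      define V where "V = W \<union> W'"
      have V: "finite V" using W W' by (simp add: V_def)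
      define c where "c x w = max 0 (\<beta> x w + (if w \<in> W then \<kappa> x * e w x else 0))" for x w
      have cb: "\<bar>c x w - \<beta> x w\<bar> \<le> 2 * \<delta>" if x: "x \<in> F" for x w
      proof -
        have xX: "x \<in> topspace X" using x FX by blast
        have "\<bar>\<kappa> x * e w x\<bar> \<le> 1 * (2 * \<delta>)"
          unfolding abs_mult using \<kappa>(2)[OF xX] e(2)[OF xX, of w] \<delta> by (intro mult_mono) auto
        then show ?thesis using cmD(2)[OF \<beta>(1) x, of w] \<delta> by (auto simp: c_def abs_le_iff max_def)
      qed
      define \<beta>' where "\<beta>' x = push K V (c x)" for x
      have "cm (insert {} K) F \<beta>'"
      proof (rule cmI[OF _ _ _ V])
        show "cf F (\<lambda>x. \<beta>' x w)" for w
          unfolding \<beta>'_def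
        proof (rule cf_push[OF V])
          show "cf F (\<lambda>x. c x w)" for w
            unfolding c_def by (cases "w \<in> W") (auto intro!: cf_max cf_add cf_mult \<kappa> e cmD(1)[OF \<beta>(1)])
        qed
        show "{w. \<beta>' x w \<noteq> 0} \<in> insert {} K" for x unfolding \<beta>'_def by (rule push_support[OF V])
      qed (auto simp: \<beta>'_def push_nonneg push_outside)
      moreover have "\<beta>' x \<noteq> (\<lambda>_. 0)" if x: "x \<in> F" for x
      proof (cases "\<kappa> x = 0")
        case True
        then have "c x = \<beta> x" using cmD(2)[OF \<beta>(1) x] by (auto simp: c_def)
        then have "\<beta>' x = \<beta> x"
          unfolding \<beta>'_def using push_eq_self[OF K V, of "\<beta> x"] cmD(2,3)[OF \<beta>(1) x] W'(2)[OF x] by (auto simp: V_def)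
        then show ?thesis using cm_neq_zero[OF \<beta>(1) K x] by simp
      next
        case False
        then have "x \<notin> Z" using \<kappa>(3) by blast
        then have big: "\<mu> / 4 < (\<Sum>w\<in>W. \<beta> x w)" using x by (simp add: Z_def)
        have "\<exists>w\<in>W. 8 * \<delta> < \<beta> x w"
        proof (rule ccontr)
          assume "\<not> ?thesis"
          then have "(\<Sum>w\<in>W. \<beta> x w) \<le> real (card W) * (8 * \<delta>)" by (intro sum_bounded_above) auto
          also have "\<dots> \<le> \<mu> / 8" using Wn by simp
          finally show False using big \<mu>(1) by linarith
        qed
        then obtain w where w: "w \<in> W" "8 * \<delta> < \<beta> x w" by blast
        have "nonface_level K V (c x) \<le> nonface_level K V (\<beta> x) + 2 * \<delta>"
        proof (rule nonface_level_mono_add[OF V])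
          show "c x w \<le> \<beta> x w + 2 * \<delta>" for w using cb[OF x, of w] by linarith
        qed (use \<delta> in simp)
        moreover have "nonface_level K V (\<beta> x) = 0"
          by (rule nonface_level_eq_0[OF K V]) (use cmD(2,3)[OF \<beta>(1) x] in auto)
        moreover have "6 * \<delta> < c x w" using cb[OF x, of w] w(2) by (simp add: abs_le_iff)
        ultimately have "0 < \<beta>' x w" using w(1) \<delta> by (simp add: \<beta>'_def push_def V_def)
        then show ?thesis by auto
      qed
      ultimately have "cm K F \<beta>'" by (rule cm_nonzero)
      moreover have "\<beta>' x = \<phi> x" if x: "x \<in> A" for x
      proof -
        have "c x w = \<phi> x w" for w
        proof (cases "w \<in> W")
          case True
          then show ?thesis using e(3)[OF x] \<kappa>(4)[OF x] \<beta>(2)[OF x] cmD(2)[OF \<phi> x, of w] by (simp add: c_def)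
        next
          case False
          then have "\<psi> x w = 0" by (simp add: \<psi>_def \<psi>0_def j_def push_outside)
          then show ?thesis using False W\<phi>[OF x False] \<beta>(2)[OF x] by (simp add: c_def)
        qed
        then have "c x = \<phi> x" by auto
        then show ?thesis unfolding \<beta>'_def
          using push_eq_self[OF K V, of "\<phi> x"] cmD(2,3)[OF \<phi> x] W\<phi>[OF x] by (auto simp: V_def)
      qed
      ultimately show "\<exists>\<phi>'. cm K F \<phi>' \<and> (\<forall>x\<in>A. \<phi>' x = \<phi> x)" by blast
    qed
  qed
qed

end

section \<open>Generic functions\<close>

text \<open>Iterated suspensions of \<open>K 0\<close> with the poles left unspecified. Each
  coordinate function trades one level: the fibres of the first \<open>k\<close> of \<open>n\<close>
  coordinates are tested against \<open>K (n - k)\<close>.\<close>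

definition susp_tower :: "(nat \<Rightarrow> 'w set set) \<Rightarrow> bool" where
  "susp_tower K \<longleftrightarrow> abstract_simplicial_complex (K 0) \<and> K 0 \<noteq> {} \<and> countable (\<Union>(K 0)) \<and>
     (\<forall>n. \<exists>S N. S \<noteq> N \<and> S \<notin> \<Union>(K n) \<and> N \<notin> \<Union>(K n) \<and> K (Suc n) = susp (K n) S N)"

lemma susp_tower_complex:
  assumes "susp_tower K"
  shows "abstract_simplicial_complex (K n) \<and> K n \<noteq> {} \<and> countable (\<Union>(K n))"
proof (induction n)
  case 0
  then show ?case using assms by (simp add: susp_tower_def)
next
  case (Suc n)
  have "\<exists>S N. S \<noteq> N \<and> S \<notin> \<Union>(K n) \<and> N \<notin> \<Union>(K n) \<and> K (Suc n) = susp (K n) S N"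
    using assms unfolding susp_tower_def by simp
  then obtain S N where SN: "K (Suc n) = susp (K n) S N" "S \<noteq> N" by (elim exE conjE) (rule that)
  have "v \<in> insert S (insert N (\<Union>(K n)))" if v: "v \<in> \<Union>(susp (K n) S N)" for v
  proof -
    obtain t where t: "v \<in> t" "t \<in> susp (K n) S N" using v by (rule UnionE)
    then have "t - {S, N} = {} \<or> t - {S, N} \<in> K n" by (simp add: susp_def)
    then show ?thesis using t(1) by auto
  qed
  then have "\<Union>(susp (K n) S N) \<subseteq> insert S (insert N (\<Union>(K n)))" by (rule subsetI)
  then have "countable (\<Union>(susp (K n) S N))" using Suc by (rule_tac countable_subset) auto
  moreover have "{S} \<in> susp (K n) S N" using SN(2) by (simp add: susp_def)
  ultimately show ?case using susp_complex[of "K n" S N] Suc unfolding SN(1) by blast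
qed

context compact_metrizable
begin

lemma AEc_empty: "AEc K {}"
  by (auto simp: AEc_def)

text \<open>The zero set of \<open>dl\<close>, a union of fibres of \<open>p\<close>, is where the function is already generic
  and must not be changed.\<close>

definition generic_ext :: "'w set set \<Rightarrow> 'j set \<Rightarrow> bool" where
  "generic_ext K J \<longleftrightarrow> (\<forall>p Y f0 dl \<epsilon>. closedin X Y \<longrightarrow> (\<forall>j\<in>J. cf (topspace X) (p j)) \<longrightarrow>
     (\<forall>x0\<in>Y. AEs K {x \<in> Y. \<forall>j\<in>J. p j x = p j x0}) \<longrightarrow> cf (topspace X) f0 \<longrightarrow> cf (topspace X) dl \<longrightarrow>
     (\<forall>x\<in>Y. \<forall>y\<in>Y. (\<forall>j\<in>J. p j x = p j y) \<longrightarrow> dl x = dl y) \<longrightarrow>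
     (\<forall>x0\<in>Y. dl x0 = 0 \<longrightarrow> AEc K (leaf p J Y f0 x0)) \<longrightarrow> (0::real) < \<epsilon> \<longrightarrow>
     (\<exists>f. cf (topspace X) f \<and> (\<forall>x\<in>Y. dl x = 0 \<longrightarrow> f x = f0 x) \<and> (\<forall>x\<in>Y. \<bar>f x - f0 x\<bar> < \<epsilon>) \<and>
        (\<forall>x0\<in>Y. AEc K (leaf p J Y f x0))))"

lemma generic_extE:
  assumes "generic_ext K J" "closedin X Y" "\<And>j. j \<in> J \<Longrightarrow> cf (topspace X) (p j)"
    "\<And>x0. x0 \<in> Y \<Longrightarrow> AEs K {x \<in> Y. \<forall>j\<in>J. p j x = p j x0}" "cf (topspace X) f0" "cf (topspace X) dl"
    "\<And>x y. x \<in> Y \<Longrightarrow> y \<in> Y \<Longrightarrow> (\<And>j. j \<in> J \<Longrightarrow> p j x = p j y) \<Longrightarrow> dl x = dl y"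
    "\<And>x0. x0 \<in> Y \<Longrightarrow> dl x0 = 0 \<Longrightarrow> AEc K (leaf p J Y f0 x0)" "0 < \<epsilon>"
  obtains f where "cf (topspace X) f" "\<And>x. x \<in> Y \<Longrightarrow> dl x = 0 \<Longrightarrow> f x = f0 x"
    "\<And>x. x \<in> Y \<Longrightarrow> \<bar>f x - f0 x\<bar> < \<epsilon>" "\<And>x0. x0 \<in> Y \<Longrightarrow> AEc K (leaf p J Y f x0)"
proof -
  have "\<exists>f. cf (topspace X) f \<and> (\<forall>x\<in>Y. dl x = 0 \<longrightarrow> f x = f0 x) \<and> (\<forall>x\<in>Y. \<bar>f x - f0 x\<bar> < \<epsilon>) \<and>
        (\<forall>x0\<in>Y. AEc K (leaf p J Y f x0))"
    by (rule assms(1)[unfolded generic_ext_def, rule_format]; fact assms)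
  then obtain f where "cf (topspace X) f \<and> (\<forall>x\<in>Y. dl x = 0 \<longrightarrow> f x = f0 x) \<and> (\<forall>x\<in>Y. \<bar>f x - f0 x\<bar> < \<epsilon>) \<and>
        (\<forall>x0\<in>Y. AEc K (leaf p J Y f x0))" ..
  then show thesis by (intro that[of f]) simp_all
qed

text \<open>The quantifier over \<open>f1\<close> is there because \<open>f1\<close> is still
  changed at the walls before a piece is solved. Both tolerances are measured from
  \<open>f0\<close>, so gluing pieces does not enlarge them.\<close>

definition solvable :: "('j \<Rightarrow> 'a \<Rightarrow> real) \<Rightarrow> 'j set \<Rightarrow> ('a \<Rightarrow> real) \<Rightarrow> real \<Rightarrow> 'w set set \<Rightarrow> 'a set \<Rightarrow> ('a \<Rightarrow> 'w \<Rightarrow> real) \<Rightarrow> 'a set \<Rightarrow> bool" where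
  "solvable p J f0 \<epsilon> K B \<psi> Y \<longleftrightarrow> (\<forall>f1 dl. cf (topspace X) f1 \<longrightarrow> (\<forall>x\<in>Y. \<bar>f1 x - f0 x\<bar> < \<epsilon>) \<longrightarrow> cf (topspace X) dl \<longrightarrow>
     (\<forall>x\<in>Y. \<forall>y\<in>Y. (\<forall>j\<in>J. p j x = p j y) \<longrightarrow> dl x = dl y) \<longrightarrow>
     (\<forall>x0\<in>Y. dl x0 = 0 \<longrightarrow> AEc K (leaf p J Y f1 x0)) \<longrightarrow>
     (\<exists>f2. cf Y f2 \<and> (\<forall>x\<in>Y. dl x = 0 \<longrightarrow> f2 x = f1 x) \<and> (\<forall>x\<in>Y. \<bar>f2 x - f0 x\<bar> < 7 * \<epsilon>) \<and>
        (\<forall>x0\<in>Y. extends_over K B \<psi> (leaf p J Y f2 x0))))"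

lemma solvableE:
  assumes "solvable p J f0 \<epsilon> K B \<psi> Y" "cf (topspace X) f1" "\<And>x. x \<in> Y \<Longrightarrow> \<bar>f1 x - f0 x\<bar> < \<epsilon>" "cf (topspace X) dl"
    "\<And>x y. x \<in> Y \<Longrightarrow> y \<in> Y \<Longrightarrow> (\<And>j. j \<in> J \<Longrightarrow> p j x = p j y) \<Longrightarrow> dl x = dl y"
    "\<And>x0. x0 \<in> Y \<Longrightarrow> dl x0 = 0 \<Longrightarrow> AEc K (leaf p J Y f1 x0)"
  obtains f2 where "cf Y f2" "\<And>x. x \<in> Y \<Longrightarrow> dl x = 0 \<Longrightarrow> f2 x = f1 x" "\<And>x. x \<in> Y \<Longrightarrow> \<bar>f2 x - f0 x\<bar> < 7 * \<epsilon>"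
    "\<And>x0. x0 \<in> Y \<Longrightarrow> extends_over K B \<psi> (leaf p J Y f2 x0)"
proof -
  have "\<exists>f2. cf Y f2 \<and> (\<forall>x\<in>Y. dl x = 0 \<longrightarrow> f2 x = f1 x) \<and> (\<forall>x\<in>Y. \<bar>f2 x - f0 x\<bar> < 7 * \<epsilon>) \<and>
        (\<forall>x0\<in>Y. extends_over K B \<psi> (leaf p J Y f2 x0))"
    by (rule assms(1)[unfolded solvable_def, rule_format]; fact assms)
  then obtain f2 where "cf Y f2 \<and> (\<forall>x\<in>Y. dl x = 0 \<longrightarrow> f2 x = f1 x) \<and> (\<forall>x\<in>Y. \<bar>f2 x - f0 x\<bar> < 7 * \<epsilon>) \<and>
        (\<forall>x0\<in>Y. extends_over K B \<psi> (leaf p J Y f2 x0))" ..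
  then show thesis by (intro that[of f2]) simp_all
qed

text \<open>To cut along a hyperplane, first make the function generic over it.\<close>

lemma solvable_split:
  fixes K :: "'w set set" and p :: "'j \<Rightarrow> 'a \<Rightarrow> real" and \<epsilon> :: real
  assumes Y: "closedin X Y" and J: "\<And>j. j \<in> J \<Longrightarrow> cf (topspace X) (p j)" and f0: "cf (topspace X) f0"
    and j: "j \<in> J" and gext: "generic_ext K (J - {j})"
    and fib: "\<And>x0. x0 \<in> Y \<Longrightarrow> AEs K {x \<in> Y. \<forall>j\<in>J. p j x = p j x0}"
    and s1: "solvable p J f0 \<epsilon> K B \<psi> {x \<in> Y. p j x \<le> c}" and s2: "solvable p J f0 \<epsilon> K B \<psi> {x \<in> Y. c \<le> p j x}"
  shows "solvable p J f0 \<epsilon> K B \<psi> Y"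
  unfolding solvable_def
proof (intro allI impI)
  fix f1 dl assume f1: "cf (topspace X) f1" and near: "\<forall>x\<in>Y. \<bar>f1 x - f0 x\<bar> < \<epsilon>" and dl: "cf (topspace X) dl"
    and sat: "\<forall>x\<in>Y. \<forall>y\<in>Y. (\<forall>j\<in>J. p j x = p j y) \<longrightarrow> dl x = dl y"
    and gen: "\<forall>x0\<in>Y. dl x0 = 0 \<longrightarrow> AEc K (leaf p J Y f1 x0)"
  have YX: "Y \<subseteq> topspace X" using Y closedin_subset by blast
  have pY: "cf Y (p j)" using cf_mono[OF J[OF j] YX] .
  have f0Y: "cf Y f0" "cf Y f1" "cf Y dl" using cf_mono[OF _ YX] f0 f1 dl by auto
  \<comment> \<open>The part of the tolerance that is left: \<open>f1\<close> may change by less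
    than \<open>e\<close> and remains within \<open>\<epsilon>\<close> of \<open>f0\<close>.\<close>
  obtain e where e: "0 < e" "\<And>x. x \<in> Y \<Longrightarrow> e \<le> \<epsilon> - \<bar>f1 x - f0 x\<bar>"
  proof (rule pos_min[OF Y])
    show "cf Y (\<lambda>x. \<epsilon> - \<bar>f1 x - f0 x\<bar>)" by (intro cf_diff cf_abs cf_const f0Y)
    show "0 < \<epsilon> - \<bar>f1 x - f0 x\<bar>" if "x \<in> Y" for x using near that by simp
  qed blast
  define H where "H = {x \<in> Y. p j x = c}"
  have H: "closedin X H" unfolding H_def by (intro closedin_eq Y pY cf_const)
  have HY: "H \<subseteq> Y" by (auto simp: H_def)
  \<comment> \<open>Coordinate \<open>j\<close> is constant on the wall \<open>H\<close>, so there
    the fibres of the remaining coordinates are fibres of all of them.\<close>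
  have agree: "p i x = p i y" if "x \<in> H" "y \<in> H" "\<And>i. i \<in> J - {j} \<Longrightarrow> p i x = p i y" "i \<in> J" for i x y
    using that by (cases "i = j") (auto simp: H_def)
  obtain g where g: "cf (topspace X) g" "\<And>x. x \<in> H \<Longrightarrow> dl x = 0 \<Longrightarrow> g x = f1 x"
    "\<And>x. x \<in> H \<Longrightarrow> \<bar>g x - f1 x\<bar> < e" "\<And>x0. x0 \<in> H \<Longrightarrow> AEc K (leaf p (J - {j}) H g x0)"
  proof (rule generic_extE[OF gext H _ _ f1 dl _ _ e(1)])
    show "cf (topspace X) (p i)" if "i \<in> J - {j}" for i using J that by simp
    fix x0 assume x0: "x0 \<in> H"
    show "AEs K {x \<in> H. \<forall>i\<in>J - {j}. p i x = p i x0}"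
    proof (rule AEs_mono)
      show "AEs K {x \<in> Y. \<forall>j\<in>J. p j x = p j x0}" using fib x0 HY by blast
      show "{x \<in> H. \<forall>i\<in>J - {j}. p i x = p i x0} \<subseteq> {x \<in> Y. \<forall>j\<in>J. p j x = p j x0}"
        using agree[OF _ x0] HY by blast
    qed
    show "AEc K (leaf p (J - {j}) H f1 x0)" if "dl x0 = 0"
    proof (rule AEc_mono)
      show "AEc K (leaf p J Y f1 x0)" using gen x0 HY that by blast
      show "leaf p (J - {j}) H f1 x0 \<subseteq> leaf p J Y f1 x0"
      proof
        fix x assume x: "x \<in> leaf p (J - {j}) H f1 x0"
        then have "x \<in> H" "f1 x = f1 x0" "\<And>i. i \<in> J - {j} \<Longrightarrow> p i x = p i x0" by (auto simp: leaf_def)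
        then show "x \<in> leaf p J Y f1 x0" using agree[OF _ x0] HY by (auto simp: leaf_def)
      qed
    qed
  next
    fix x y assume xy: "x \<in> H" "y \<in> H" "\<And>i. i \<in> J - {j} \<Longrightarrow> p i x = p i y"
    then have "\<forall>i\<in>J. p i x = p i y" using agree by blast
    then show "dl x = dl y" using sat xy HY by blast
  qed (rule that; (assumption | simp))
  define D where "D = {x \<in> Y. dl x = 0}"
  have D: "closedin X D" unfolding D_def by (intro closedin_eq Y f0Y cf_const)
  define h where "h x = (if x \<in> H then g x - f1 x else 0)" for x
  have "cf (D \<union> H) h"
  proof (rule cf_glue[OF D H])
    show "cf D h" by (rule cf_cong[OF cf_const[of _ 0]]) (use g(2) in \<open>auto simp: h_def D_def\<close>)
    have "cf H (\<lambda>x. g x - f1 x)" by (intro cf_diff cf_mono[OF g(1)] cf_mono[OF f1]) (use HY YX in auto)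
    then show "cf H h" by (rule cf_cong) (simp add: h_def)
  qed
  moreover have "h x \<in> {- e<..<e}" for x using g(3)[of x] e(1) by (auto simp: h_def)
  ultimately obtain h' where h': "\<And>A. cf A h'" "\<And>x. x \<in> topspace X \<Longrightarrow> h' x \<in> {- e<..<e}" "\<And>x. x \<in> D \<union> H \<Longrightarrow> h' x = h x"
    using tietze[OF closedin_Un[OF D H], of h "{- e<..<e}"] e(1) is_interval_oo by auto
  define f1' where "f1' x = f1 x + h' x" for x
  have f1': "cf (topspace X) f1'" unfolding f1'_def by (intro cf_add f1 h')
  have f1'D: "f1' x = f1 x" if "x \<in> Y" "dl x = 0" for x
    using h'(3)[of x] that g(2)[of x] by (auto simp: f1'_def h_def D_def)
  have f1'H: "f1' x = g x" if "x \<in> H" for x using h'(3)[of x] that by (simp add: f1'_def h_def)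
  have near': "\<bar>f1' x - f0 x\<bar> < \<epsilon>" if "x \<in> Y" for x
  proof -
    have "x \<in> topspace X" using that YX by blast
    from h'(2)[OF this] have "\<bar>h' x\<bar> < e" by auto
    moreover have "\<bar>f1' x - f0 x\<bar> \<le> \<bar>f1 x - f0 x\<bar> + \<bar>h' x\<bar>" unfolding f1'_def by linarith
    ultimately show ?thesis using e(2)[OF that] by linarith
  qed
  \<comment> \<open>The zero set is the old frozen set together with the wall. Solutions on the two
    sides therefore both equal \<open>f1'\<close> on the wall and fit together.\<close>
  define dl' where "dl' x = dl x * (p j x - c)" for x
  have dl': "cf (topspace X) dl'" unfolding dl'_def by (intro cf_mult cf_diff dl J[OF j] cf_const)
  have sat': "dl' x = dl' y" if "x \<in> Y" "y \<in> Y" "\<And>j. j \<in> J \<Longrightarrow> p j x = p j y" for x y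
  proof -
    have "dl x = dl y" by (rule sat[rule_format]; fact that)
    then show ?thesis using that(3)[OF j] by (simp add: dl'_def)
  qed
  have gen': "AEc K (leaf p J Y f1' x0)" if x0: "x0 \<in> Y" "dl' x0 = 0" for x0
  proof (cases "dl x0 = 0")
    case True
    have "leaf p J Y f1' x0 \<subseteq> leaf p J Y f1 x0"
    proof
      fix x assume "x \<in> leaf p J Y f1' x0"
      then have x: "x \<in> Y" "\<forall>j\<in>J. p j x = p j x0" "f1' x = f1' x0" by (auto simp: leaf_def)
      then have "dl x = 0" using sat x0(1) True by metis
      then show "x \<in> leaf p J Y f1 x0" using x f1'D[of x] f1'D[OF x0(1) True] by (auto simp: leaf_def)
    qed
    then show ?thesis by (rule AEc_mono[rotated]) (use gen x0 True in blast)
  next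
    case False
    then have x0H: "x0 \<in> H" using x0 by (simp add: dl'_def H_def)
    have "leaf p J Y f1' x0 \<subseteq> leaf p (J - {j}) H g x0"
    proof
      fix x assume "x \<in> leaf p J Y f1' x0"
      then have x: "x \<in> Y" "\<And>j. j \<in> J \<Longrightarrow> p j x = p j x0" "f1' x = f1' x0" by (auto simp: leaf_def)
      then have "x \<in> H" using x0H j by (simp add: H_def)
      then show "x \<in> leaf p (J - {j}) H g x0" using x f1'H x0H by (simp add: leaf_def)
    qed
    then show ?thesis by (rule AEc_mono[rotated]) (rule g(4)[OF x0H])
  qed
  have half: "\<exists>f2. cf Z f2 \<and> (\<forall>x\<in>Z. dl' x = 0 \<longrightarrow> f2 x = f1' x) \<and> (\<forall>x\<in>Z. \<bar>f2 x - f0 x\<bar> < 7 * \<epsilon>) \<and>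
      (\<forall>x0\<in>Z. extends_over K B \<psi> (leaf p J Z f2 x0))"
    if Z: "Z \<subseteq> Y" and sv: "solvable p J f0 \<epsilon> K B \<psi> Z" for Z
  proof -
    obtain f2 where "cf Z f2" "\<And>x. x \<in> Z \<Longrightarrow> dl' x = 0 \<Longrightarrow> f2 x = f1' x" "\<And>x. x \<in> Z \<Longrightarrow> \<bar>f2 x - f0 x\<bar> < 7 * \<epsilon>"
      "\<And>x0. x0 \<in> Z \<Longrightarrow> extends_over K B \<psi> (leaf p J Z f2 x0)"
    proof (rule solvableE[OF sv f1' _ dl'])
      show "\<bar>f1' x - f0 x\<bar> < \<epsilon>" if "x \<in> Z" for x using near' that Z by blast
      show "dl' x = dl' y" if "x \<in> Z" "y \<in> Z" "\<And>j. j \<in> J \<Longrightarrow> p j x = p j y" for x y using sat' that Z by blast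
      show "AEc K (leaf p J Z f1' x0)" if "x0 \<in> Z" "dl' x0 = 0" for x0
        by (rule AEc_mono[OF gen' leaf_mono[OF Z]]) (use that Z in auto)
    qed (rule that; (assumption | simp))
    then show ?thesis by blast
  qed
  define Y1 where "Y1 = {x \<in> Y. p j x \<le> c}"
  define Y2 where "Y2 = {x \<in> Y. c \<le> p j x}"
  have Y12: "closedin X Y1" "closedin X Y2" unfolding Y1_def Y2_def by (intro closedin_le Y pY cf_const)+
  have Yun: "Y1 \<union> Y2 = Y" by (auto simp: Y1_def Y2_def)
  have "Y1 \<subseteq> Y" "Y2 \<subseteq> Y" by (auto simp: Y1_def Y2_def)
  obtain fa where fa: "cf Y1 fa" "\<forall>x\<in>Y1. dl' x = 0 \<longrightarrow> fa x = f1' x" "\<forall>x\<in>Y1. \<bar>fa x - f0 x\<bar> < 7 * \<epsilon>"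
      "\<forall>x0\<in>Y1. extends_over K B \<psi> (leaf p J Y1 fa x0)"
    using half[OF \<open>Y1 \<subseteq> Y\<close> s1[folded Y1_def]] by (elim exE conjE) (rule that)
  obtain fb where fb: "cf Y2 fb" "\<forall>x\<in>Y2. dl' x = 0 \<longrightarrow> fb x = f1' x" "\<forall>x\<in>Y2. \<bar>fb x - f0 x\<bar> < 7 * \<epsilon>"
      "\<forall>x0\<in>Y2. extends_over K B \<psi> (leaf p J Y2 fb x0)"
    using half[OF \<open>Y2 \<subseteq> Y\<close> s2[folded Y2_def]] by (elim exE conjE) (rule that)
  define f2 where "f2 x = (if p j x \<le> c then fa x else fb x)" for x
  have f2a: "f2 x = fa x" if "x \<in> Y1" for x using that by (simp add: f2_def Y1_def)
  have f2b: "f2 x = fb x" if "x \<in> Y2" for x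
  proof (cases "p j x = c")
    case True
    then have "x \<in> Y1" "dl' x = 0" using that by (auto simp: Y1_def Y2_def dl'_def)
    then show ?thesis using fa(2) fb(2) that f2a by simp
  qed (use that in \<open>auto simp: f2_def Y2_def\<close>)
  show "\<exists>f2. cf Y f2 \<and> (\<forall>x\<in>Y. dl x = 0 \<longrightarrow> f2 x = f1 x) \<and> (\<forall>x\<in>Y. \<bar>f2 x - f0 x\<bar> < 7 * \<epsilon>) \<and>
      (\<forall>x0\<in>Y. extends_over K B \<psi> (leaf p J Y f2 x0))"
  proof (intro exI conjI ballI impI)
    have "cf (Y1 \<union> Y2) f2"
      by (rule cf_glue[OF Y12]) (use cf_cong[OF fa(1)] cf_cong[OF fb(1)] f2a f2b in metis)+
    then show "cf Y f2" by (simp add: Yun)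
    fix x assume x: "x \<in> Y"
    then have c: "x \<in> Y1 \<or> x \<in> Y2" using Yun by blast
    show "f2 x = f1 x" if "dl x = 0"
      using c fa(2) fb(2) f2a[of x] f2b[of x] f1'D[OF x that] that by (auto simp: dl'_def)
    show "\<bar>f2 x - f0 x\<bar> < 7 * \<epsilon>" using c fa(3) fb(3) f2a[of x] f2b[of x] by auto
    have pj: "p j z = p j x" if "z \<in> leaf p J Y f2 x" for z using that j by (auto simp: leaf_def)
    show "extends_over K B \<psi> (leaf p J Y f2 x)"
    proof (cases "x \<in> Y1")
      case True
      have "leaf p J Y f2 x \<subseteq> leaf p J Y1 fa x"
      proof
        fix z assume z: "z \<in> leaf p J Y f2 x"
        then have "z \<in> Y1" using pj[OF z] True by (auto simp: leaf_def Y1_def)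
        then show "z \<in> leaf p J Y1 fa x" using z f2a True by (auto simp: leaf_def)
      qed
      then show ?thesis by (rule extends_over_mono[rotated]) (use fa(4) True in blast)
    next
      case False
      then have x2: "x \<in> Y2" using c by blast
      have "leaf p J Y f2 x \<subseteq> leaf p J Y2 fb x"
      proof
        fix z assume z: "z \<in> leaf p J Y f2 x"
        then have "z \<in> Y2" using pj[OF z] x2 by (auto simp: leaf_def Y2_def)
        then show "z \<in> leaf p J Y2 fb x" using z f2b x2 by (auto simp: leaf_def)
      qed
      then show ?thesis by (rule extends_over_mono[rotated]) (use fb(4) x2 in blast)
    qed
  qed
qed

lemma solvable_empty: "solvable p J f0 \<epsilon> K B \<psi> {}"
proof -
  have "cf {} (\<lambda>x. 0)" by simp
  then show ?thesis unfolding solvable_def by blast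
qed

text \<open>Induction on the set \<open>G\<close> of directions in which the piece may still be
  wide. Slabs of width \<open>\<eta>\<close> in a new direction are covered by the induction
  hypothesis and are added one after the other along walls.\<close>

lemma solvable_of_small:
  fixes K :: "'w set set" and p :: "'j \<Rightarrow> 'a \<Rightarrow> real" and \<epsilon> \<eta> :: real
  assumes J: "finite J" "\<And>j. j \<in> J \<Longrightarrow> cf (topspace X) (p j)" and f0: "cf (topspace X) f0"
    and gext: "\<And>j. j \<in> J \<Longrightarrow> generic_ext K (J - {j})" and \<eta>: "0 < \<eta>"
    and fib: "\<And>x0. x0 \<in> Y0 \<Longrightarrow> AEs K {x \<in> Y0. \<forall>j\<in>J. p j x = p j x0}"
    and small: "\<And>T. closedin X T \<Longrightarrow> T \<subseteq> Y0 \<Longrightarrow> (\<And>x y j. x \<in> T \<Longrightarrow> y \<in> T \<Longrightarrow> j \<in> J \<Longrightarrow> \<bar>p j x - p j y\<bar> \<le> \<eta>) \<Longrightarrow>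
      solvable p J f0 \<epsilon> K B \<psi> T"
    and Y0: "closedin X Y0"
  shows "solvable p J f0 \<epsilon> K B \<psi> Y0"
proof -
  have "solvable p J f0 \<epsilon> K B \<psi> Y" if G: "G \<subseteq> J" and Y: "closedin X Y" "Y \<subseteq> Y0"
    and var: "\<And>x y j. x \<in> Y \<Longrightarrow> y \<in> Y \<Longrightarrow> j \<in> J - G \<Longrightarrow> \<bar>p j x - p j y\<bar> \<le> \<eta>" for G Y
    using finite_subset[OF G J(1)] G Y var
  proof (induction G arbitrary: Y rule: finite_induct)
    case empty
    then show ?case by (intro small) auto
  next
    case (insert j G)
    have j: "j \<in> J" using insert.prems by simp
    have YX: "Y \<subseteq> topspace X" using insert.prems(2) closedin_subset by blast
    have pY: "cf Y (p j)" using cf_mono[OF J(2)[OF j] YX] .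
    obtain M where M: "0 < M" "\<And>x. x \<in> Y \<Longrightarrow> \<bar>p j x\<bar> \<le> M" using cf_bounded[OF insert.prems(2) pY] by blast
    have slab: "solvable p J f0 \<epsilon> K B \<psi> {x \<in> {x \<in> Y. p j x \<le> a + \<eta>}. a \<le> p j x}" (is "solvable _ _ _ _ _ _ _ ?T") for a
    proof (rule insert.IH)
      show "G \<subseteq> J" using insert.prems by simp
      have "closedin X {x \<in> Y. p j x \<le> a + \<eta>}" by (intro closedin_le insert.prems(2) pY cf_const)
      then show "closedin X ?T" by (rule closedin_le[OF _ cf_const]) (rule cf_mono[OF pY], auto)
      show "?T \<subseteq> Y0" using insert.prems(3) by auto
      fix x y i assume xy: "x \<in> ?T" "y \<in> ?T" "i \<in> J - G"
      show "\<bar>p i x - p i y\<bar> \<le> \<eta>"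
      proof (cases "i = j")
        case True
        then show ?thesis using xy by (auto simp: abs_le_iff)
      next
        case False
        then show ?thesis using xy by (intro insert.prems(4)) auto
      qed
    qed
    \<comment> \<open>The first cut lies below the range of \<open>p j\<close>, so the recursion
      starts with the empty set.\<close>
    define c where "c m = real m * \<eta> - (M + 1)" for m
    have "solvable p J f0 \<epsilon> K B \<psi> {x \<in> Y. p j x \<le> c m}" for m
    proof (induction m)
      case 0
      have empty: "{x \<in> Y. p j x \<le> c 0} = {}" using M(2) by (fastforce simp: c_def)
      show ?case unfolding empty by (rule solvable_empty)
    next
      case (Suc m)
      let ?Y = "{x \<in> Y. p j x \<le> c (Suc m)}"
      have cs: "c (Suc m) = c m + \<eta>" by (simp add: c_def algebra_simps)
      show ?case
      proof (rule solvable_split[OF _ J(2) f0 j gext[OF j], where c = "c m"])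
        show "closedin X ?Y" by (intro closedin_le insert.prems(2) pY cf_const)
        show "solvable p J f0 \<epsilon> K B \<psi> {x \<in> ?Y. c m \<le> p j x}" using slab[of "c m"] by (simp only: cs)
        have "{x \<in> ?Y. p j x \<le> c m} = {x \<in> Y. p j x \<le> c m}" using \<eta> by (auto simp: cs)
        then show "solvable p J f0 \<epsilon> K B \<psi> {x \<in> ?Y. p j x \<le> c m}" using Suc by simp
        fix x0 assume x0: "x0 \<in> ?Y"
        show "AEs K {x \<in> ?Y. \<forall>j\<in>J. p j x = p j x0}"
          by (rule AEs_mono[OF fib[of x0]]) (use x0 insert.prems(3) in auto)
      qed
    qed
    moreover obtain m :: nat where "(2 * M + 1) / \<eta> \<le> m" using real_arch_simple by blast
    then have "M \<le> c m" using \<eta> by (simp add: c_def field_simps)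
    then have "{x \<in> Y. p j x \<le> c m} = Y" using M(2) by fastforce
    ultimately show ?case by metis
  qed
  from this[of J Y0] show ?thesis using Y0 by simp
qed

text \<open>Local data exist near every fibre, hence on all pieces on which the coordinates vary by
  at most some \<open>\<eta>\<close>. These are solved one by one and assembled along walls. The
  outcome is within \<open>7 * e\<close> of \<open>f0\<close>, which fixes \<open>e\<close>.\<close>

lemma generic_ext_one:
  fixes K :: "'w set set" and p :: "'j \<Rightarrow> 'a \<Rightarrow> real" and \<epsilon> :: real
  assumes K: "abstract_simplicial_complex K" "K \<noteq> {}"
    and gext: "\<And>j. j \<in> J \<Longrightarrow> generic_ext K (J - {j})" and J: "finite J" "\<And>j. j \<in> J \<Longrightarrow> cf (topspace X) (p j)"
    and Y: "closedin X Y" and fib: "\<And>x0. x0 \<in> Y \<Longrightarrow> AEs K {x \<in> Y. \<forall>j\<in>J. p j x = p j x0}"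
    and f0: "cf (topspace X) f0" and dl: "cf (topspace X) dl"
    and sat: "\<And>x y. x \<in> Y \<Longrightarrow> y \<in> Y \<Longrightarrow> (\<And>j. j \<in> J \<Longrightarrow> p j x = p j y) \<Longrightarrow> dl x = dl y"
    and gen: "\<And>x0. x0 \<in> Y \<Longrightarrow> dl x0 = 0 \<Longrightarrow> AEc K (leaf p J Y f0 x0)"
    and B: "closedin X B" "cm K B \<psi>" and \<epsilon>: "0 < \<epsilon>"
  obtains f where "cf (topspace X) f" "\<And>x. x \<in> Y \<Longrightarrow> dl x = 0 \<Longrightarrow> f x = f0 x"
    "\<And>x. x \<in> Y \<Longrightarrow> \<bar>f x - f0 x\<bar> < \<epsilon>" "\<And>x0. x0 \<in> Y \<Longrightarrow> extends_over K B \<psi> (leaf p J Y f x0)"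
proof -
  define e where "e = \<epsilon> / 7"
  have e: "0 < e" using \<epsilon> by (simp add: e_def)
  obtain \<eta> where \<eta>: "0 < \<eta>"
    "\<And>T. T \<subseteq> Y \<Longrightarrow> T \<noteq> {} \<Longrightarrow> (\<And>x y j. x \<in> T \<Longrightarrow> y \<in> T \<Longrightarrow> j \<in> J \<Longrightarrow> \<bar>p j x - p j y\<bar> \<le> \<eta>) \<Longrightarrow> local_data f0 e K B \<psi> T"
  proof (rule lebesgue_fibres[OF Y J, where Q = "local_data f0 e K B \<psi>"])
    fix x0 assume "x0 \<in> Y"
    then show "\<exists>r>0. local_data f0 e K B \<psi> {x \<in> Y. \<forall>j\<in>J. \<bar>p j x - p j x0\<bar> \<le> r}"
      by (intro local_data_near_fibre K Y J fib B f0 e)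
  qed (use local_data_mono in blast)+
  have "solvable p J f0 e K B \<psi> Y"
  proof (rule solvable_of_small[OF J f0 gext \<eta>(1) fib _ Y])
    fix T assume T: "closedin X T" "T \<subseteq> Y" "\<And>x y j. x \<in> T \<Longrightarrow> y \<in> T \<Longrightarrow> j \<in> J \<Longrightarrow> \<bar>p j x - p j y\<bar> \<le> \<eta>"
    show "solvable p J f0 e K B \<psi> T"
    proof (cases "T = {}")
      case True
      then show ?thesis by (simp add: solvable_empty)
    next
      case False
      have ld: "local_data f0 e K B \<psi> T" by (rule \<eta>(2)[OF T(2) False]) (rule T(3))
      show ?thesis
        unfolding solvable_def
      proof (intro allI impI)
        fix f1 dl assume *: "cf (topspace X) f1" "\<forall>x\<in>T. \<bar>f1 x - f0 x\<bar> < e" "cf (topspace X) dl"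
          "\<forall>x\<in>T. \<forall>y\<in>T. (\<forall>j\<in>J. p j x = p j y) \<longrightarrow> dl x = dl y" "\<forall>x0\<in>T. dl x0 = 0 \<longrightarrow> AEc K (leaf p J T f1 x0)"
        obtain f2 where "cf T f2" "\<And>x. x \<in> T \<Longrightarrow> dl x = 0 \<Longrightarrow> f2 x = f1 x"
          "\<And>x. x \<in> T \<Longrightarrow> \<bar>f2 x - f0 x\<bar> < 7 * e" "\<And>x0. x0 \<in> T \<Longrightarrow> extends_over K B \<psi> (leaf p J T f2 x0)"
          by (rule solve_local[OF K T(1) J B e ld *(1) *(2)[rule_format] *(3) *(4)[rule_format] *(5)[rule_format]])
            (assumption | blast)+
        then show "\<exists>f2. cf T f2 \<and> (\<forall>x\<in>T. dl x = 0 \<longrightarrow> f2 x = f1 x) \<and> (\<forall>x\<in>T. \<bar>f2 x - f0 x\<bar> < 7 * e) \<and>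
          (\<forall>x0\<in>T. extends_over K B \<psi> (leaf p J T f2 x0))" by blast
      qed
    qed
  qed
  then obtain f2 where f2: "cf Y f2" "\<And>x. x \<in> Y \<Longrightarrow> dl x = 0 \<Longrightarrow> f2 x = f0 x" "\<And>x. x \<in> Y \<Longrightarrow> \<bar>f2 x - f0 x\<bar> < 7 * e"
    "\<And>x0. x0 \<in> Y \<Longrightarrow> extends_over K B \<psi> (leaf p J Y f2 x0)"
    by (rule solvableE[OF _ f0 _ dl sat gen]) (use e in \<open>auto intro: that\<close>)
  obtain f where f: "\<And>A. cf A f" "\<And>x. x \<in> Y \<Longrightarrow> f x = f2 x" using tietze_real[OF Y f2(1)] by blast
  show thesis
  proof (rule that)
    show "cf (topspace X) f" by (rule f)
    show "f x = f0 x" if "x \<in> Y" "dl x = 0" for x using f(2) f2(2) that by simp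
    show "\<bar>f x - f0 x\<bar> < \<epsilon>" if "x \<in> Y" for x using f(2)[OF that] f2(3)[OF that] by (simp add: e_def)
    show "extends_over K B \<psi> (leaf p J Y f x0)" if "x0 \<in> Y" for x0
    proof -
      have "leaf p J Y f x0 = leaf p J Y f2 x0" using f(2) that by (auto simp: leaf_def)
      then show ?thesis using f2(4)[OF that] by simp
    qed
  qed
qed

text \<open>The Baire argument runs among the functions that agree with \<open>f0\<close> on the
  zero set of \<open>dl\<close>: each approximation solves one more test problem with a margin, and
  all later changes stay within it. For empty \<open>J\<close> there are no walls, so the induction
  has no separate base case.\<close>

lemma generic_ext_finite:
  fixes K :: "'w set set"
  assumes K: "abstract_simplicial_complex K" "K \<noteq> {}" "countable (\<Union>K)" and J: "finite (J :: 'j set)"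
  shows "generic_ext K J"
  using J
proof (induction J rule: finite_psubset_induct)
  case (psubset J)
  have gext: "generic_ext K (J - {j})" if "j \<in> J" for j using psubset.IH[of "J - {j}"] that by blast
  obtain B :: "nat \<Rightarrow> 'a set" and \<psi> :: "nat \<Rightarrow> 'a \<Rightarrow> 'w \<Rightarrow> real" where
    B: "\<And>i. closedin X (B i)" "\<And>i. cm K (B i) (\<psi> i)"
    "\<And>F. closedin X F \<Longrightarrow> (\<And>i. extends_over K (B i) (\<psi> i) F) \<Longrightarrow> AEc K F"
    using detecting_family[OF K(1,3)] by blast
  show ?case
    unfolding generic_ext_def
  proof (intro allI impI)
    fix p :: "'j \<Rightarrow> 'a \<Rightarrow> real" and Y f0 dl and \<epsilon> :: real
    assume Y: "closedin X Y" and p': "\<forall>j\<in>J. cf (topspace X) (p j)"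
      and fib: "\<forall>x0\<in>Y. AEs K {x \<in> Y. \<forall>j\<in>J. p j x = p j x0}" and f0: "cf (topspace X) f0" and dl: "cf (topspace X) dl"
      and sat: "\<forall>x\<in>Y. \<forall>y\<in>Y. (\<forall>j\<in>J. p j x = p j y) \<longrightarrow> dl x = dl y"
      and gen: "\<forall>x0\<in>Y. dl x0 = 0 \<longrightarrow> AEc K (leaf p J Y f0 x0)" and \<epsilon>: "0 < \<epsilon>"
    have YX: "Y \<subseteq> topspace X" using Y closedin_subset by blast
    have p: "cf (topspace X) (p j)" if "j \<in> J" for j using p' that by blast
    \<comment> \<open>A pair is a function with the radius of a ball around it. The halving in
      \<open>Q\<close> nests the balls, and every function in the new ball solves problem
      \<open>i\<close>. The initial radius \<open>\<epsilon> / 2\<close> makes the final estimate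
      strict.\<close>
    define P where "P = (\<lambda>(i :: nat) (f, e). cf (topspace X) f \<and> 0 < e \<and> (\<forall>x\<in>Y. dl x = 0 \<longrightarrow> f x = f0 x) \<and>
      (i = 0 \<longrightarrow> f = f0 \<and> e = \<epsilon> / 2))"
    define Q where "Q = (\<lambda>i (f, e) (g, e'). (\<forall>x\<in>Y. \<bar>g x - f x\<bar> < e / 2) \<and> e' \<le> e / (2::real) \<and>
      (\<forall>h. (\<forall>x\<in>Y. \<bar>h x - g x\<bar> \<le> e') \<longrightarrow> (\<forall>x0\<in>Y. extends_over K (B i) (\<psi> i) (leaf p J Y h x0))))"
    have "\<exists>s. \<forall>i. P i (s i) \<and> Q i (s i) (s (Suc i))"
    proof (rule dependent_nat_choice)
      show "\<exists>s. P 0 s" using f0 \<epsilon> by (intro exI[of _ "(f0, \<epsilon> / 2)"]) (simp add: P_def)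
      fix s i assume "P i s"
      then obtain f e where s: "s = (f, e)" and f: "cf (topspace X) f" "0 < e" "\<And>x. x \<in> Y \<Longrightarrow> dl x = 0 \<Longrightarrow> f x = f0 x"
        by (cases s) (auto simp: P_def)
      have gen': "AEc K (leaf p J Y f x0)" if x0: "x0 \<in> Y" "dl x0 = 0" for x0
      proof -
        have "leaf p J Y f x0 \<subseteq> leaf p J Y f0 x0"
        proof
          fix x assume "x \<in> leaf p J Y f x0"
          then have x: "x \<in> Y" "\<forall>j\<in>J. p j x = p j x0" "f x = f x0" by (auto simp: leaf_def)
          then have "dl x = 0" using sat x0 by metis
          then show "x \<in> leaf p J Y f0 x0" using x f(3)[of x] f(3)[OF x0] by (auto simp: leaf_def)
        qed
        then show ?thesis by (rule AEc_mono[rotated]) (use gen x0 in blast)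
      qed
      have e2: "0 < e / 2" using f by simp
      obtain g where g: "cf (topspace X) g" "\<And>x. x \<in> Y \<Longrightarrow> dl x = 0 \<Longrightarrow> g x = f x"
        "\<And>x. x \<in> Y \<Longrightarrow> \<bar>g x - f x\<bar> < e / 2" "\<And>x0. x0 \<in> Y \<Longrightarrow> extends_over K (B i) (\<psi> i) (leaf p J Y g x0)"
        by (rule generic_ext_one[OF K(1,2) gext psubset.hyps p Y fib[rule_format] f(1) dl sat[rule_format] gen' B(1,2) e2])
          (assumption | blast)+
      have dl0: "cf Y (\<lambda>_. 0)" by simp
      obtain \<eta> where \<eta>: "0 < \<eta>" "\<And>f' x0. (\<And>x. x \<in> Y \<Longrightarrow> \<bar>f' x - g x\<bar> \<le> \<eta>) \<Longrightarrow> x0 \<in> Y \<Longrightarrow> \<bar>0::real\<bar> \<le> \<eta> \<Longrightarrow>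
          extends_over K (B i) (\<psi> i) (leaf p J Y f' x0)"
        by (rule extends_over_leaves_stable[OF K(1) Y psubset.hyps p g(1) dl0 B(1,2) g(4)]) (assumption | blast)+
      have "P (Suc i) (g, min \<eta> (e / 2))" using g \<eta>(1) f by (simp add: P_def)
      moreover have "Q i s (g, min \<eta> (e / 2))"
        unfolding Q_def s prod.case using g(3) \<eta> by simp
      ultimately show "\<exists>t. P (Suc i) t \<and> Q i s t" by blast
    qed
    then obtain s where s: "\<And>i. P i (s i)" "\<And>i. Q i (s i) (s (Suc i))" by blast
    define f where "f i = fst (s i)" for i
    define e where "e i = snd (s i)" for i
    have Ps: "cf (topspace X) (f i)" "0 < e i" "\<And>x. x \<in> Y \<Longrightarrow> dl x = 0 \<Longrightarrow> f i x = f0 x" for i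
      using s(1)[of i] by (auto simp: P_def f_def e_def split: prod.splits)
    have P0: "f 0 = f0" "e 0 = \<epsilon> / 2" using s(1)[of 0] by (auto simp: P_def f_def e_def split: prod.splits)
    have Qs: "\<And>x. x \<in> Y \<Longrightarrow> \<bar>f (Suc i) x - f i x\<bar> < e i / 2" "e (Suc i) \<le> e i / 2"
      "\<And>h x0. (\<And>x. x \<in> Y \<Longrightarrow> \<bar>h x - f (Suc i) x\<bar> \<le> e (Suc i)) \<Longrightarrow> x0 \<in> Y \<Longrightarrow> extends_over K (B i) (\<psi> i) (leaf p J Y h x0)" for i
      using s(2)[of i] by (auto simp: Q_def f_def e_def split: prod.splits)
    \<comment> \<open>Telescoping: each step is shorter than \<open>e i / 2\<close>, which is at
      most the loss of radius \<open>e i - e (Suc i)\<close>.\<close>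
    have close: "\<bar>f (i + k) x - f i x\<bar> \<le> e i - e (i + k)" if "x \<in> Y" for i k x
    proof (induction k)
      case (Suc k)
      have "\<bar>f (Suc (i + k)) x - f (i + k) x\<bar> < e (i + k) / 2" "e (Suc (i + k)) \<le> e (i + k) / 2"
        by (rule Qs(1)[OF that], rule Qs(2))
      then have "\<bar>f (Suc (i + k)) x - f i x\<bar> \<le> e i - e (Suc (i + k))" using Suc by linarith
      then show ?case by simp
    qed simp
    have eb: "e i \<le> \<epsilon> / 2 ^ Suc i" for i
    proof (induction i)
      case (Suc i)
      then show ?case using Qs(2)[of i] by simp
    qed (simp add: P0)
    have elim: "\<exists>i. e i < r" if r: "0 < r" for r
    proof -
      have "(\<lambda>i. \<epsilon> * (1 / 2) ^ Suc i) \<longlonglongrightarrow> \<epsilon> * 0"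
        by (intro tendsto_mult tendsto_const LIMSEQ_Suc LIMSEQ_power_zero) simp
      then have "\<forall>\<^sub>F i in sequentially. \<epsilon> * (1 / 2) ^ Suc i < r"
        by (rule order_tendstoD(2)) (use r in simp)
      then obtain i where "\<epsilon> * (1 / 2) ^ Suc i < r" by (auto simp: eventually_sequentially)
      then have "e i < r" using eb[of i] by (simp add: power_divide)
      then show ?thesis by blast
    qed
    have emono: "e j \<le> e i" if "i \<le> j" for i j
    proof -
      have "e (Suc k) \<le> e k" for k using Qs(2)[of k] Ps(2)[of k] by linarith
      then show ?thesis by (rule lift_Suc_antimono_le) fact
    qed
    define g where "g x = lim (\<lambda>i. f i x)" for x
    have conv: "(\<lambda>i. f i x) \<longlonglongrightarrow> g x" if x: "x \<in> Y" for x
    proof -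
      have "Cauchy (\<lambda>i. f i x)"
        unfolding Cauchy_altdef2
      proof (intro allI impI)
        fix r :: real assume "0 < r"
        then obtain N where N: "e N < r" using elim by blast
        have "dist (f n x) (f N x) < r" if "N \<le> n" for n
          using close[OF x, of N "n - N"] that N Ps(2)[of n] by (simp add: dist_real_def)
        then show "\<exists>N. \<forall>n\<ge>N. dist (f n x) (f N x) < r" by blast
      qed
      then show ?thesis unfolding g_def by (simp add: Cauchy_convergent_iff convergent_LIMSEQ_iff)
    qed
    have gclose: "\<bar>g x - f i x\<bar> \<le> e i" if x: "x \<in> Y" for x i
    proof -
      have "(\<lambda>k. \<bar>f k x - f i x\<bar>) \<longlonglongrightarrow> \<bar>g x - f i x\<bar>" by (intro tendsto_intros conv x)
      moreover have "\<bar>f k x - f i x\<bar> \<le> e i" if "i \<le> k" for k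
        using close[OF x, of i "k - i"] that Ps(2)[of k] by simp
      ultimately show ?thesis by (intro LIMSEQ_le_const2[of _ _ "e i"]) blast+
    qed
    have "continuous_map (subtopology X Y) (Metric_space.mtopology (UNIV :: real set) dist) g"
    proof (rule Met_TC.continuous_map_uniform_limit)
      show "\<forall>\<^sub>F i in sequentially. continuous_map (subtopology X Y) (Metric_space.mtopology UNIV dist) (f i)"
        using cf_mono[OF Ps(1) YX] by (simp add: cf_def)
      show "\<forall>\<^sub>F i in sequentially. \<forall>x\<in>topspace (subtopology X Y). g x \<in> UNIV \<and> dist (f i x) (g x) < r" if r: "0 < r" for r
      proof -
        obtain N where N: "e N < r" using elim r by blast
        have "dist (f i x) (g x) < r" if "N \<le> i" "x \<in> Y" for i x
          using gclose[OF that(2), of i] emono[OF that(1)] N by (simp add: dist_real_def abs_minus_commute)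
        then show ?thesis by (auto simp: eventually_sequentially)
      qed
    qed simp
    then have "cf Y g" by (simp add: cf_def)
    then obtain g' where g': "\<And>A. cf A g'" "\<And>x. x \<in> Y \<Longrightarrow> g' x = g x" using tietze_real[OF Y] by blast
    show "\<exists>f. cf (topspace X) f \<and> (\<forall>x\<in>Y. dl x = 0 \<longrightarrow> f x = f0 x) \<and> (\<forall>x\<in>Y. \<bar>f x - f0 x\<bar> < \<epsilon>) \<and>
        (\<forall>x0\<in>Y. AEc K (leaf p J Y f x0))"
    proof (intro exI conjI ballI impI)
      show "cf (topspace X) g'" by (rule g')
      fix x assume x: "x \<in> Y"
      show "g' x = f0 x" if "dl x = 0"
      proof -
        have "(\<lambda>i. f i x) \<longlonglongrightarrow> f0 x" using Ps(3)[OF x that] by simp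
        then show ?thesis using LIMSEQ_unique[OF conv[OF x]] g'(2)[OF x] by simp
      qed
      show "\<bar>g' x - f0 x\<bar> < \<epsilon>" using gclose[OF x, of 0] g'(2)[OF x] \<epsilon> by (simp add: P0)
      show "AEc K (leaf p J Y g' x)"
      proof (rule B(3))
        show "closedin X (leaf p J Y g' x)" by (rule closedin_leaf[OF Y psubset.hyps cf_mono[OF p YX] g'(1)])
        show "extends_over K (B i) (\<psi> i) (leaf p J Y g' x)" for i
          by (rule Qs(3)[OF _ x]) (use gclose g'(2) in simp)
      qed
    qed
  qed
qed

lemma AEc_tower_Suc:
  assumes "susp_tower K"
  shows "AEc (K (Suc n)) Y \<longleftrightarrow> AEs (K n) Y"
proof -
  have "\<exists>S N. S \<noteq> N \<and> S \<notin> \<Union>(K n) \<and> N \<notin> \<Union>(K n) \<and> K (Suc n) = susp (K n) S N"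
    using assms unfolding susp_tower_def by simp
  then obtain S N where "S \<noteq> N" "S \<notin> \<Union>(K n)" "N \<notin> \<Union>(K n)" "K (Suc n) = susp (K n) S N"
    by (elim exE conjE) (rule that)
  then show ?thesis using AEc_susp_iff[of S N "K n" Y] by simp
qed

text \<open>A fibre of the first \<open>k + 1\<close> functions is a fibre of \<open>f k\<close> on
  a fibre of the first \<open>k\<close>. Dropping one function thus costs one suspension, and the
  induction descends from \<open>k = n\<close> to \<open>k = 0\<close>.\<close>

lemma AEc_tower_of_fibres:
  assumes K: "susp_tower K" and f: "\<And>i. i < n \<Longrightarrow> cf (topspace X) (f i)"
    and fib: "\<And>x0. x0 \<in> topspace X \<Longrightarrow> AEc (K 0) {x \<in> topspace X. \<forall>i<n. f i x = f i x0}"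
  shows "AEc (K n) (topspace X)"
proof -
  have "k \<le> n \<Longrightarrow> \<forall>x0\<in>topspace X. AEc (K (n - k)) {x \<in> topspace X. \<forall>i<k. f i x = f i x0}" for k
  proof (induction "n - k" arbitrary: k)
    case 0
    then have "k = n" by simp
    then show ?case using fib by simp
  next
    case (Suc m)
    then have m: "m = n - Suc k" and kn: "k < n" by simp_all
    have IH: "\<forall>x0\<in>topspace X. AEc (K m) {x \<in> topspace X. \<forall>i<Suc k. f i x = f i x0}"
      using Suc(1)[OF m] kn m by simp
    show ?case
    proof
      fix x0 assume x0: "x0 \<in> topspace X"
      define Y where "Y = {x \<in> topspace X. \<forall>i\<in>{..<k}. f i x = f i x0}"
      have Y: "closedin X Y" unfolding Y_def by (rule closedin_fibre) (use f kn in auto)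
      have fk: "cf Y (f k)" by (rule cf_mono[OF f[OF kn]]) (auto simp: Y_def)
      have "AEc (K m) {x \<in> Y. f k x = t}" for t
      proof (cases "{x \<in> Y. f k x = t} = {}")
        case True
        then show ?thesis by (simp only: AEc_empty)
      next
        case False
        then obtain x1 where x1: "x1 \<in> Y" "f k x1 = t" by auto
        then have "{x \<in> Y. f k x = t} \<subseteq> {x \<in> topspace X. \<forall>i<Suc k. f i x = f i x1}"
          by (auto simp: Y_def less_Suc_eq)
        moreover have "x1 \<in> topspace X" using x1 by (simp add: Y_def)
        ultimately show ?thesis using IH AEc_mono by blast
      qed
      then have "AEs (K m) Y" by (intro AEs_of_fibres[OF _ Y fk]) (use susp_tower_complex[OF K] in auto)
      then have "AEc (K (Suc m)) Y" by (simp add: AEc_tower_Suc[OF K])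
      moreover have "Suc m = n - k" using m kn by simp
      moreover have "Y = {x \<in> topspace X. \<forall>i<k. f i x = f i x0}" by (auto simp: Y_def)
      ultimately show "AEc (K (n - k)) {x \<in> topspace X. \<forall>i<k. f i x = f i x0}" by simp
    qed
  qed
  from this[of 0] have *: "\<forall>x0\<in>topspace X. AEc (K n) (topspace X)" by simp
  show ?thesis
  proof (cases "topspace X = {}")
    case True
    then show ?thesis by (simp only: AEc_empty)
  qed (use * in blast)
qed

text \<open>That a fibre has \<open>K (Suc m)\<close> as extensor means \<open>AEs (K m)\<close>,
  which is the hypothesis under which a generic new coordinate cuts it into leaves with extensor
  \<open>K m\<close>.\<close>

lemma generic_fibres_of_tower:
  assumes K: "susp_tower K" and ae: "AEc (K n) (topspace X)"
    and f0: "\<And>i. i < n \<Longrightarrow> cf (topspace X) (f0 i)" and \<epsilon>: "(0::real) < \<epsilon>"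
  obtains f where "\<And>i. i < n \<Longrightarrow> cf (topspace X) (f i)" "\<And>i x. i < n \<Longrightarrow> x \<in> topspace X \<Longrightarrow> \<bar>f i x - f0 i x\<bar> < \<epsilon>"
    "\<And>x0. x0 \<in> topspace X \<Longrightarrow> AEc (K 0) {x \<in> topspace X. \<forall>i<n. f i x = f i x0}"
proof -
  have "k \<le> n \<Longrightarrow> \<exists>f. (\<forall>i<k. cf (topspace X) (f i)) \<and> (\<forall>i<k. \<forall>x\<in>topspace X. \<bar>f i x - f0 i x\<bar> < \<epsilon>) \<and>
    (\<forall>x0\<in>topspace X. AEc (K (n - k)) {x \<in> topspace X. \<forall>i<k. f i x = f i x0})" for k
  proof (induction k)
    case 0
    then show ?case using ae by simp
  next
    case (Suc k)
    then obtain f where f: "\<forall>i<k. cf (topspace X) (f i)" "\<forall>i<k. \<forall>x\<in>topspace X. \<bar>f i x - f0 i x\<bar> < \<epsilon>"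
      "\<forall>x0\<in>topspace X. AEc (K (n - k)) {x \<in> topspace X. \<forall>i<k. f i x = f i x0}"
      by auto
    define m where "m = n - Suc k"
    have nk: "n - k = Suc m" "k < n" using Suc.prems by (auto simp: m_def)
    have Km: "abstract_simplicial_complex (K m)" "K m \<noteq> {}" "countable (\<Union>(K m))" using susp_tower_complex[OF K] by blast+
    \<comment> \<open>With the constant 1 as \<open>dl\<close> nothing is frozen.\<close>
    have one: "cf (topspace X) (\<lambda>_. 1)" by simp
    obtain g where g: "cf (topspace X) g" "\<And>x. x \<in> topspace X \<Longrightarrow> \<bar>g x - f0 k x\<bar> < \<epsilon>"
      "\<And>x0. x0 \<in> topspace X \<Longrightarrow> AEc (K m) (leaf f {..<k} (topspace X) g x0)"
    proof (rule generic_extE[OF generic_ext_finite[OF Km finite_lessThan] closedin_topspace _ _ f0[OF nk(2)] one _ _ \<epsilon>])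
      show "cf (topspace X) (f j)" if "j \<in> {..<k}" for j using f(1) that by simp
      show "AEs (K m) {x \<in> topspace X. \<forall>j\<in>{..<k}. f j x = f j x0}" if "x0 \<in> topspace X" for x0
        using f(3) that AEc_tower_Suc[OF K] by (simp add: nk(1) Ball_def)
    qed (simp_all add: that)
    show ?case
    proof (intro exI conjI allI impI ballI)
      fix i assume i: "i < Suc k"
      show "cf (topspace X) ((f(k := g)) i)" using f(1) g(1) i by simp
      show "\<bar>(f(k := g)) i x - f0 i x\<bar> < \<epsilon>" if "x \<in> topspace X" for x
        using f(2) g(2)[OF that] i that by (cases "i = k") auto
    next
      fix x0 assume x0: "x0 \<in> topspace X"
      have "{x \<in> topspace X. \<forall>i<Suc k. (f(k := g)) i x = (f(k := g)) i x0} \<subseteq> leaf f {..<k} (topspace X) g x0"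
      proof
        fix x assume "x \<in> {x \<in> topspace X. \<forall>i<Suc k. (f(k := g)) i x = (f(k := g)) i x0}"
        then have x: "x \<in> topspace X" "\<And>i. i < Suc k \<Longrightarrow> (f(k := g)) i x = (f(k := g)) i x0" by auto
        have "g x = g x0" using x(2)[of k] by simp
        moreover have "f i x = f i x0" if "i < k" for i using x(2)[of i] that by simp
        ultimately show "x \<in> leaf f {..<k} (topspace X) g x0" using x(1) by (simp add: leaf_def)
      qed
      then show "AEc (K (n - Suc k)) {x \<in> topspace X. \<forall>i<Suc k. (f(k := g)) i x = (f(k := g)) i x0}"
        using AEc_mono g(3)[OF x0] unfolding m_def by blast
    qed
  qed
  from this[of n] obtain f where "\<forall>i<n. cf (topspace X) (f i)" "\<forall>i<n. \<forall>x\<in>topspace X. \<bar>f i x - f0 i x\<bar> < \<epsilon>"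
    "\<forall>x0\<in>topspace X. AEc (K 0) {x \<in> topspace X. \<forall>i<n. f i x = f i x0}"
    by auto
  then show thesis by (intro that[of f]) simp_all
qed

end

section \<open>Iterated suspensions as complexes\<close>

lemma realization_carrier_iff:
  assumes "finite W" "{v. b v \<noteq> 0} \<subseteq> W"
  shows "b \<in> realization_carrier K \<longleftrightarrow> (\<forall>v. 0 \<le> b v) \<and> {v. b v \<noteq> 0} \<in> K \<and> sum b W = 1"
proof -
  have "sum b {v. b v \<noteq> 0} = sum b W" using assms by (intro sum.mono_neutral_left) auto
  then show ?thesis by (simp add: realization_carrier_def)
qed

lemma realization_carrierD:
  assumes "b \<in> realization_carrier K"
  shows "0 \<le> b v" "{v. b v \<noteq> 0} \<in> K" "sum b {v. b v \<noteq> 0} = 1"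
  using assms by (auto simp: realization_carrier_def)

lemma closed_cell_eq:
  assumes K: "abstract_simplicial_complex K" and s: "s \<in> K"
  shows "closed_cell K s = {b. (\<forall>v. b v \<in> (if v \<in> s then {0..1} else {0})) \<and> sum b s = 1}"
proof -
  have fin: "finite s" using K s unfolding abstract_simplicial_complex_def by simp
  show ?thesis
  proof (intro set_eqI iffI)
    fix b assume b: "b \<in> closed_cell K s"
    then have sup: "{v. b v \<noteq> 0} \<subseteq> s" by (simp add: closed_cell_def)
    then have c: "(\<forall>v. 0 \<le> b v)" "sum b s = 1"
      using b realization_carrier_iff[OF fin sup, of K] by (auto simp: closed_cell_def)
    have "b v \<le> 1" if "v \<in> s" for v using member_le_sum[OF that, of b] c fin by simp
    then show "b \<in> {b. (\<forall>v. b v \<in> (if v \<in> s then {0..1} else {0})) \<and> sum b s = 1}" using c sup by auto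
  next
    fix b assume "b \<in> {b. (\<forall>v. b v \<in> (if v \<in> s then {0..1} else {0})) \<and> sum b s = (1::real)}"
    then have r: "\<And>v. b v \<in> (if v \<in> s then {0..1} else {0})" and b1: "sum b s = 1" by auto
    have sup: "{v. b v \<noteq> 0} \<subseteq> s" using r by (metis (mono_tags, lifting) mem_Collect_eq singletonD subsetI)
    have pos: "0 \<le> b v" for v using r[of v] by (auto split: if_splits)
    have "{v. b v \<noteq> 0} \<noteq> {}" using b1 by (auto intro: ccontr)
    then have "{v. b v \<noteq> 0} \<in> K" by (rule complex_face[OF K s sup])
    then have "b \<in> realization_carrier K" using realization_carrier_iff[OF fin sup, of K] pos b1 by simp
    then show "b \<in> closed_cell K s" using sup by (simp add: closed_cell_def)
  qed
qed

text \<open>A cell is a product of intervals and points cut by a hyperplane, hence compact in the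
  product topology, and its inclusion into the weak topology is continuous by definition.\<close>

lemma compactin_closed_cell:
  assumes K: "abstract_simplicial_complex K" and s: "s \<in> K"
  shows "compactin (realization K) (closed_cell K s)"
proof -
  have "compactin (product_topology (\<lambda>_. euclideanreal) UNIV) (Pi\<^sub>E UNIV (\<lambda>v. if v \<in> s then {0..1} else {0}))"
    by (subst compactin_PiE) auto
  then have "compact (Pi\<^sub>E UNIV (\<lambda>v. if v \<in> s then {0..1} else {0::real}))"
    by (simp add: euclidean_product_topology)
  moreover have "closed {b. sum b s = (1::real)}"
    by (intro closed_Collect_eq continuous_intros continuous_on_product_coordinates)
  ultimately have "compact (Pi\<^sub>E UNIV (\<lambda>v. if v \<in> s then {0..1} else {0::real}) \<inter> {b. sum b s = 1})"
    by (rule compact_Int_closed)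
  moreover have "closed_cell K s = Pi\<^sub>E UNIV (\<lambda>v. if v \<in> s then {0..1} else {0::real}) \<inter> {b. sum b s = 1}"
    unfolding closed_cell_eq[OF assms] by (auto simp: PiE_def Pi_def)
  ultimately have "compact (closed_cell K s)" by simp
  then have cpt: "compactin (top_of_set (closed_cell K s)) (closed_cell K s)"
    by (simp add: compactin_subtopology)
  have "continuous_map (top_of_set (closed_cell K s)) (realization K) (\<lambda>x. x)"
    unfolding continuous_map_def
  proof (intro conjI allI impI)
    show "(\<lambda>x. x) \<in> topspace (top_of_set (closed_cell K s)) \<rightarrow> topspace (realization K)"
      by (auto simp: closed_cell_def)
    fix U assume "openin (realization K) U"
    then have "openin (top_of_set (closed_cell K s)) (U \<inter> closed_cell K s)" using s by (simp add: openin_realization)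
    moreover have "{x \<in> topspace (top_of_set (closed_cell K s)). x \<in> U} = U \<inter> closed_cell K s" by auto
    ultimately show "openin (top_of_set (closed_cell K s)) {x \<in> topspace (top_of_set (closed_cell K s)). x \<in> U}" by simp
  qed
  from image_compactin[OF cpt this] show ?thesis by simp
qed

lemma continuous_map_realization:
  assumes "\<And>s. s \<in> K \<Longrightarrow> continuous_on (closed_cell K s) f"
  shows "continuous_map (realization K) (euclidean :: real topology) f"
  unfolding continuous_map_def
proof (intro conjI allI impI)
  fix U :: "real set" assume U: "openin euclidean U"
  show "openin (realization K) {x \<in> topspace (realization K). f x \<in> U}"
    unfolding openin_realization
  proof (intro conjI ballI)
    fix s assume "s \<in> K"
    have "{x \<in> topspace (realization K). f x \<in> U} \<inter> closed_cell K s = closed_cell K s \<inter> f -` U"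
      by (auto simp: closed_cell_def)
    moreover have "openin (top_of_set (closed_cell K s)) (closed_cell K s \<inter> f -` U)"
      using assms[OF \<open>s \<in> K\<close>] U by (auto simp: continuous_on_open_gen intro: continuous_openin_preimage_gen)
    ultimately show "openin (top_of_set (closed_cell K s)) ({x \<in> topspace (realization K). f x \<in> U} \<inter> closed_cell K s)" by simp
  qed auto
qed auto

text \<open>The complexes of the iterated suspensions; \<open>Inr (2 * n)\<close> and \<open>Inr (Suc (2 * n))\<close> are
  the poles of the suspension number \<open>n + 1\<close>.\<close>

primrec susp_complexes :: "'v set set \<Rightarrow> nat \<Rightarrow> ('v + nat) set set" where
  "susp_complexes K 0 = (`) Inl ` K"
| "susp_complexes K (Suc n) = susp (susp_complexes K n) (Inr (2 * n)) (Inr (Suc (2 * n)))"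

lemma Inr_susp_complexes:
  assumes "2 * n \<le> m"
  shows "Inr m \<notin> \<Union>(susp_complexes K n)"
  using assms
proof (induction n)
  case (Suc n)
  show ?case
  proof
    assume "Inr m \<in> \<Union>(susp_complexes K (Suc n))"
    then obtain t where t: "Inr m \<in> t" "t \<in> susp (susp_complexes K n) (Inr (2 * n)) (Inr (Suc (2 * n)))" by auto
    then have "t - {Inr (2 * n), Inr (Suc (2 * n))} = {} \<or> t - {Inr (2 * n), Inr (Suc (2 * n))} \<in> susp_complexes K n"
      by (simp add: susp_def)
    moreover have "Inr m \<in> t - {Inr (2 * n), Inr (Suc (2 * n))}" using t(1) Suc.prems by auto
    ultimately have "Inr m \<in> \<Union>(susp_complexes K n)" by (metis UnionI empty_iff)
    then show False using Suc by simp
  qed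
qed auto

lemma complex_susp_complexes:
  assumes K: "abstract_simplicial_complex K"
  shows "abstract_simplicial_complex (susp_complexes K n)"
proof (induction n)
  case 0
  show ?case
    unfolding abstract_simplicial_complex_def
  proof (intro conjI ballI allI impI; (elim conjE)?)
    fix s assume "s \<in> susp_complexes K 0"
    then obtain s' where s: "s = Inl ` s'" "s' \<in> K" by auto
    then have "finite s'" "s' \<noteq> {}" using K unfolding abstract_simplicial_complex_def by simp_all
    then show "finite s" "s \<noteq> {}" using s by auto
    fix t assume t: "t \<subseteq> s" "t \<noteq> {}"
    then obtain t' where t': "t' \<subseteq> s'" "t = Inl ` t'" using s(1) by (auto simp: subset_image_iff)
    then have "t' \<in> K" using complex_face[OF K s(2) t'(1)] t(2) by auto
    then show "t \<in> susp_complexes K 0" using t' by auto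
  qed
next
  case (Suc n)
  then show ?case by (simp add: susp_complex)
qed

lemma susp_tower_susp_complexes:
  assumes K: "abstract_simplicial_complex K" "K \<noteq> {}" "countable (\<Union>K)"
  shows "susp_tower (susp_complexes K)"
  unfolding susp_tower_def
proof (intro conjI allI)
  show "abstract_simplicial_complex (susp_complexes K 0)" by (rule complex_susp_complexes[OF K(1)])
  show "susp_complexes K 0 \<noteq> {}" using K(2) by simp
  have "\<Union>(susp_complexes K 0) = Inl ` \<Union>K" by auto
  then show "countable (\<Union>(susp_complexes K 0))" using K(3) by simp
  fix n show "\<exists>S N. S \<noteq> N \<and> S \<notin> \<Union>(susp_complexes K n) \<and> N \<notin> \<Union>(susp_complexes K n) \<and>
      susp_complexes K (Suc n) = susp (susp_complexes K n) S N"
    by (intro exI[of _ "Inr (2 * n)"] exI[of _ "Inr (Suc (2 * n))"] conjI Inr_susp_complexes) simp_all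
qed

text \<open>Barycentric coordinates of the points of the iterated suspensions; the parameter \<open>t\<close> of
  a suspension is turned into the coordinates of its two poles, at least one of which vanishes.\<close>

definition cone_coords :: "nat \<Rightarrow> real \<Rightarrow> ('v + nat \<Rightarrow> real) \<Rightarrow> 'v + nat \<Rightarrow> real" where
  "cone_coords n t c w = (if w = Inr (2 * n) then max 0 (1 - 2 * t)
     else if w = Inr (Suc (2 * n)) then max 0 (2 * t - 1) else (1 - \<bar>2 * t - 1\<bar>) * c w)"

primrec coords :: "nat \<Rightarrow> ('v \<Rightarrow> real) susp_point \<Rightarrow> 'v + nat \<Rightarrow> real" where
  "coords 0 p = (case p of Base b \<Rightarrow> (\<lambda>w. case w of Inl v \<Rightarrow> b v | Inr _ \<Rightarrow> 0) | _ \<Rightarrow> (\<lambda>_. 0))"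
| "coords (Suc n) p = (case p of Mid q t \<Rightarrow> cone_coords n t (coords n q)
     | South \<Rightarrow> cone_coords n 0 (\<lambda>_. 0) | North \<Rightarrow> cone_coords n 1 (\<lambda>_. 0) | Base _ \<Rightarrow> (\<lambda>_. 0))"

lemma coords_susp_proj:
  assumes "t \<in> {0..1}"
  shows "coords (Suc n) (susp_proj (q, t)) = cone_coords n t (coords n q)"
  by (auto simp: susp_proj_def cone_coords_def fun_eq_iff)

text \<open>Inverse of \<open>coords\<close>. The divisor is the total weight off the two new poles;
  if it is 0 then the parameter is 0 or 1, and \<open>susp_proj\<close> ignores the meaningless
  first component.\<close>

primrec point_of :: "nat \<Rightarrow> ('v + nat \<Rightarrow> real) \<Rightarrow> ('v \<Rightarrow> real) susp_point" where
  "point_of 0 c = Base (\<lambda>v. c (Inl v))"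
| "point_of (Suc n) c = susp_proj (point_of n (\<lambda>w. if w = Inr (2 * n) \<or> w = Inr (Suc (2 * n)) then 0
       else c w / (1 - c (Inr (2 * n)) - c (Inr (Suc (2 * n))))),
     (1 + c (Inr (Suc (2 * n))) - c (Inr (2 * n))) / 2)"

lemma topspace_suspension:
  "topspace (suspension T) = susp_proj ` (topspace T \<times> {0..1})"
  by (simp add: suspension_def)

lemma continuous_map_susp_proj:
  "continuous_map (prod_topology T (top_of_set {0..1})) (suspension T) susp_proj"
  unfolding suspension_def by (rule quotient_imp_continuous_map[OF quotient_map_final_topology])

lemma continuous_map_from_suspension:
  assumes "continuous_map (prod_topology T (top_of_set {0..1})) Z (\<lambda>z. g (susp_proj z))"
  shows "continuous_map (suspension T) Z g"
proof -
  have "continuous_map (prod_topology T (top_of_set {0..1})) Z (g \<circ> susp_proj)" using assms by (simp add: o_def)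
  then show ?thesis
    unfolding suspension_def by (rule continuous_compose_quotient_map_eq[OF quotient_map_final_topology, THEN iffD1])
qed

context
  fixes K :: "'v set set"
  assumes K: "abstract_simplicial_complex K" "K \<noteq> {}"
begin

lemma carrier_Inr:
  assumes "c \<in> realization_carrier (susp_complexes K n)" "2 * n \<le> m"
  shows "c (Inr m) = 0"
  using realization_carrierD(2)[OF assms(1)] Inr_susp_complexes[OF assms(2), of K] by auto

lemma finite_support:
  assumes "c \<in> realization_carrier (susp_complexes K n)"
  shows "finite {w. c w \<noteq> 0}"
  using realization_carrierD(2)[OF assms] complex_susp_complexes[OF K(1), of n]
  unfolding abstract_simplicial_complex_def by simp

lemma cone_coords_carrier:
  assumes c: "c \<in> realization_carrier (susp_complexes K n)" and t: "t \<in> {0..1}"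
  shows "cone_coords n t c \<in> realization_carrier (susp_complexes K (Suc n))"
proof -
  let ?S = "Inr (2 * n) :: 'v + nat" and ?N = "Inr (Suc (2 * n)) :: 'v + nat"
  define s where "s = {w. c w \<noteq> 0}"
  have fin: "finite s" unfolding s_def by (rule finite_support[OF c])
  have SN: "?S \<notin> s" "?N \<notin> s" using carrier_Inr[OF c] by (simp_all add: s_def)
  let ?W = "insert ?S (insert ?N s)"
  let ?d = "cone_coords n t c"
  have sup: "{w. ?d w \<noteq> 0} \<subseteq> ?W" by (auto simp: cone_coords_def s_def)
  have pos: "0 \<le> ?d w" for w using t realization_carrierD(1)[OF c] by (auto simp: cone_coords_def)
  have "sum ?d ?W = ?d ?S + (?d ?N + sum ?d s)" using fin SN by simp
  also have "sum ?d s = (\<Sum>w\<in>s. (1 - \<bar>2 * t - 1\<bar>) * c w)"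
    using SN by (intro sum.cong) (auto simp: cone_coords_def)
  also have "\<dots> = 1 - \<bar>2 * t - 1\<bar>"
    using realization_carrierD(3)[OF c] by (simp add: s_def flip: sum_distrib_left)
  also have "?d ?S + (?d ?N + (1 - \<bar>2 * t - 1\<bar>)) = 1" by (simp add: cone_coords_def)
  finally have sum1: "sum ?d ?W = 1" .
  have ne: "{w. ?d w \<noteq> 0} \<noteq> {}"
  proof
    assume e: "{w. ?d w \<noteq> 0} = {}"
    then have "sum ?d ?W = 0" by (intro sum.neutral) auto
    then show False using sum1 by simp
  qed
  have rest: "?d w = (1 - \<bar>2 * t - 1\<bar>) * c w" if "w \<noteq> ?S" "w \<noteq> ?N" for w using that by (simp add: cone_coords_def)
  have A: "{w. ?d w \<noteq> 0} - {?S, ?N} \<in> insert {} (susp_complexes K n)"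
  proof (cases "1 - \<bar>2 * t - 1\<bar> = 0")
    case True
    then have "{w. ?d w \<noteq> 0} - {?S, ?N} = {}" using rest by auto
    then show ?thesis by simp
  next
    case False
    have "w \<in> {w. ?d w \<noteq> 0} - {?S, ?N} \<longleftrightarrow> w \<in> s" for w
    proof (cases "w = ?S \<or> w = ?N")
      case True
      then show ?thesis using SN by auto
    next
      case w: False
      then have "?d w = (1 - \<bar>2 * t - 1\<bar>) * c w" using rest by simp
      then show ?thesis using w False by (simp add: s_def)
    qed
    then have "{w. ?d w \<noteq> 0} - {?S, ?N} = s" by (rule set_eqI)
    then show ?thesis using realization_carrierD(2)[OF c] by (simp only: s_def insertI2)
  qed
  have "\<not> (?d ?S \<noteq> 0 \<and> ?d ?N \<noteq> 0)" by (simp add: cone_coords_def max_def)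
  then have "\<not> (?S \<in> {w. ?d w \<noteq> 0} \<and> ?N \<in> {w. ?d w \<noteq> 0})" by (simp only: mem_Collect_eq not_False_eq_True)
  with ne A have "{w. ?d w \<noteq> 0} \<in> susp_complexes K (Suc n)"
    unfolding susp_complexes.simps susp_def by (intro CollectI conjI)
  then show ?thesis using realization_carrier_iff[OF _ sup] fin pos sum1 by simp
qed

lemma coords_carrier:
  "p \<in> topspace (iter_suspension n (realization K)) \<Longrightarrow> coords n p \<in> realization_carrier (susp_complexes K n)"
proof (induction n arbitrary: p)
  case 0
  then obtain b where b: "p = Base b" "b \<in> realization_carrier K" by auto
  have eq: "{w. coords 0 p w \<noteq> 0} = Inl ` {v. b v \<noteq> 0}"
    by (auto simp: b(1) image_iff split: sum.splits) (metis sum.exhaust)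
  have fin: "finite {v. b v \<noteq> 0}" using realization_carrierD(2)[OF b(2)] K unfolding abstract_simplicial_complex_def by simp
  have "sum (coords 0 p) (Inl ` {v. b v \<noteq> 0}) = sum b {v. b v \<noteq> 0}"
    by (subst sum.reindex) (auto simp: b(1))
  then have "sum (coords 0 p) (Inl ` {v. b v \<noteq> 0}) = 1" using realization_carrierD(3)[OF b(2)] by simp
  moreover have "0 \<le> coords 0 p w" for w using realization_carrierD(1)[OF b(2)] by (auto simp: b(1) split: sum.split)
  moreover have "{w. coords 0 p w \<noteq> 0} \<in> susp_complexes K 0" unfolding eq using realization_carrierD(2)[OF b(2)] by simp
  ultimately show ?case using realization_carrier_iff[of "Inl ` {v. b v \<noteq> 0}" "coords 0 p"] fin eq by blast
next
  case (Suc n)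
  then obtain q t where q: "q \<in> topspace (iter_suspension n (realization K))" "t \<in> {0..1}" "p = susp_proj (q, t)"
    by (auto simp: topspace_suspension)
  show ?case unfolding q(3) coords_susp_proj[OF q(2)] by (rule cone_coords_carrier[OF Suc.IH[OF q(1)] q(2)])
qed

lemma point_of_coords:
  "p \<in> topspace (iter_suspension n (realization K)) \<Longrightarrow> point_of n (coords n p) = p"
proof (induction n arbitrary: p)
  case 0
  then show ?case by auto
next
  case (Suc n)
  then obtain q t where q: "q \<in> topspace (iter_suspension n (realization K))" "t \<in> {0..1}" "p = susp_proj (q, t)"
    by (auto simp: topspace_suspension)
  let ?c = "cone_coords n t (coords n q)"
  have S: "?c (Inr (2 * n)) = max 0 (1 - 2 * t)" and N: "?c (Inr (Suc (2 * n))) = max 0 (2 * t - 1)"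
    by (simp_all add: cone_coords_def)
  have t: "(1 + ?c (Inr (Suc (2 * n))) - ?c (Inr (2 * n))) / 2 = t" unfolding S N by (simp add: max_def)
  have d: "1 - ?c (Inr (2 * n)) - ?c (Inr (Suc (2 * n))) = 1 - \<bar>2 * t - 1\<bar>" unfolding S N by (simp add: max_def)
  show ?case
  proof (cases "t = 0 \<or> t = 1")
    case True
    then show ?thesis unfolding q(3) coords_susp_proj[OF q(2)] point_of.simps t by (auto simp: susp_proj_def)
  next
    case False
    then have nz: "1 - \<bar>2 * t - 1\<bar> \<noteq> 0" using q(2) by auto
    have "(\<lambda>w. if w = Inr (2 * n) \<or> w = Inr (Suc (2 * n)) then 0 else ?c w / (1 - \<bar>2 * t - 1\<bar>)) = coords n q"
    proof
      fix w
      show "(if w = Inr (2 * n) \<or> w = Inr (Suc (2 * n)) then 0 else ?c w / (1 - \<bar>2 * t - 1\<bar>)) = coords n q w"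
        using carrier_Inr[OF coords_carrier[OF q(1)]] nz by (auto simp: cone_coords_def)
    qed
    then show ?thesis unfolding q(3) coords_susp_proj[OF q(2)] point_of.simps t d
      using Suc.IH[OF q(1)] by simp
  qed
qed

lemma topspace_iter_suspension_nonempty: "topspace (iter_suspension n (realization K)) \<noteq> {}"
proof (induction n)
  case 0
  obtain v where v: "{v} \<in> K" using complex_vertex[OF K] .
  have "(\<lambda>w. if w = v then 1 else 0) \<in> realization_carrier K"
    using realization_carrier_iff[of "{v}" "\<lambda>w. if w = v then 1 else 0" K] v by simp
  then show ?case by auto
qed (auto simp: topspace_suspension)

lemma coords_point_of:
  "c \<in> realization_carrier (susp_complexes K n) \<Longrightarrow>
    point_of n c \<in> topspace (iter_suspension n (realization K)) \<and> coords n (point_of n c) = c"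
proof (induction n arbitrary: c)
  case 0
  have Inr0: "c (Inr m) = 0" for m using carrier_Inr[OF 0] by simp
  let ?b = "\<lambda>v. c (Inl v)"
  have sup: "{w. c w \<noteq> 0} = Inl ` {v. ?b v \<noteq> 0}"
    using Inr0 by (auto simp: image_iff) (metis sum.exhaust)
  have "{v. ?b v \<noteq> 0} \<in> K"
    using realization_carrierD(2)[OF 0] unfolding sup by (auto simp: inj_image_eq_iff)
  moreover have "sum ?b {v. ?b v \<noteq> 0} = 1"
    using realization_carrierD(3)[OF 0] unfolding sup by (simp add: sum.reindex)
  ultimately have "?b \<in> realization_carrier K" using realization_carrierD(1)[OF 0] by (simp add: realization_carrier_def)
  moreover have "coords 0 (point_of 0 c) = c" using Inr0 by (auto simp: fun_eq_iff split: sum.split)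
  ultimately show ?case by simp
next
  case (Suc n)
  let ?S = "Inr (2 * n) :: 'v + nat" and ?N = "Inr (Suc (2 * n)) :: 'v + nat"
  define s where "s = {w. c w \<noteq> 0}"
  have s: "s \<in> susp (susp_complexes K n) ?S ?N" using realization_carrierD(2)[OF Suc.prems] by (simp add: s_def)
  have pos: "0 \<le> c w" for w using realization_carrierD(1)[OF Suc.prems] .
  have fin: "finite s" unfolding s_def by (rule finite_support[OF Suc.prems])
  have rest: "s - {?S, ?N} = {} \<or> s - {?S, ?N} \<in> susp_complexes K n" using s by (simp add: susp_def)
  have SN: "c ?S = 0 \<or> c ?N = 0" using s by (auto simp: susp_def s_def)
  define \<sigma> where "\<sigma> = sum c (s - {?S, ?N})"
  have "sum c (insert ?S (insert ?N s)) = 1"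
    using realization_carrierD(3)[OF Suc.prems] fin
    by (subst sum.mono_neutral_right[of _ s]) (auto simp: s_def)
  moreover have "insert ?S (insert ?N s) = insert ?S (insert ?N (s - {?S, ?N}))" by auto
  ultimately have total: "c ?S + c ?N + \<sigma> = 1" using fin by (simp add: \<sigma>_def)
  have \<sigma>0: "0 \<le> \<sigma>" unfolding \<sigma>_def using pos by (intro sum_nonneg) auto
  define t where "t = (1 + c ?N - c ?S) / 2"
  have t01: "t \<in> {0..1}" using total \<sigma>0 pos[of ?S] pos[of ?N] by (auto simp: t_def)
  have tS: "max 0 (1 - 2 * t) = c ?S" and tN: "max 0 (2 * t - 1) = c ?N" and ts: "1 - \<bar>2 * t - 1\<bar> = \<sigma>"
    using SN pos[of ?S] pos[of ?N] total by (auto simp: t_def max_def field_simps)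
  define r where "r = (\<lambda>w. if w = ?S \<or> w = ?N then 0 else c w / (1 - c ?S - c ?N))"
  have pt: "point_of (Suc n) c = susp_proj (point_of n r, t)" by (simp only: point_of.simps r_def t_def)
  have d: "1 - c ?S - c ?N = \<sigma>" using total by simp
  show ?case
  proof (cases "s - {?S, ?N} = {}")
    case True
    then have \<sigma>: "\<sigma> = 0" by (simp only: \<sigma>_def sum.empty)
    then have t: "t = 0 \<or> t = 1" using ts by auto
    \<comment> \<open>At a pole the first component has no meaning and may lie outside the space;
      any point of the nonempty space can take its place.\<close>
    obtain q where q: "q \<in> topspace (iter_suspension n (realization K))" using topspace_iter_suspension_nonempty by blast
    have eq: "susp_proj (point_of n r, t) = susp_proj (q, t)" using t by (auto simp: susp_proj_def)
    have "susp_proj (q, t) \<in> topspace (iter_suspension (Suc n) (realization K))"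
      using q t01 by (simp add: topspace_suspension)
    moreover have "cone_coords n t (coords n q) = c"
    proof
      fix w
      show "cone_coords n t (coords n q) w = c w"
        using True tS tN ts \<sigma> by (auto simp: cone_coords_def s_def)
    qed
    ultimately show ?thesis unfolding pt eq coords_susp_proj[OF t01] by simp
  next
    case False
    then have sK: "s - {?S, ?N} \<in> susp_complexes K n" using rest by simp
    have "\<sigma> \<noteq> 0"
    proof
      assume "\<sigma> = 0"
      then have "\<forall>w\<in>s - {?S, ?N}. c w = 0" unfolding \<sigma>_def using fin pos by (subst (asm) sum_nonneg_eq_0_iff) auto
      then show False using False by (auto simp: s_def)
    qed
    then have \<sigma>: "0 < \<sigma>" using \<sigma>0 by simp
    have rsup: "{w. r w \<noteq> 0} = s - {?S, ?N}" using \<sigma> by (auto simp: r_def d s_def)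
    have "sum r (s - {?S, ?N}) = sum (\<lambda>w. c w / \<sigma>) (s - {?S, ?N})"
      by (intro sum.cong) (auto simp: r_def d)
    also have "\<dots> = 1" using \<sigma> by (simp add: \<sigma>_def flip: sum_divide_distrib)
    finally have "sum r (s - {?S, ?N}) = 1" .
    moreover have "0 \<le> r w" for w using pos \<sigma> by (simp add: r_def d)
    ultimately have "r \<in> realization_carrier (susp_complexes K n)"
      unfolding realization_carrier_def mem_Collect_eq rsup using sK by simp
    then have IH: "point_of n r \<in> topspace (iter_suspension n (realization K))" "coords n (point_of n r) = r"
      using Suc.IH by blast+
    have "cone_coords n t r = c"
    proof
      fix w
      show "cone_coords n t r w = c w"
        using tS tN ts \<sigma> by (auto simp: cone_coords_def r_def d)
    qed
    moreover have "susp_proj (point_of n r, t) \<in> topspace (iter_suspension (Suc n) (realization K))"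
      using IH(1) t01 by (simp add: topspace_suspension)
    ultimately show ?thesis unfolding pt coords_susp_proj[OF t01] IH(2) by simp
  qed
qed

section \<open>Continuity of the coordinates, and compact sets\<close>

lemma continuous_map_coords:
  "continuous_map (iter_suspension n (realization K)) euclideanreal (\<lambda>p. coords n p w)"
proof (induction n arbitrary: w)
  case 0
  have "continuous_map (realization K) euclideanreal (\<lambda>b. coords 0 (Base b) w)"
  proof (rule continuous_map_realization)
    fix s show "continuous_on (closed_cell K s) (\<lambda>b. coords 0 (Base b) w)"
      by (cases w) (auto intro: continuous_on_product_coordinates continuous_on_subset[OF _ subset_UNIV])
  qed
  then have "continuous_map (realization K) euclideanreal ((\<lambda>p. coords 0 p w) \<circ> Base)" by (simp only: o_def)
  then show ?case unfolding iter_suspension.simps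
    by (rule continuous_compose_quotient_map_eq[OF quotient_map_final_topology, THEN iffD1])
next
  case (Suc n)
  let ?P = "prod_topology (iter_suspension n (realization K)) (top_of_set {0..1::real})"
  have snd: "continuous_map ?P euclideanreal snd"
    using continuous_map_snd continuous_map_into_fulltopology by blast
  have fst: "continuous_map ?P euclideanreal (\<lambda>z. coords n (fst z) w)"
    using continuous_map_compose[OF continuous_map_fst Suc.IH] by (simp add: o_def)
  have "continuous_map ?P euclideanreal (\<lambda>z. cone_coords n (snd z) (coords n (fst z)) w)"
  proof -
    consider "w = Inr (2 * n)" | "w = Inr (Suc (2 * n))" | "w \<noteq> Inr (2 * n)" "w \<noteq> Inr (Suc (2 * n))" by blast
    then show ?thesis
      by cases (auto simp: cone_coords_def intro!: continuous_map_real_max continuous_map_diff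
          continuous_map_real_mult continuous_map_real_abs snd fst)
  qed
  then have "continuous_map ?P euclideanreal (\<lambda>z. coords (Suc n) (susp_proj z) w)"
    by (rule continuous_map_eq) (auto simp del: coords.simps simp: coords_susp_proj)
  then show ?case unfolding iter_suspension.simps by (rule continuous_map_from_suspension)
qed

text \<open>Arbitrary weights on the vertices are allowed, which is what makes compact sets meet
  only finitely many of them.\<close>

lemma continuous_map_weighted_coords:
  "continuous_map (iter_suspension n (realization K)) euclideanreal
     (\<lambda>p. \<Sum>v | coords n p (Inl v) \<noteq> 0. \<kappa> v * coords n p (Inl v))"
proof (induction n)
  case 0
  have "continuous_map (realization K) euclideanreal (\<lambda>b. \<Sum>v | b v \<noteq> 0. \<kappa> v * b v)"
  proof (rule continuous_map_realization)
    fix s assume s: "s \<in> K"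
    then have fin: "finite s" using K unfolding abstract_simplicial_complex_def by simp
    have "continuous_on (closed_cell K s) (\<lambda>b. \<Sum>v\<in>s. \<kappa> v * b v)"
      by (intro continuous_intros continuous_on_subset[OF continuous_on_product_coordinates subset_UNIV])
    then show "continuous_on (closed_cell K s) (\<lambda>b. \<Sum>v | b v \<noteq> 0. \<kappa> v * b v)"
    proof (rule continuous_on_cong[THEN iffD1, rotated -1])
      fix b assume "b \<in> closed_cell K s"
      then show "(\<Sum>v\<in>s. \<kappa> v * b v) = (\<Sum>v | b v \<noteq> 0. \<kappa> v * b v)"
        using fin by (intro sum.mono_neutral_right) (auto simp: closed_cell_def)
    qed simp
  qed
  then have "continuous_map (realization K) euclideanreal
      ((\<lambda>p. \<Sum>v | coords 0 p (Inl v) \<noteq> 0. \<kappa> v * coords 0 p (Inl v)) \<circ> Base)" by (simp add: o_def)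
  then show ?case unfolding iter_suspension.simps
    by (rule continuous_compose_quotient_map_eq[OF quotient_map_final_topology, THEN iffD1])
next
  case (Suc n)
  let ?P = "prod_topology (iter_suspension n (realization K)) (top_of_set {0..1::real})"
  let ?\<theta> = "\<lambda>n p. \<Sum>v | coords n p (Inl v) \<noteq> 0. \<kappa> v * coords n p (Inl v)"
  have snd: "continuous_map ?P euclideanreal snd"
    using continuous_map_snd continuous_map_into_fulltopology by blast
  have fst: "continuous_map ?P euclideanreal (\<lambda>z. ?\<theta> n (fst z))"
    using continuous_map_compose[OF continuous_map_fst Suc.IH] by (simp add: o_def)
  have "continuous_map ?P euclideanreal (\<lambda>z. (1 - \<bar>2 * snd z - 1\<bar>) * ?\<theta> n (fst z))"
    by (intro continuous_map_diff continuous_map_real_mult continuous_map_real_abs snd fst) simp_all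
  then have "continuous_map ?P euclideanreal (\<lambda>z. ?\<theta> (Suc n) (susp_proj z))"
  proof (rule continuous_map_eq)
    fix z assume "z \<in> topspace ?P"
    then obtain q t where z: "z = (q, t)" "t \<in> {0..1}" by auto
    have c: "coords (Suc n) (susp_proj z) (Inl v) = (1 - \<bar>2 * t - 1\<bar>) * coords n q (Inl v)" for v
      unfolding z(1) coords_susp_proj[OF z(2)] by (simp add: cone_coords_def)
    show "(1 - \<bar>2 * snd z - 1\<bar>) * ?\<theta> n (fst z) = ?\<theta> (Suc n) (susp_proj z)"
    proof (cases "1 - \<bar>2 * t - 1\<bar> = 0")
      case True
      then show ?thesis unfolding c by (simp add: z(1))
    next
      case False
      then have "{v. (1 - \<bar>2 * t - 1\<bar>) * coords n q (Inl v) \<noteq> 0} = {v. coords n q (Inl v) \<noteq> 0}" by auto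
      then show ?thesis unfolding c by (simp add: z(1) sum_distrib_left mult_ac)
    qed
  qed
  then show ?case unfolding iter_suspension.simps by (rule continuous_map_from_suspension)
qed

text \<open>Infinitely many vertices would allow weights for which the weighted sum is continuous
  but unbounded on \<open>Q\<close>. The poles contribute at most \<open>2 * n\<close> vertices, so
  the infinitely many come from \<open>K\<close>.\<close>

lemma finite_vertices_of_compact:
  assumes Q: "compactin (iter_suspension n (realization K)) Q"
  shows "finite {w. \<exists>p\<in>Q. coords n p w \<noteq> 0}"
proof (rule ccontr)
  let ?T = "iter_suspension n (realization K)"
  let ?A = "{w. \<exists>p\<in>Q. coords n p w \<noteq> 0}"
  assume inf: "infinite ?A"
  have QT: "Q \<subseteq> topspace ?T" using Q compactin_subset_topspace by blast
  have "?A \<subseteq> Inl ` {v. Inl v \<in> ?A} \<union> Inr ` {..<2 * n}"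
  proof
    fix w assume w: "w \<in> ?A"
    show "w \<in> Inl ` {v. Inl v \<in> ?A} \<union> Inr ` {..<2 * n}"
    proof (cases w)
      case (Inl v)
      then show ?thesis using w by blast
    next
      case (Inr m)
      obtain p where "p \<in> Q" "coords n p (Inr m) \<noteq> 0" using w Inr by blast
      then have "m < 2 * n" using carrier_Inr[OF coords_carrier] QT by (meson not_less subsetD)
      then show ?thesis using Inr by blast
    qed
  qed
  then have infV: "infinite {v. Inl v \<in> ?A}" using inf finite_subset by blast
  then obtain v :: "nat \<Rightarrow> 'v" where v: "inj v" "range v \<subseteq> {v. Inl v \<in> ?A}"
    using infinite_countable_subset by blast
  have "\<forall>i. \<exists>p. p \<in> Q \<and> coords n p (Inl (v i)) \<noteq> 0" using v(2) by blast
  then obtain p where p: "\<And>i. p i \<in> Q" "\<And>i. coords n (p i) (Inl (v i)) \<noteq> 0" by metis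
  \<comment> \<open>Scaled so that the vertex \<open>v i\<close> contributes exactly
    \<open>i\<close> at the point \<open>p i\<close>; the other summands are nonnegative.\<close>
  define \<kappa> where "\<kappa> u = (if u \<in> range v then real (inv v u) / coords n (p (inv v u)) (Inl u) else 0)" for u
  let ?\<theta> = "\<lambda>p. \<Sum>u | coords n p (Inl u) \<noteq> 0. \<kappa> u * coords n p (Inl u)"
  have carr: "coords n (p i) \<in> realization_carrier (susp_complexes K n)" for i using coords_carrier p(1) QT by blast
  have pos: "0 \<le> coords n (p i) w" for i w using realization_carrierD(1)[OF carr] .
  have \<kappa>pos: "0 \<le> \<kappa> u" for u unfolding \<kappa>_def using pos by simp
  have big: "real i \<le> ?\<theta> (p i)" for i
  proof -
    have "finite ((Inl :: 'v \<Rightarrow> 'v + nat) -` {w. coords n (p i) w \<noteq> 0})"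
      by (rule finite_vimageI[OF finite_support[OF carr]]) simp
    then have fin: "finite {u. coords n (p i) (Inl u) \<noteq> 0}" by (simp add: vimage_def)
    have "\<kappa> (v i) = real i / coords n (p i) (Inl (v i))" using v(1) by (simp add: \<kappa>_def)
    then have "real i = \<kappa> (v i) * coords n (p i) (Inl (v i))" using p(2) by simp
    also have "\<dots> \<le> ?\<theta> (p i)"
      using fin p(2) pos \<kappa>pos by (intro member_le_sum[where f = "\<lambda>u. \<kappa> u * coords n (p i) (Inl u)"]) auto
    finally show ?thesis .
  qed
  have "compactin euclideanreal (?\<theta> ` Q)" by (rule image_compactin[OF Q continuous_map_weighted_coords])
  then have "bounded (?\<theta> ` Q)" by (simp add: compact_imp_bounded)
  then obtain M where M: "\<And>y. y \<in> ?\<theta> ` Q \<Longrightarrow> norm y \<le> M" unfolding bounded_iff by blast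
  obtain i :: nat where "M < real i" using reals_Archimedean2 by blast
  then show False using big[of i] M[of "?\<theta> (p i)"] p(1)[of i] by fastforce
qed

text \<open>Finitely many vertices span finitely many compact cells, and a suspension of a compact
  set is the image of its product with the unit interval.\<close>

lemma compact_of_finite_vertices:
  assumes W: "finite W"
  obtains Q where "compactin (iter_suspension n (realization K)) Q"
    "\<And>p. p \<in> topspace (iter_suspension n (realization K)) \<Longrightarrow> (\<And>w. w \<notin> W \<Longrightarrow> coords n p w = 0) \<Longrightarrow> p \<in> Q"
proof -
  have "\<exists>Q. compactin (iter_suspension n (realization K)) Q \<and>
    (\<forall>p \<in> topspace (iter_suspension n (realization K)). (\<forall>w. w \<notin> W \<longrightarrow> coords n p w = 0) \<longrightarrow> p \<in> Q)"
  proof (induction n)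
    case 0
    define F where "F = {s \<in> K. s \<subseteq> Inl -` W}"
    have "finite (Inl -` W)" using W by (simp add: finite_vimageI)
    then have "finite F" unfolding F_def by (rule_tac finite_subset[of _ "Pow (Inl -` W)"]) auto
    then have "compactin (realization K) (\<Union>s\<in>F. closed_cell K s)"
      by (intro compactin_Union) (auto simp: F_def intro: compactin_closed_cell K(1))
    then have "compactin (iter_suspension 0 (realization K)) (Base ` (\<Union>s\<in>F. closed_cell K s))"
      using image_compactin quotient_imp_continuous_map[OF quotient_map_final_topology[of "realization K" Base]] by fastforce
    moreover have "p \<in> Base ` (\<Union>s\<in>F. closed_cell K s)"
      if p: "p \<in> topspace (iter_suspension 0 (realization K))" "\<forall>w. w \<notin> W \<longrightarrow> coords 0 p w = 0" for p
    proof -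
      obtain b where b: "p = Base b" "b \<in> realization_carrier K" using p(1) by auto
      have "{v. b v \<noteq> 0} \<subseteq> Inl -` W" using p(2) by (auto simp: b(1))
      then have "{v. b v \<noteq> 0} \<in> F" using realization_carrierD(2)[OF b(2)] by (simp add: F_def)
      moreover have "b \<in> closed_cell K {v. b v \<noteq> 0}" using b(2) by (simp add: closed_cell_def)
      ultimately show ?thesis unfolding b(1) by blast
    qed
    ultimately show ?case by blast
  next
    case (Suc n)
    let ?T = "iter_suspension n (realization K)"
    obtain Q where Q: "compactin ?T Q" "\<forall>p \<in> topspace ?T. (\<forall>w. w \<notin> W \<longrightarrow> coords n p w = 0) \<longrightarrow> p \<in> Q" using Suc by blast
    \<comment> \<open>A spare point: if \<open>Q\<close> were empty, its product with the interval
      would miss the poles.\<close>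
    obtain q0 where q0: "q0 \<in> topspace ?T" using topspace_iter_suspension_nonempty by blast
    have "compactin ?T (insert q0 Q)" using Q(1) q0 by (metis compactin_Un compactin_sing insert_is_Un)
    moreover have "compactin (top_of_set {0..1}) {0..1::real}" by (simp add: compactin_subtopology)
    ultimately have "compactin (prod_topology ?T (top_of_set {0..1})) (insert q0 Q \<times> {0..1::real})"
      unfolding compactin_Times by blast
    then have "compactin (suspension ?T) (susp_proj ` (insert q0 Q \<times> {0..1}))"
      by (rule image_compactin[OF _ continuous_map_susp_proj])
    moreover have "p \<in> susp_proj ` (insert q0 Q \<times> {0..1})"
      if p: "p \<in> topspace (suspension ?T)" "\<forall>w. w \<notin> W \<longrightarrow> coords (Suc n) p w = 0" for p
    proof -
      obtain q t where q: "q \<in> topspace ?T" "t \<in> {0..1}" "p = susp_proj (q, t)"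
        using p(1) by (auto simp: topspace_suspension)
      show ?thesis
      proof (cases "t = 0 \<or> t = 1")
        case True
        then have "p = susp_proj (q0, t)" unfolding q(3) by (auto simp: susp_proj_def)
        then show ?thesis using q(2) by blast
      next
        case False
        then have nz: "1 - \<bar>2 * t - 1\<bar> \<noteq> 0" using q(2) by auto
        have "coords n q w = 0" if w: "w \<notin> W" for w
        proof (cases "w = Inr (2 * n) \<or> w = Inr (Suc (2 * n))")
          case True
          then show ?thesis using carrier_Inr[OF coords_carrier[OF q(1)]] by auto
        next
          case False
          have "cone_coords n t (coords n q) w = 0" using p(2) w unfolding q(3) coords_susp_proj[OF q(2)] by blast
          then show ?thesis using False nz by (simp add: cone_coords_def)
        qed
        then have "q \<in> Q" using Q(2) q(1) by blast
        then show ?thesis unfolding q(3) using q(2) by blast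
      qed
    qed
    ultimately show ?case unfolding iter_suspension.simps by blast
  qed
  then show thesis using that by blast
qed

end

section \<open>The function space\<close>

context compact_metrizable
begin

text \<open>The topology of the iterated suspension is not defined by the coordinates. However, all
  values lie in one compact set \<open>Q\<close>, on which \<open>coords\<close> is continuous and
  injective into a Hausdorff space and therefore carries closed sets to closed sets.\<close>

lemma continuous_map_point_of:
  assumes K: "abstract_simplicial_complex K" "K \<noteq> {}" and A: "closedin X A"
    and \<phi>: "cm (susp_complexes K n) A \<phi>" and carr: "\<And>x. x \<in> A \<Longrightarrow> \<phi> x \<in> realization_carrier (susp_complexes K n)"
  shows "continuous_map (subtopology X A) (iter_suspension n (realization K)) (\<lambda>x. point_of n (\<phi> x))"
  unfolding continuous_map_closedin
proof (intro conjI allI impI)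
  let ?T = "iter_suspension n (realization K)"
  have pt: "point_of n (\<phi> x) \<in> topspace ?T" "coords n (point_of n (\<phi> x)) = \<phi> x" if "x \<in> A" for x
    using coords_point_of[OF K carr[OF that]] by blast+
  show "(\<lambda>x. point_of n (\<phi> x)) \<in> topspace (subtopology X A) \<rightarrow> topspace ?T" using pt(1) by auto
  fix C assume C: "closedin ?T C"
  obtain W where W: "finite W" "\<And>x w. x \<in> A \<Longrightarrow> w \<notin> W \<Longrightarrow> \<phi> x w = 0" using cm_vertices[OF \<phi>] by blast
  obtain Q where Q: "compactin ?T Q"
    "\<And>p. p \<in> topspace ?T \<Longrightarrow> (\<And>w. w \<notin> W \<Longrightarrow> coords n p w = 0) \<Longrightarrow> p \<in> Q"
    by (rule compact_of_finite_vertices[OF K W(1), of n]) blast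
  have QT: "Q \<subseteq> topspace ?T" using Q(1) compactin_subset_topspace by blast
  let ?E = "product_topology (\<lambda>_. euclideanreal) UNIV"
  have "continuous_map ?T ?E (coords n)"
    unfolding continuous_map_componentwise_UNIV using continuous_map_coords[OF K] by blast
  moreover have "compactin ?T (C \<inter> Q)" using closed_Int_compactin[OF C Q(1)] .
  ultimately have "compactin ?E (coords n ` (C \<inter> Q))" by (rule image_compactin[rotated])
  moreover have "Hausdorff_space ?E" by (simp add: Hausdorff_space_product_topology)
  ultimately have cl: "closedin ?E (coords n ` (C \<inter> Q))" using compactin_imp_closedin by blast
  have "continuous_map (subtopology X A) ?E \<phi>"
    unfolding continuous_map_componentwise_UNIV using cmD(1)[OF \<phi>] by (simp add: cf_def)
  from closedin_continuous_map_preimage[OF this cl]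
  have "closedin (subtopology X A) {x \<in> topspace (subtopology X A). \<phi> x \<in> coords n ` (C \<inter> Q)}" .
  moreover have "\<phi> x \<in> coords n ` (C \<inter> Q) \<longleftrightarrow> point_of n (\<phi> x) \<in> C" if x: "x \<in> A" for x
  proof
    assume "\<phi> x \<in> coords n ` (C \<inter> Q)"
    then obtain p where p: "p \<in> C" "p \<in> Q" "\<phi> x = coords n p" by blast
    then have "point_of n (\<phi> x) = p" using point_of_coords[OF K] QT by auto
    then show "point_of n (\<phi> x) \<in> C" using p(1) by simp
  next
    assume C': "point_of n (\<phi> x) \<in> C"
    have "point_of n (\<phi> x) \<in> Q" by (rule Q(2)[OF pt(1)[OF x]]) (use pt(2)[OF x] W(2)[OF x] in simp)
    then show "\<phi> x \<in> coords n ` (C \<inter> Q)" using C' pt(2)[OF x] by (metis IntI image_eqI)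
  qed
  then have "{x \<in> topspace (subtopology X A). \<phi> x \<in> coords n ` (C \<inter> Q)} =
      {x \<in> topspace (subtopology X A). point_of n (\<phi> x) \<in> C}" by auto
  ultimately show "closedin (subtopology X A) {x \<in> topspace (subtopology X A). point_of n (\<phi> x) \<in> C}" by simp
qed

text \<open>The image of the compact set \<open>A\<close> is compact, so only finitely many vertices
  occur.\<close>

lemma cm_coords:
  assumes K: "abstract_simplicial_complex K" "K \<noteq> {}" and A: "closedin X A"
    and f: "continuous_map (subtopology X A) (iter_suspension n (realization K)) f"
  shows "cm (susp_complexes K n) A (\<lambda>x. coords n (f x))"
    "\<And>x. x \<in> A \<Longrightarrow> coords n (f x) \<in> realization_carrier (susp_complexes K n)"
proof -
  let ?T = "iter_suspension n (realization K)"
  have AX: "A \<subseteq> topspace X" using A closedin_subset by blast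
  have fT: "f x \<in> topspace ?T" if "x \<in> A" for x
    using continuous_map_image_subset_topspace[OF f] that AX by auto
  show carr: "coords n (f x) \<in> realization_carrier (susp_complexes K n)" if "x \<in> A" for x
    by (rule coords_carrier[OF K fT[OF that]])
  have "compactin (subtopology X A) A" using compact_closed[OF A] by (simp add: compactin_subtopology)
  then have "compactin ?T (f ` A)" by (rule image_compactin[OF _ f])
  then have "finite {w. \<exists>p\<in>f ` A. coords n p w \<noteq> 0}" by (rule finite_vertices_of_compact[OF K])
  moreover have "cf A (\<lambda>x. coords n (f x) w)" for w
    unfolding cf_def using continuous_map_compose[OF f continuous_map_coords[OF K]] by (simp add: o_def)
  ultimately show "cm (susp_complexes K n) A (\<lambda>x. coords n (f x))"
    unfolding cm_def using realization_carrierD(1,2)[OF carr] by auto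
qed

lemma cm_scale:
  assumes "cm K A \<phi>" "cf A s" "\<And>x. x \<in> A \<Longrightarrow> 0 < s x"
  shows "cm K A (\<lambda>x w. s x * \<phi> x w)"
proof -
  obtain W where W: "finite W" "\<And>x w. x \<in> A \<Longrightarrow> w \<notin> W \<Longrightarrow> \<phi> x w = 0" using cm_vertices assms(1) by blast
  show ?thesis
  proof (rule cmI[OF _ _ _ W(1)])
    show "cf A (\<lambda>x. s x * \<phi> x w)" for w by (intro cf_mult assms(2) cmD(1)[OF assms(1)])
    fix x assume x: "x \<in> A"
    show "0 \<le> s x * \<phi> x w" for w using assms(3)[OF x] cmD(2)[OF assms(1) x] by simp
    show "s x * \<phi> x w = 0" if "w \<notin> W" for w using W(2)[OF x that] by simp
    have "{w. s x * \<phi> x w \<noteq> 0} = {w. \<phi> x w \<noteq> 0}" using assms(3)[OF x] by auto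
    then show "{w. s x * \<phi> x w \<noteq> 0} \<in> K" using cmD(3)[OF assms(1) x] by simp
  qed
qed

lemma cm_normalize:
  assumes K: "abstract_simplicial_complex K" and "cm K A \<phi>"
  obtains s where "cf A s" "\<And>x. x \<in> A \<Longrightarrow> 0 < s x"
    "cm K A (\<lambda>x w. inverse (s x) * \<phi> x w)" "\<And>x. x \<in> A \<Longrightarrow> (\<lambda>w. inverse (s x) * \<phi> x w) \<in> realization_carrier K"
    "\<And>x. x \<in> A \<Longrightarrow> \<phi> x \<in> realization_carrier K \<Longrightarrow> s x = 1"
proof -
  obtain W where W: "finite W" "\<And>x w. x \<in> A \<Longrightarrow> w \<notin> W \<Longrightarrow> \<phi> x w = 0" using cm_vertices assms(2) by blast
  have K0: "{} \<notin> K" using K by (auto simp: abstract_simplicial_complex_def)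
  define s where "s x = (\<Sum>w\<in>W. \<phi> x w)" for x
  have s: "cf A s" unfolding s_def by (intro cf_sum W(1) cmD(1)[OF assms(2)])
  have spos: "0 < s x" if "x \<in> A" for x unfolding s_def by (rule cm_sum_pos[OF assms(2) K0 W that])
  have sub: "{w. \<phi> x w \<noteq> 0} \<subseteq> W" if "x \<in> A" for x using W(2)[OF that] by auto
  have cfi: "cf A (\<lambda>x. inverse (s x))"
    using cf_divide[OF cf_const s, of 1] spos by (force simp: inverse_eq_divide)
  have cmi: "cm K A (\<lambda>x w. inverse (s x) * \<phi> x w)" by (rule cm_scale[OF assms(2) cfi]) (simp add: spos)
  show thesis
  proof (rule that[OF s spos cmi])
    fix x assume x: "x \<in> A"
    have sub': "{w. inverse (s x) * \<phi> x w \<noteq> 0} \<subseteq> W" using sub[OF x] by auto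
    have "sum (\<lambda>w. inverse (s x) * \<phi> x w) W = 1" using spos[OF x] by (simp add: s_def flip: sum_distrib_left)
    then show "(\<lambda>w. inverse (s x) * \<phi> x w) \<in> realization_carrier K"
      using realization_carrier_iff[OF W(1) sub'] cmD(2,3)[OF cmi x] by simp
    show "s x = 1" if "\<phi> x \<in> realization_carrier K"
      using realization_carrier_iff[OF W(1) sub[OF x]] that by (simp add: s_def)
  qed
qed

text \<open>Dividing by the sum of the coordinates leads into the realization. A solution there is
  brought back to the original scale by a factor; conversely, coordinates that come from points have
  sum 1 and are not changed by normalizing.\<close>

lemma absolute_extensor_iff_AEc:
  assumes K: "abstract_simplicial_complex K" "K \<noteq> {}" and Y: "closedin X Y"
  shows "absolute_extensor (iter_suspension n (realization K)) (subtopology X Y) \<longleftrightarrow> AEc (susp_complexes K n) Y"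
proof
  let ?T = "iter_suspension n (realization K)" and ?K = "susp_complexes K n"
  have YX: "Y \<subseteq> topspace X" using Y closedin_subset by blast
  have Kn: "abstract_simplicial_complex ?K" by (rule complex_susp_complexes[OF K(1)])
  have sub: "subtopology (subtopology X Y) A = subtopology X A" if "A \<subseteq> Y" for A
    using that by (simp add: subtopology_subtopology Int_absorb1)
  show "AEc ?K Y" if ae: "absolute_extensor ?T (subtopology X Y)"
    unfolding AEc_def
  proof (intro allI impI; elim conjE)
    fix A \<phi> assume A: "closedin X A" "A \<subseteq> Y" "cm ?K A \<phi>"
    obtain s where s: "cf A s" "\<And>x. x \<in> A \<Longrightarrow> 0 < s x"
      "cm ?K A (\<lambda>x w. inverse (s x) * \<phi> x w)" "\<And>x. x \<in> A \<Longrightarrow> (\<lambda>w. inverse (s x) * \<phi> x w) \<in> realization_carrier ?K"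
      by (rule cm_normalize[OF Kn A(3)]) (rule that; (assumption | simp))
    define f where "f x = point_of n (\<lambda>w. inverse (s x) * \<phi> x w)" for x
    have f: "continuous_map (subtopology X A) ?T f"
      unfolding f_def by (rule continuous_map_point_of[OF K A(1) s(3,4)])
    have "closedin (subtopology X Y) A" using A by (simp add: closedin_subset_topspace)
    then have "\<exists>g. continuous_map (subtopology X Y) ?T g \<and> (\<forall>x\<in>A. g x = f x)"
      using ae f sub[OF A(2)] unfolding absolute_extensor_def by simp
    then obtain g where g: "continuous_map (subtopology X Y) ?T g" "\<And>x. x \<in> A \<Longrightarrow> g x = f x" by blast
    \<comment> \<open>A positive extension of the sum of the coordinates, by which the original
      scale is restored on \<open>A\<close>.\<close>
    obtain s' where s': "\<And>B. cf B s'" "\<And>x. x \<in> topspace X \<Longrightarrow> s' x \<in> {0<..}" "\<And>x. x \<in> A \<Longrightarrow> s' x = s x"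
      by (rule tietze[OF A(1) s(1), of "{0<..}"]) (use s(2) in \<open>auto simp: is_interval_oi\<close>)
    have "cm ?K Y (\<lambda>x w. s' x * coords n (g x) w)"
      by (rule cm_scale[OF cm_coords(1)[OF K Y g(1)] s'(1)]) (use s'(2) YX in auto)
    moreover have "(\<lambda>w. s' x * coords n (g x) w) = \<phi> x" if x: "x \<in> A" for x
    proof -
      have "coords n (g x) = (\<lambda>w. inverse (s x) * \<phi> x w)"
        using coords_point_of[OF K s(4)[OF x]] g(2)[OF x] by (simp add: f_def)
      then show ?thesis using s'(3)[OF x] s(2)[OF x] by (simp add: fun_eq_iff)
    qed
    ultimately show "\<exists>\<phi>'. cm ?K Y \<phi>' \<and> (\<forall>x\<in>A. \<phi>' x = \<phi> x)" by blast
  qed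
  show "absolute_extensor ?T (subtopology X Y)" if ae: "AEc ?K Y"
    unfolding absolute_extensor_def
  proof (intro allI impI; elim conjE)
    fix A f assume "closedin (subtopology X Y) A" and f': "continuous_map (subtopology (subtopology X Y) A) ?T f"
    then have A: "closedin X A" "A \<subseteq> Y" using Y closedin_trans_full closedin_subset by fastforce+
    have f: "continuous_map (subtopology X A) ?T f" using f' sub[OF A(2)] by simp
    have fT: "f x \<in> topspace ?T" if "x \<in> A" for x
      using continuous_map_image_subset_topspace[OF f] that A(2) YX by auto
    note c = cm_coords[OF K A(1) f]
    obtain \<phi> where \<phi>: "cm ?K Y \<phi>" "\<And>x. x \<in> A \<Longrightarrow> \<phi> x = coords n (f x)" using AEcE[OF ae A c(1)] by blast
    obtain s where s: "cf Y s" "\<And>x. x \<in> Y \<Longrightarrow> 0 < s x"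
      "cm ?K Y (\<lambda>x w. inverse (s x) * \<phi> x w)" "\<And>x. x \<in> Y \<Longrightarrow> (\<lambda>w. inverse (s x) * \<phi> x w) \<in> realization_carrier ?K"
      "\<And>x. x \<in> Y \<Longrightarrow> \<phi> x \<in> realization_carrier ?K \<Longrightarrow> s x = 1"
      by (rule cm_normalize[OF Kn \<phi>(1)]) (rule that; (assumption | simp))
    have "continuous_map (subtopology X Y) ?T (\<lambda>x. point_of n (\<lambda>w. inverse (s x) * \<phi> x w))"
      by (rule continuous_map_point_of[OF K Y s(3,4)])
    moreover have "point_of n (\<lambda>w. inverse (s x) * \<phi> x w) = f x" if x: "x \<in> A" for x
    proof -
      have "s x = 1" using s(5)[of x] x A(2) c(2)[OF x] \<phi>(2)[OF x] by auto
      then show ?thesis using \<phi>(2)[OF x] point_of_coords[OF K fT[OF x]] by simp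
    qed
    ultimately show "\<exists>g. continuous_map (subtopology X Y) ?T g \<and> (\<forall>x\<in>A. g x = f x)" by blast
  qed
qed

lemma ext_dim_le_iff_AEc:
  assumes K: "abstract_simplicial_complex K" "K \<noteq> {}" and Y: "closedin X Y"
  shows "ext_dim_le (realization K) (subtopology X Y) n \<longleftrightarrow> AEc (susp_complexes K n) Y"
  unfolding ext_dim_le_def by (rule absolute_extensor_iff_AEc[OF assms])

end

section \<open>Dimension zero, and boxes in the cube\<close>

lemma ext_dim_eq_0: "ext_dim L X = 0 \<longleftrightarrow> ext_dim_le L X 0"
proof
  assume 0: "ext_dim L X = 0"
  show "ext_dim_le L X 0"
  proof (rule ccontr)
    assume n: "\<not> ext_dim_le L X 0"
    have "(1::enat) \<le> ext_dim L X"
      unfolding ext_dim_def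
    proof (rule INF_greatest)
      fix m assume "m \<in> {n. ext_dim_le L X n}"
      then have "m \<noteq> 0" using n by (metis mem_Collect_eq)
      then show "1 \<le> enat m" by (simp add: one_enat_def)
    qed
    then show False using 0 by simp
  qed
next
  assume "ext_dim_le L X 0"
  from ext_dim_le_imp[OF this] show "ext_dim L X = 0" by (simp add: zero_enat_def[symmetric])
qed

lemma ext_dim_map_eq_0:
  "ext_dim_map L X Y f = 0 \<longleftrightarrow>
    (\<forall>y\<in>topspace Y. ext_dim_le L (subtopology X {x \<in> topspace X. f x = y}) 0)"
proof -
  have "ext_dim_map L X Y f = 0 \<longleftrightarrow> ext_dim_map L X Y f \<le> 0" by simp
  also have "\<dots> \<longleftrightarrow> (\<forall>y\<in>topspace Y. ext_dim L (subtopology X {x \<in> topspace X. f x = y}) \<le> 0)"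
    unfolding ext_dim_map_def by (rule SUP_le_iff)
  also have "\<dots> \<longleftrightarrow> (\<forall>y\<in>topspace Y. ext_dim_le L (subtopology X {x \<in> topspace X. f x = y}) 0)"
    by (simp add: ext_dim_eq_0)
  finally show ?thesis .
qed

lemma topspace_cube: "topspace (cube n) = Pi\<^sub>E {..<n} (\<lambda>_. {0..1})"
  by (simp add: cube_def)

lemma cube_eqI:
  assumes "y \<in> topspace (cube n)" "z \<in> topspace (cube n)" "\<And>i. i < n \<Longrightarrow> y i = z i"
  shows "y = z"
  using assms unfolding topspace_cube by (intro PiE_ext[of y "{..<n}" "\<lambda>_. {0..1}" z]) auto

lemma continuous_map_cube_coord:
  assumes "i < n"
  shows "continuous_map (cube n) euclideanreal (\<lambda>y. y i)"
proof -
  have "continuous_map (cube n) (top_of_set {0..1}) (\<lambda>y. y i)"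
    unfolding cube_def by (rule continuous_map_product_projection) (use assms in simp)
  then show ?thesis by (simp add: continuous_map_in_subtopology)
qed

lemma openin_cube_box:
  "openin (cube n) {y \<in> topspace (cube n). \<forall>i<n. \<bar>y i - c i\<bar> < r}"
proof -
  have "openin (cube n) {y \<in> topspace (cube n). \<bar>y i - c i\<bar> < r}" if "i < n" for i
  proof -
    have "continuous_map (cube n) euclideanreal (\<lambda>y. \<bar>y i - c i\<bar>)"
      by (intro continuous_map_real_abs continuous_map_diff continuous_map_cube_coord that) simp
    from openin_continuous_map_preimage[OF this, of "{..<r}"] show ?thesis by simp
  qed
  then have "openin (cube n) (topspace (cube n) \<inter> (\<Inter>i\<in>{..<n}. {y \<in> topspace (cube n). \<bar>y i - c i\<bar> < r}))"
    by (cases "n = 0") (auto intro!: openin_Int openin_INT)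
  moreover have "topspace (cube n) \<inter> (\<Inter>i\<in>{..<n}. {y \<in> topspace (cube n). \<bar>y i - c i\<bar> < r}) =
      {y \<in> topspace (cube n). \<forall>i<n. \<bar>y i - c i\<bar> < r}" by auto
  ultimately show ?thesis by simp
qed

lemma cube_box_inside:
  assumes "openin (cube n) U" "y \<in> U"
  obtains r where "0 < r" "\<And>z. z \<in> topspace (cube n) \<Longrightarrow> (\<And>i. i < n \<Longrightarrow> \<bar>z i - y i\<bar> < r) \<Longrightarrow> z \<in> U"
proof -
  obtain V where V: "\<And>i. i < n \<Longrightarrow> openin (top_of_set {0..1::real}) (V i)" "y \<in> Pi\<^sub>E {..<n} V" "Pi\<^sub>E {..<n} V \<subseteq> U"
    using assms unfolding cube_def openin_product_topology_alt by (metis lessThan_iff)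
  have "\<exists>r>0. \<forall>t\<in>{0..1}. \<bar>t - y i\<bar> < r \<longrightarrow> t \<in> V i" if i: "i < n" for i
  proof -
    have "y i \<in> V i" using V(2) i by auto
    then obtain r where "0 < r" "\<forall>t\<in>{0..1}. dist t (y i) < r \<longrightarrow> t \<in> V i"
      using V(1)[OF i] unfolding openin_euclidean_subtopology_iff by blast
    then show ?thesis by (auto simp: dist_real_def)
  qed
  then have "\<forall>i\<in>{..<n}. \<exists>r. 0 < r \<and> (\<forall>t\<in>{0..1}. \<bar>t - y i\<bar> < r \<longrightarrow> t \<in> V i)" by simp
  then obtain r where r: "\<forall>i\<in>{..<n}. 0 < r i \<and> (\<forall>t\<in>{0..1}. \<bar>t - y i\<bar> < r i \<longrightarrow> t \<in> V i)" by (rule bchoice[THEN exE])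
  define R where "R = Min (insert 1 (r ` {..<n}))"
  have R: "0 < R" "\<And>i. i < n \<Longrightarrow> R \<le> r i"
    using r by (auto simp: R_def)
  show thesis
  proof (rule that[OF R(1)])
    fix z assume z: "z \<in> topspace (cube n)" "\<And>i. i < n \<Longrightarrow> \<bar>z i - y i\<bar> < R"
    have "z i \<in> V i" if i: "i < n" for i
    proof -
      have "z i \<in> {0..1}" using PiE_mem[OF z(1)[unfolded topspace_cube], of i] i by simp
      moreover have "\<bar>z i - y i\<bar> < r i" using z(2)[OF i] R(2)[OF i] by simp
      ultimately show ?thesis using r i by simp
    qed
    then have "z \<in> Pi\<^sub>E {..<n} V" using z(1) by (auto simp: topspace_cube PiE_def)
    then show "z \<in> U" using V(3) by blast
  qed
qed

context compact_metrizable
begin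

section \<open>The compact-open topology and uniform distance\<close>

lemma maps_cubeD:
  assumes "continuous_map X (cube n) f"
  shows "x \<in> topspace X \<Longrightarrow> f x \<in> topspace (cube n)" "i < n \<Longrightarrow> cf (topspace X) (\<lambda>x. f x i)"
proof -
  show "x \<in> topspace X \<Longrightarrow> f x \<in> topspace (cube n)" using continuous_map_image_subset_topspace[OF assms] by blast
  show "i < n \<Longrightarrow> cf (topspace X) (\<lambda>x. f x i)"
    using continuous_map_compose[OF assms continuous_map_cube_coord] by (simp add: cf_def o_def)
qed

text \<open>Finitely many cells on which \<open>f\<close> varies little cover the space. Their
  closed versions are compact, so sending each of them into a box around a value of \<open>f\<close>
  is an open condition.\<close>

lemma compact_open_nbhd_in_ball:
  assumes f: "f \<in> maps X (cube n)" and \<eta>: "(0::real) < \<eta>"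
  obtains U where "openin (compact_open X (cube n)) U" "f \<in> U"
    "\<And>g x i. g \<in> U \<Longrightarrow> x \<in> topspace X \<Longrightarrow> i < n \<Longrightarrow> \<bar>g x i - f x i\<bar> \<le> \<eta>"
proof -
  have fc: "continuous_map X (cube n) f" using f by (simp add: maps_def)
  \<comment> \<open>The box of size \<open>\<eta> / 2\<close> is wider than the variation
    \<open>\<eta> / 3\<close> on a cell, so \<open>f\<close> itself qualifies, and both together
    stay below \<open>\<eta>\<close>.\<close>
  define C where "C x = {z \<in> topspace X. \<forall>i\<in>{..<n}. \<bar>f z i - f x i\<bar> \<le> \<eta> / 3}" for x
  define V where "V x = {z \<in> topspace X. \<forall>i\<in>{..<n}. \<bar>f z i - f x i\<bar> < \<eta> / 3}" for x
  define O' where "O' x = {y \<in> topspace (cube n). \<forall>i<n. \<bar>y i - f x i\<bar> < \<eta> / 2}" for x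
  define G where "G x = {g \<in> maps X (cube n). g ` C x \<subseteq> O' x}" for x
  have fi: "cf (topspace X) (\<lambda>x. f x i)" if "i \<in> {..<n}" for i using maps_cubeD(2)[OF fc] that by simp
  have C: "closedin X (C x)" for x
  proof -
    have "C x = topspace X \<inter> (\<Inter>i\<in>{..<n}. {z \<in> topspace X. \<bar>f z i - f x i\<bar> \<le> \<eta> / 3})" by (auto simp: C_def)
    moreover have "closedin X {z \<in> topspace X. \<bar>f z i - f x i\<bar> \<le> \<eta> / 3}" if "i \<in> {..<n}" for i
      by (intro closedin_le closedin_topspace cf_abs cf_diff cf_const fi that)
    ultimately show ?thesis by (cases "n = 0") (auto intro!: closedin_Int closedin_INT)
  qed
  have "openin X (V x) \<and> x \<in> V x" if "x \<in> topspace X" for x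
  proof
    show "openin X (V x)" unfolding V_def
      using openin_ball[where p = "\<lambda>i x. f x i" and J = "{..<n}", OF finite_lessThan fi] by blast
    show "x \<in> V x" using that \<eta> by (simp add: V_def)
  qed
  from finite_subcover[OF closedin_topspace this] obtain F where F: "finite F" "F \<subseteq> topspace X"
    "topspace X \<subseteq> (\<Union>x\<in>F. V x)" by blast
  have G: "openin (compact_open X (cube n)) (G x)" for x
    unfolding compact_open_def
  proof (rule topology_generated_by_Basis)
    show "G x \<in> {{f \<in> maps X (cube n). f ` C \<subseteq> U} |C U. compactin X C \<and> openin (cube n) U}"
      using compact_closed[OF C] openin_cube_box[of n "f x" "\<eta> / 2"] unfolding G_def O'_def by blast
  qed
  show thesis
  proof (rule that[of "maps X (cube n) \<inter> (\<Inter>x\<in>F. G x)"])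
    have "openin (compact_open X (cube n)) (maps X (cube n))"
      using openin_topspace[of "compact_open X (cube n)"] by simp
    then show "openin (compact_open X (cube n)) (maps X (cube n) \<inter> (\<Inter>x\<in>F. G x))"
      using F(1) G by (cases "F = {}") (auto intro!: openin_Int openin_INT2)
    have "f \<in> G x" for x
    proof -
      have "f z \<in> O' x" if z: "z \<in> C x" for z
      proof -
        have zX: "z \<in> topspace X" using z by (simp add: C_def)
        have "\<bar>f z i - f x i\<bar> < \<eta> / 2" if "i < n" for i
        proof -
          have "\<bar>f z i - f x i\<bar> \<le> \<eta> / 3" using z that by (simp add: C_def)
          then show ?thesis using \<eta> by linarith
        qed
        then show ?thesis using maps_cubeD(1)[OF fc zX] by (simp add: O'_def)
      qed
      then show ?thesis using f by (auto simp: G_def)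
    qed
    then show "f \<in> maps X (cube n) \<inter> (\<Inter>x\<in>F. G x)" using f by blast
    fix g z i assume g: "g \<in> maps X (cube n) \<inter> (\<Inter>x\<in>F. G x)" and z: "z \<in> topspace X" and i: "i < n"
    obtain x where x: "x \<in> F" "z \<in> V x" using F(3) z by blast
    have fz: "\<bar>f z i - f x i\<bar> < \<eta> / 3" using x(2) i by (simp add: V_def)
    have "\<forall>i\<in>{..<n}. \<bar>f z i - f x i\<bar> \<le> \<eta> / 3" using x(2) unfolding V_def by (blast intro: less_imp_le)
    then have "z \<in> C x" using z by (simp add: C_def)
    then have "g z \<in> O' x" using g x(1) by (auto simp: G_def)
    then have "\<bar>g z i - f x i\<bar> < \<eta> / 2" using i by (simp add: O'_def)
    then show "\<bar>g z i - f z i\<bar> \<le> \<eta>" using fz \<eta> by linarith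
  qed
qed

text \<open>Induction on the way \<open>U\<close> is generated. Only the subbasic sets have content:
  the compact set is covered by finitely many cells with half radii, which leaves a uniform room
  inside the open set.\<close>

lemma ball_in_compact_open:
  assumes U: "openin (compact_open X (cube n)) U" "f \<in> U"
  shows "\<exists>\<epsilon>>0. \<forall>g\<in>maps X (cube n). (\<forall>x\<in>topspace X. \<forall>i<n. \<bar>g x i - f x i\<bar> < \<epsilon>) \<longrightarrow> g \<in> U"
proof -
  have f: "f \<in> maps X (cube n)" using U openin_subset[OF U(1)] by auto
  have fc: "continuous_map X (cube n) f" using f by (simp add: maps_def)
  have "generate_topology_on {{f \<in> maps X (cube n). f ` C \<subseteq> U} |C U. compactin X C \<and> openin (cube n) U} U"
    using U(1) unfolding compact_open_def by (rule openin_topology_generated_by)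
  then show ?thesis
    using U(2)
  proof (induction U rule: generate_topology_on.induct)
    case (Int a b)
    then obtain e1 e2 :: real where e: "0 < e1" "0 < e2"
      "\<forall>g\<in>maps X (cube n). (\<forall>x\<in>topspace X. \<forall>i<n. \<bar>g x i - f x i\<bar> < e1) \<longrightarrow> g \<in> a"
      "\<forall>g\<in>maps X (cube n). (\<forall>x\<in>topspace X. \<forall>i<n. \<bar>g x i - f x i\<bar> < e2) \<longrightarrow> g \<in> b" by blast
    show ?case
    proof (intro exI[of _ "min e1 e2"] conjI ballI impI)
      show "0 < min e1 e2" using e by simp
      fix g assume "g \<in> maps X (cube n)" "\<forall>x\<in>topspace X. \<forall>i<n. \<bar>g x i - f x i\<bar> < min e1 e2"
      then show "g \<in> a \<inter> b" using e(3,4) by auto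
    qed
  next
    case (UN K)
    then obtain k where "k \<in> K" "f \<in> k" by blast
    with UN.IH show ?case by blast
  next
    case (Basis s)
    then obtain C V where s: "s = {f \<in> maps X (cube n). f ` C \<subseteq> V}" "compactin X C" "openin (cube n) V" by blast
    have C: "closedin X C" using s(2) metrizableX metrizable_imp_Hausdorff_space compactin_imp_closedin by blast
    have CX: "C \<subseteq> topspace X" using C closedin_subset by blast
    have "\<exists>r>0. \<forall>z\<in>topspace (cube n). (\<forall>i<n. \<bar>z i - f x i\<bar> < r) \<longrightarrow> z \<in> V" if x: "x \<in> C" for x
    proof -
      have "f x \<in> V" using Basis.prems s(1) x by auto
      from cube_box_inside[OF s(3) this] show ?thesis by metis
    qed
    then have "\<forall>x\<in>C. \<exists>r. 0 < r \<and> (\<forall>z\<in>topspace (cube n). (\<forall>i<n. \<bar>z i - f x i\<bar> < r) \<longrightarrow> z \<in> V)" by blast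
    then obtain r where r: "\<forall>x\<in>C. 0 < r x \<and> (\<forall>z\<in>topspace (cube n). (\<forall>i<n. \<bar>z i - f x i\<bar> < r x) \<longrightarrow> z \<in> V)"
      by (rule bchoice[THEN exE])
    define B where "B x = {z \<in> topspace X. \<forall>i\<in>{..<n}. \<bar>f z i - f x i\<bar> < r x / 2}" for x
    have fi: "cf (topspace X) (\<lambda>x. f x i)" if "i \<in> {..<n}" for i using maps_cubeD(2)[OF fc] that by simp
    have "openin X (B x) \<and> x \<in> B x" if "x \<in> C" for x
    proof
      show "openin X (B x)" unfolding B_def
        using openin_ball[where p = "\<lambda>i x. f x i" and J = "{..<n}", OF finite_lessThan fi] by blast
      show "x \<in> B x" using that CX r by (auto simp: B_def)
    qed
    from finite_subcover[OF C this] obtain F where F: "finite F" "F \<subseteq> C" "C \<subseteq> (\<Union>x\<in>F. B x)" by blast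
    define e where "e = Min (insert 1 ((\<lambda>x. r x / 2) ` F))"
    have e: "0 < e" "\<And>x. x \<in> F \<Longrightarrow> e \<le> r x / 2"
    proof -
      have "0 < r x / 2" if "x \<in> F" for x using r F(2) that by auto
      then show "0 < e" unfolding e_def using F(1) by (subst Min_gr_iff) auto
      show "e \<le> r x / 2" if "x \<in> F" for x unfolding e_def using F(1) that by (intro Min_le) auto
    qed
    show ?case
    proof (intro exI[of _ e] conjI ballI impI e(1))
      fix g assume g: "g \<in> maps X (cube n)" "\<forall>x\<in>topspace X. \<forall>i<n. \<bar>g x i - f x i\<bar> < e"
      have "g z \<in> V" if z: "z \<in> C" for z
      proof -
        have zX: "z \<in> topspace X" using z CX by blast
        obtain x where x: "x \<in> F" "z \<in> B x" using F(3) z by blast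
        have "\<bar>g z i - f x i\<bar> < r x" if i: "i < n" for i
        proof -
          have "\<bar>g z i - f z i\<bar> < e" using g(2) zX i by blast
          moreover have "\<bar>f z i - f x i\<bar> < r x / 2" using x(2) i by (simp add: B_def)
          ultimately show ?thesis using e(2)[OF x(1)] by linarith
        qed
        moreover have "g z \<in> topspace (cube n)" using maps_cubeD(1)[OF _ zX] g(1) by (simp add: maps_def)
        ultimately show ?thesis using r x(1) F(2) by blast
      qed
      then show "g \<in> s" using g(1) by (auto simp: s(1))
    qed
  qed auto
qed

section \<open>Generic maps\<close>

lemma ext_dim_map_cube_eq_0:
  assumes K: "abstract_simplicial_complex K" "K \<noteq> {}" and f: "continuous_map X (cube n) f"
  shows "ext_dim_map (realization K) X (cube n) f = 0 \<longleftrightarrow>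
    (\<forall>x0\<in>topspace X. AEc (susp_complexes K 0) {x \<in> topspace X. \<forall>i<n. f x i = f x0 i})"
proof -
  have fib: "{x \<in> topspace X. f x = f x0} = {x \<in> topspace X. \<forall>i<n. f x i = f x0 i}" if "x0 \<in> topspace X" for x0
    using cube_eqI[OF maps_cubeD(1)[OF f] maps_cubeD(1)[OF f that]] by auto
  have cl: "closedin X {x \<in> topspace X. \<forall>i<n. f x i = f x0 i}" for x0
    using closedin_fibre[where p = "\<lambda>i x. f x i" and J = "{..<n}", OF closedin_topspace finite_lessThan] maps_cubeD(2)[OF f]
    by (simp add: Ball_def)
  have dim: "ext_dim_le (realization K) (subtopology X {x \<in> topspace X. f x = f x0}) 0 \<longleftrightarrow>
      AEc (susp_complexes K 0) {x \<in> topspace X. \<forall>i<n. f x i = f x0 i}" if "x0 \<in> topspace X" for x0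
    unfolding fib[OF that] by (rule ext_dim_le_iff_AEc[OF K cl])
  show ?thesis
    unfolding ext_dim_map_eq_0
  proof (intro iffI ballI)
    fix x0 assume "\<forall>y\<in>topspace (cube n). ext_dim_le (realization K) (subtopology X {x \<in> topspace X. f x = y}) 0" "x0 \<in> topspace X"
    then show "AEc (susp_complexes K 0) {x \<in> topspace X. \<forall>i<n. f x i = f x0 i}"
      using dim maps_cubeD(1)[OF f] by blast
  next
    fix y assume *: "\<forall>x0\<in>topspace X. AEc (susp_complexes K 0) {x \<in> topspace X. \<forall>i<n. f x i = f x0 i}"
      and y: "y \<in> topspace (cube n)"
    show "ext_dim_le (realization K) (subtopology X {x \<in> topspace X. f x = y}) 0"
    proof (cases "{x \<in> topspace X. f x = y} = {}")
      case True
      show ?thesis unfolding True ext_dim_le_iff_AEc[OF K closedin_empty] by (rule AEc_empty)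
    next
      case False
      then obtain x0 where "x0 \<in> topspace X" "f x0 = y" by blast
      then show ?thesis using * dim by blast
    qed
  qed
qed

text \<open>Each test problem defines an open set of maps, because solvability on all fibres
  survives small perturbations. The countable intersection consists of the generic maps, because the
  tests detect the extension property.\<close>

lemma gdelta_generic_maps:
  assumes K: "abstract_simplicial_complex K" "K \<noteq> {}" "countable (\<Union>K)"
  shows "gdelta_in (compact_open X (cube n)) {f \<in> maps X (cube n). ext_dim_map (realization K) X (cube n) f = 0}"
proof -
  let ?K = "susp_complexes K 0"
  have K0: "abstract_simplicial_complex ?K" "countable (\<Union>?K)"
    using susp_tower_complex[OF susp_tower_susp_complexes[OF K], of 0] by blast+
  obtain B :: "nat \<Rightarrow> 'a set" and \<psi> where
    B: "\<And>i. closedin X (B i)" "\<And>i. cm ?K (B i) (\<psi> i)"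
    "\<And>F. closedin X F \<Longrightarrow> (\<And>i. extends_over ?K (B i) (\<psi> i) F) \<Longrightarrow> AEc ?K F"
    using detecting_family[OF K0] by blast
  define G where "G k = {f \<in> maps X (cube n). \<forall>x0\<in>topspace X. extends_over ?K (B k) (\<psi> k) {x \<in> topspace X. \<forall>i\<in>{..<n}. f x i = f x0 i}}" for k
  have fi: "cf (topspace X) (\<lambda>x. f x i)" if "f \<in> maps X (cube n)" "i \<in> {..<n}" for f i
  proof -
    have "continuous_map X (cube n) f" using that by (simp add: maps_def)
    from maps_cubeD(2)[OF this] show ?thesis using that(2) by simp
  qed
  have cl: "closedin X {x \<in> topspace X. \<forall>i\<in>{..<n}. f x i = f x0 i}" if "f \<in> maps X (cube n)" for f x0
    using closedin_fibre[where p = "\<lambda>i x. f x i", OF closedin_topspace finite_lessThan fi[OF that]] by blast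
  have "openin (compact_open X (cube n)) (G k)" for k
    unfolding openin_subopen[of _ "G k"]
  proof
    fix f assume f: "f \<in> G k"
    then have fm: "f \<in> maps X (cube n)" by (simp add: G_def)
    have good: "extends_over ?K (B k) (\<psi> k) {x \<in> topspace X. \<forall>i\<in>{..<n}. f x i = f x0 i}" if "x0 \<in> topspace X" for x0
      using f that by (simp add: G_def)
    have dl: "cf (topspace X) (\<lambda>_. 0)" by simp
    obtain \<eta> where \<eta>: "0 < \<eta>"
      "\<And>P' x0. (\<And>i x. i \<in> {..<n} \<Longrightarrow> x \<in> topspace X \<Longrightarrow> \<bar>P' i x - f x i\<bar> \<le> \<eta>) \<Longrightarrow> x0 \<in> topspace X \<Longrightarrow> \<bar>0::real\<bar> \<le> \<eta> \<Longrightarrow>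
        extends_over ?K (B k) (\<psi> k) {x \<in> topspace X. \<forall>i\<in>{..<n}. P' i x = P' i x0}"
      by (rule extends_over_fibres_stable[where P = "\<lambda>i x. f x i", OF K0(1) closedin_topspace finite_lessThan fi[OF fm] dl B(1,2) good])
        (assumption | blast)+
    obtain U where U: "openin (compact_open X (cube n)) U" "f \<in> U"
      "\<And>g x i. g \<in> U \<Longrightarrow> x \<in> topspace X \<Longrightarrow> i < n \<Longrightarrow> \<bar>g x i - f x i\<bar> \<le> \<eta>"
      using compact_open_nbhd_in_ball[OF fm \<eta>(1)] by blast
    have "U \<subseteq> G k"
    proof
      fix g assume g: "g \<in> U"
      have "g \<in> maps X (cube n)" using openin_subset[OF U(1)] g by auto
      moreover have "extends_over ?K (B k) (\<psi> k) {x \<in> topspace X. \<forall>i\<in>{..<n}. g x i = g x0 i}" if "x0 \<in> topspace X" for x0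
        by (rule \<eta>(2)[of "\<lambda>i x. g x i" x0]) (use U(3)[OF g] that \<eta>(1) in auto)
      ultimately show "g \<in> G k" by (simp add: G_def)
    qed
    then show "\<exists>T. openin (compact_open X (cube n)) T \<and> f \<in> T \<and> T \<subseteq> G k" using U by blast
  qed
  then have "gdelta_in (compact_open X (cube n)) (\<Inter>(range G))"
    by (intro gdelta_in_Inter) (auto intro: open_imp_gdelta_in)
  moreover have "{f \<in> maps X (cube n). ext_dim_map (realization K) X (cube n) f = 0} = \<Inter>(range G)"
  proof (intro set_eqI iffI)
    fix f assume f: "f \<in> {f \<in> maps X (cube n). ext_dim_map (realization K) X (cube n) f = 0}"
    then have fm: "f \<in> maps X (cube n)" "continuous_map X (cube n) f" by (auto simp: maps_def)
    have "AEc ?K {x \<in> topspace X. \<forall>i\<in>{..<n}. f x i = f x0 i}" if "x0 \<in> topspace X" for x0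
      using f ext_dim_map_cube_eq_0[OF K(1,2) fm(2)] that by (simp add: Ball_def)
    then show "f \<in> \<Inter>(range G)"
      using fm(1) AEc_extends_over[OF _ cl[OF fm(1)] B(1,2)] by (auto simp: G_def)
  next
    fix f assume f: "f \<in> \<Inter>(range G)"
    then have fm: "f \<in> maps X (cube n)" "continuous_map X (cube n) f" by (auto simp: G_def maps_def)
    have "AEc ?K {x \<in> topspace X. \<forall>i\<in>{..<n}. f x i = f x0 i}" if "x0 \<in> topspace X" for x0
      by (rule B(3)[OF cl[OF fm(1)]]) (use f that in \<open>simp add: G_def\<close>)
    then have "ext_dim_map (realization K) X (cube n) f = 0"
      unfolding ext_dim_map_cube_eq_0[OF K(1,2) fm(2)] by (simp add: Ball_def)
    then show "f \<in> {f \<in> maps X (cube n). ext_dim_map (realization K) X (cube n) f = 0}" using fm by simp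
  qed
  ultimately show ?thesis by simp
qed

lemma dense_generic_maps:
  assumes K: "abstract_simplicial_complex K" "K \<noteq> {}" "countable (\<Union>K)" and dim: "ext_dim_le (realization K) X n"
  shows "compact_open X (cube n) closure_of {f \<in> maps X (cube n). ext_dim_map (realization K) X (cube n) f = 0} = maps X (cube n)"
    (is "_ closure_of ?Z = _")
proof
  show "compact_open X (cube n) closure_of ?Z \<subseteq> maps X (cube n)"
    using closure_of_subset_topspace[of "compact_open X (cube n)" ?Z] by simp
  show "maps X (cube n) \<subseteq> compact_open X (cube n) closure_of ?Z"
  proof
    fix f assume f: "f \<in> maps X (cube n)"
    then have fc: "continuous_map X (cube n) f" by (simp add: maps_def)
    show "f \<in> compact_open X (cube n) closure_of ?Z"
      unfolding in_closure_of
    proof (intro conjI allI impI)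
      show "f \<in> topspace (compact_open X (cube n))" using f by simp
      fix U assume "f \<in> U \<and> openin (compact_open X (cube n)) U"
      then obtain \<epsilon> where \<epsilon>: "0 < \<epsilon>"
        "\<forall>g\<in>maps X (cube n). (\<forall>x\<in>topspace X. \<forall>i<n. \<bar>g x i - f x i\<bar> < \<epsilon>) \<longrightarrow> g \<in> U"
        using ball_in_compact_open by blast
      define \<eta> where "\<eta> = min (\<epsilon> / 4) (1 / 4)"
      have \<eta>: "0 < \<eta>" "\<eta> \<le> 1 / 4" "\<eta> \<le> \<epsilon> / 4" using \<epsilon>(1) by (auto simp: \<eta>_def)
      \<comment> \<open>A contraction of the values into the interval from \<open>\<eta>\<close> to
        \<open>1 - \<eta>\<close>: a perturbation below \<open>\<eta>\<close> stays in the cube, and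
        both changes together move \<open>f\<close> by less than \<open>2 * \<eta>\<close>, which is
        at most \<open>\<epsilon> / 2\<close>.\<close>
      define f0 where "f0 i x = (1 - 2 * \<eta>) * f x i + \<eta>" for i x
      have f0: "cf (topspace X) (f0 i)" if "i < n" for i
        unfolding f0_def by (intro cf_add cf_mult cf_const maps_cubeD(2)[OF fc that])
      have ae: "AEc (susp_complexes K n) (topspace X)"
        using dim ext_dim_le_iff_AEc[OF K(1,2) closedin_topspace] by simp
      obtain h where h: "\<And>i. i < n \<Longrightarrow> cf (topspace X) (h i)"
        "\<And>i x. i < n \<Longrightarrow> x \<in> topspace X \<Longrightarrow> \<bar>h i x - f0 i x\<bar> < \<eta>"
        "\<And>x0. x0 \<in> topspace X \<Longrightarrow> AEc (susp_complexes K 0) {x \<in> topspace X. \<forall>i<n. h i x = h i x0}"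
        by (rule generic_fibres_of_tower[where n = n and ?f0.0 = f0, OF susp_tower_susp_complexes[OF K] ae f0 \<eta>(1)])
          (assumption | rule that)+
      have fx: "0 \<le> f x i \<and> f x i \<le> 1" if "x \<in> topspace X" "i < n" for x i
        using PiE_mem[OF maps_cubeD(1)[OF fc that(1), unfolded topspace_cube], of i] that(2) by simp
      have bnd: "0 \<le> h i x \<and> h i x \<le> 1 \<and> \<bar>h i x - f x i\<bar> < \<epsilon>" if x: "x \<in> topspace X" and i: "i < n" for x i
      proof -
        have "0 \<le> \<eta> * f x i" "\<eta> * f x i \<le> \<eta> * 1" using fx[OF x i] \<eta>(1) by (auto intro: mult_left_mono)
        then have a: "\<bar>f0 i x - f x i\<bar> \<le> \<eta>" by (simp add: f0_def algebra_simps abs_le_iff)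
        have "0 \<le> (1 - 2 * \<eta>) * f x i" "(1 - 2 * \<eta>) * f x i \<le> (1 - 2 * \<eta>) * 1"
          using fx[OF x i] \<eta>(2) by (auto intro: mult_left_mono)
        then have b: "\<eta> \<le> f0 i x" "f0 i x \<le> 1 - \<eta>" by (simp_all add: f0_def)
        have "\<bar>h i x - f0 i x\<bar> < \<eta>" using h(2)[OF i x] .
        then show ?thesis using a b \<eta>(3) \<epsilon>(1) by linarith
      qed
      define g where "g = restrict (\<lambda>x. restrict (\<lambda>i. h i x) {..<n}) (topspace X)"
      have gx: "g x i = h i x" if "x \<in> topspace X" "i < n" for x i using that by (simp add: g_def)
      have "continuous_map X (cube n) g"
        unfolding cube_def continuous_map_componentwise
      proof (intro conjI ballI)
        show "g ` topspace X \<subseteq> extensional {..<n}" by (auto simp: g_def)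
        fix i assume "i \<in> {..<n}"
        then have i: "i < n" by simp
        have "continuous_map X euclideanreal (h i)" using h(1)[OF i] by (simp add: cf_def)
        then have "continuous_map X (top_of_set {0..1}) (h i)" using bnd i by (auto simp: continuous_map_in_subtopology)
        then show "continuous_map X (top_of_set {0..1}) (\<lambda>x. g x i)"
          by (rule continuous_map_eq) (simp add: gx i)
      qed
      then have gm: "g \<in> maps X (cube n)" and gc: "continuous_map X (cube n) g" by (auto simp: maps_def g_def)
      have "g \<in> U" using \<epsilon>(2) gm bnd gx by simp
      moreover have "ext_dim_map (realization K) X (cube n) g = 0"
        unfolding ext_dim_map_cube_eq_0[OF K(1,2) gc]
      proof
        fix x0 assume x0: "x0 \<in> topspace X"
        have "{x \<in> topspace X. \<forall>i<n. g x i = g x0 i} = {x \<in> topspace X. \<forall>i<n. h i x = h i x0}"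
          using gx x0 by auto
        then show "AEc (susp_complexes K 0) {x \<in> topspace X. \<forall>i<n. g x i = g x0 i}" using h(3)[OF x0] by simp
      qed
      ultimately show "\<exists>y. y \<in> ?Z \<and> y \<in> U" using gm by blast
    qed
  qed
qed

lemma ext_dim_le_of_map:
  assumes K: "abstract_simplicial_complex K" "K \<noteq> {}" "countable (\<Union>K)"
    and f: "continuous_map X (cube n) f" "ext_dim_map (realization K) X (cube n) f = 0"
  shows "ext_dim_le (realization K) X n"
proof -
  have "AEc (susp_complexes K n) (topspace X)"
    using f(2) unfolding ext_dim_map_cube_eq_0[OF K(1,2) f(1)]
    by (intro AEc_tower_of_fibres[OF susp_tower_susp_complexes[OF K], where f = "\<lambda>i x. f x i"] maps_cubeD(2)[OF f(1)]) auto
  then show ?thesis using ext_dim_le_iff_AEc[OF K(1,2) closedin_topspace] by simp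
qed

end

text \<open>A dense subset of a nonempty space is nonempty, which is how (iii) follows from
  (ii).\<close>

lemma maps_cube_nonempty: "maps X (cube n) \<noteq> {}"
proof -
  let ?c = "restrict (\<lambda>x. restrict (\<lambda>i. 0) {..<n}) (topspace X)"
  have "continuous_map X (cube n) (\<lambda>x. restrict (\<lambda>i. 0) {..<n})"
    by (simp add: topspace_cube)
  then have "continuous_map X (cube n) ?c" by (rule continuous_map_eq) simp
  then have "?c \<in> maps X (cube n)" by (simp add: maps_def)
  then show ?thesis by blast
qed

lemma topspace_iter_suspension_empty:
  "topspace T = {} \<Longrightarrow> topspace (iter_suspension n T) = {}"
  by (induction n) (auto simp: suspension_def)

text \<open>Extending the map from the empty set already requires a map from \<open>X\<close> into
  the iterated suspension, which is empty. The complexes with poles do not describe this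
  case.\<close>

lemma ext_dim_le_empty_complex:
  "ext_dim_le (realization ({} :: 'v set set)) X n \<longleftrightarrow> topspace X = {}"
proof
  have "realization_carrier ({} :: 'v set set) = {}" by (simp add: realization_carrier_def)
  then have e: "topspace (iter_suspension n (realization ({} :: 'v set set))) = {}" for n
    by (intro topspace_iter_suspension_empty) simp
  show "topspace X = {}" if d: "ext_dim_le (realization ({} :: 'v set set)) X n"
  proof -
    let ?T = "iter_suspension n (realization ({} :: 'v set set))" and ?f = "\<lambda>_. undefined"
    have "continuous_map (subtopology X {}) ?T ?f"
      by (simp add: subtopology_eq_discrete_topology_empty)
    moreover have "closedin X {} \<and> continuous_map (subtopology X {}) ?T ?f \<longrightarrow>
        (\<exists>g. continuous_map X ?T g \<and> (\<forall>x\<in>{}. g x = ?f x))"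
      using d unfolding ext_dim_le_def absolute_extensor_def by (elim allE)
    ultimately obtain g where g: "continuous_map X ?T g" by auto
    have "g ` topspace X \<subseteq> {}" using continuous_map_image_subset_topspace[OF g] unfolding e .
    then show ?thesis by simp
  qed
  show "ext_dim_le (realization ({} :: 'v set set)) X n" if "topspace X = {}"
    using that closedin_subset[of X] unfolding ext_dim_le_def absolute_extensor_def
    by (auto simp: continuous_map_def)
qed

theorem theorem4p9:
  fixes K :: "'v set set" and X :: "'a topology" and n :: nat
  assumes "abstract_simplicial_complex K"
    and "locally_finite_complex K"
    and "countable K"
    and "compact_space X"
    and "metrizable_space X"
    and "1 \<le> n"
  defines "L \<equiv> realization K"
  defines "Z \<equiv> {f \<in> maps X (cube n). ext_dim_map L X (cube n) f = 0}"
  shows "(ext_dim_le L X n \<longleftrightarrow>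
            gdelta_in (compact_open X (cube n)) Z \<and>
            compact_open X (cube n) closure_of Z = maps X (cube n)) \<and>
         (ext_dim_le L X n \<longleftrightarrow>
            (\<exists>f. continuous_map X (cube n) f \<and> ext_dim_map L X (cube n) f = 0))"
proof -
  interpret compact_metrizable X by unfold_locales (fact assms)+
  have "finite s" if "s \<in> K" for s using assms(1) that unfolding abstract_simplicial_complex_def by simp
  then have count: "countable (\<Union>K)" using assms(3) by (intro countable_UN[of K "\<lambda>s. s", simplified]) (auto intro: countable_finite)
  have main: "gdelta_in (compact_open X (cube n)) Z" "ext_dim_le L X n \<Longrightarrow> compact_open X (cube n) closure_of Z = maps X (cube n)"
    "continuous_map X (cube n) f \<Longrightarrow> ext_dim_map L X (cube n) f = 0 \<Longrightarrow> ext_dim_le L X n" for f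
  proof -
    show "gdelta_in (compact_open X (cube n)) Z"
    proof (cases "K = {}")
      case True
      \<comment> \<open>Without simplices a map is generic only if \<open>X\<close> is empty, and
        then every map is; either way \<open>Z\<close> is open.\<close>
      have "Z = {} \<or> Z = maps X (cube n)"
      proof (cases "topspace X = {}")
        case X: True
        have "ext_dim_map L X (cube n) f = 0" for f
          unfolding L_def True ext_dim_map_eq_0 ext_dim_le_empty_complex using X by simp
        then show ?thesis by (simp add: Z_def)
      next
        case False
        then obtain x where x: "x \<in> topspace X" by blast
        have "ext_dim_map L X (cube n) f \<noteq> 0" if f: "f \<in> maps X (cube n)" for f
        proof
          assume "ext_dim_map L X (cube n) f = 0"
          then have "topspace (subtopology X {z \<in> topspace X. f z = f x}) = {}"
            unfolding L_def True ext_dim_map_eq_0 ext_dim_le_empty_complex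
            using maps_cubeD(1)[of n f x] f x by (simp add: maps_def)
          then show False using x by auto
        qed
        then show ?thesis by (auto simp: Z_def)
      qed
      then show ?thesis
        using openin_topspace[of "compact_open X (cube n)"] by (auto intro: open_imp_gdelta_in)
    next
      case False
      then show ?thesis unfolding Z_def L_def using gdelta_generic_maps assms(1) count by blast
    qed
    show "compact_open X (cube n) closure_of Z = maps X (cube n)" if d: "ext_dim_le L X n"
    proof (cases "K = {}")
      case True
      have X: "topspace X = {}" using d unfolding L_def True ext_dim_le_empty_complex .
      have "ext_dim_map L X (cube n) f = 0" for f
        unfolding L_def True ext_dim_map_eq_0 ext_dim_le_empty_complex using X by simp
      then have "Z = topspace (compact_open X (cube n))" by (simp add: Z_def)
      then show ?thesis using closure_of_topspace[of "compact_open X (cube n)"] by simp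
    next
      case False
      then show ?thesis unfolding Z_def L_def using dense_generic_maps assms(1) count d by (simp add: L_def)
    qed
    show "ext_dim_le L X n" if f: "continuous_map X (cube n) f" "ext_dim_map L X (cube n) f = 0"
    proof (cases "K = {}")
      case True
      have "topspace X = {}"
      proof (rule ccontr)
        assume "topspace X \<noteq> {}"
        then obtain x where x: "x \<in> topspace X" by blast
        have "topspace (subtopology X {z \<in> topspace X. f z = f x}) = {}"
          using f(2) maps_cubeD(1)[OF f(1) x] unfolding L_def True ext_dim_map_eq_0 ext_dim_le_empty_complex by simp
        then show False using x by auto
      qed
      then show ?thesis unfolding L_def True ext_dim_le_empty_complex .
    next
      case False
      then show ?thesis using ext_dim_le_of_map assms(1) count f by (simp add: L_def)
    qed
  qed
  have "\<exists>f. continuous_map X (cube n) f \<and> ext_dim_map L X (cube n) f = 0"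
    if "compact_open X (cube n) closure_of Z = maps X (cube n)"
  proof -
    have "Z \<noteq> {}" using that maps_cube_nonempty[of X n] by (metis closure_of_empty)
    then show ?thesis by (auto simp: Z_def maps_def)
  qed
  then show ?thesis using main by blast
qed

end
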